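(* Let $\nu>-\frac12$ and let $\mathbf{m}=\begin{pmatrix}a&b\\c&d\end{pmatrix}\in SL(2,\mathbb{R})$ with $b\neq0$. 1) Let $f,g\in\mathcal{L}_{1,\nu}$. Then for all $x\in\mathbb{R}$, $$\frac{c_\nu}{(ib)^{\nu+1}}\,\mathcal{F}_\nu^{\mathbf{m}}\left(f\underset{\nu,\mathbf{m}^{-1}}{*}g\right)(x)=e^{-\frac i2\frac db x^2}\,\mathcal{F}_\nu^{\mathbf{m}}f(x)\,\mathcal{F}_\nu^{\mathbf{m}}g(x).$$ 2) Let $f\in\mathcal{L}_{1,\nu}$ and $g\in\mathcal{L}_{p,\nu}$ with $p\in\,]1,2]$. Then for almost every $x$, $$\frac{c_\nu}{(ib)^{\nu+1}}\,\mathcal{F}_\nu^{\mathbf{m}}\left(f\underset{\nu,\mathbf{m}^{-1}}{*}g\right)(x)=e^{-\frac i2\frac db x^2}\,\mathcal{F}_\nu^{\mathbf{m}}f(x)\,\mathcal{F}_\nu^{\mathbf{m}}g(x).$$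
   Context: $\mathcal{L}_{p,\nu}$ is the Lebesgue space on $[0,+\infty[$ with norm $\|f\|_{p,\nu}=\left(\int_0^{+\infty}|f(y)|^py^{2\nu+1}dy\right)^{1/p}$. Let $c_\nu^{-1}=2^\nu\Gamma(\nu+1)$, $j_\nu(x)=\sum_{n\ge0}(-1)^n\frac{\Gamma(\nu+1)}{n!\,\Gamma(n+\nu+1)}\left(\frac x2\right)^{2n}$ and $K_\nu^{\mathbf{m}}(x,y)=e^{\frac i2(\frac db x^2+\frac ab y^2)}j_\nu\left(\frac{xy}b\right)$. The canonical Fourier Bessel transform of $f\in\mathcal{L}_{1,\nu}$ is $$\mathcal{F}_\nu^{\mathbf{m}}f(x)=\frac{c_\nu}{(ib)^{\nu+1}}\int_0^{+\infty}K_\nu^{\mathbf{m}}(x,y)f(y)y^{2\nu+1}dy$$ (principal branch of the power). For $1<p\le2$, $1/p+1/q=1$, it extends by continuity from $\mathcal{L}_{1,\nu}\cap\mathcal{L}_{p,\nu}$ to a bounded operator $\mathcal{L}_{p,\nu}\to\mathcal{L}_{q,\nu}$. The Bessel translation is $T_x^\nu f(y)=\frac{\Gamma(\nu+1)}{\sqrt\pi\,\Gamma(\nu+1/2)}\int_0^\pi f\left(\sqrt{x^2+y^2-2xy\cos\theta}\right)(\sin\theta)^{2\nu}d\theta$ (for $f\in\mathcal{L}_{p,\nu}$, defined for almost every $y\geq 0$). Since $\mathbf{m}^{-1}=\begin{pmatrix}d&-b\\-c&a\end{pmatrix}$, the translation and convolution associated with $\mathbf{m}^{-1}$ are $$T_x^{\nu,\mathbf{m}^{-1}}f(y)=e^{-\frac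 i2\frac ab(x^2+y^2)}T_x^\nu\left[s\mapsto e^{\frac i2\frac ab s^2}f(s)\right](y),\qquad \left(f\underset{\nu,\mathbf{m}^{-1}}{*}g\right)(x)=\int_0^{+\infty}\left[T_x^{\nu,\mathbf{m}^{-1}}f(y)\right]\left[e^{i\frac ab y^2}g(y)\right]y^{2\nu+1}dy .$$ *)

theory Defs
  imports "HOL-Analysis.Analysis"
begin

text \<open>
  Functions on \<open>[0, \<infinity>[\<close> are represented by functions \<open>real \<Rightarrow> complex\<close>; their values at negative
  arguments are irrelevant, because all measures below live on \<open>{0..}\<close>. The matrix
  \<open>m :: real^2^2\<close> has the entries \<open>a = m$1$1\<close>, \<open>b = m$1$2\<close>, \<open>c = m$2$1\<close>, \<open>d = m$2$2\<close>.
\<close>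

definition bessel_measure :: "real \<Rightarrow> real measure" where
  "bessel_measure \<nu> = density (lebesgue_on {0..}) (\<lambda>y. ennreal (y powr (2 * \<nu> + 1)))"

definition Lp :: "real \<Rightarrow> real \<Rightarrow> (real \<Rightarrow> complex) set" where
  "Lp p \<nu> = {f \<in> borel_measurable (bessel_measure \<nu>).
              integrable (bessel_measure \<nu>) (\<lambda>y. cmod (f y) powr p)}"

definition Lp_norm :: "real \<Rightarrow> real \<Rightarrow> (real \<Rightarrow> complex) \<Rightarrow> real" where
  "Lp_norm p \<nu> f = (\<integral>y. cmod (f y) powr p \<partial>bessel_measure \<nu>) powr (1 / p)"

definition c_const :: "real \<Rightarrow> real" where
  "c_const \<nu> = 1 / (2 powr \<nu> * Gamma (\<nu> + 1))"

definition bessel_j :: "real \<Rightarrow> real \<Rightarrow> real" where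
  "bessel_j \<nu> x =
     (\<Sum>n. (-1) ^ n * (Gamma (\<nu> + 1) / (fact n * Gamma (real n + \<nu> + 1))) * (x / 2) ^ (2 * n))"

definition kernel_K :: "real \<Rightarrow> real^2^2 \<Rightarrow> real \<Rightarrow> real \<Rightarrow> complex" where
  "kernel_K \<nu> m x y =
     exp (\<i> / 2 * of_real (m$2$2 / m$1$2 * x\<^sup>2 + m$1$1 / m$1$2 * y\<^sup>2)) *
     of_real (bessel_j \<nu> (x * y / m$1$2))"

text \<open>The factor \<open>c\<^sub>\<nu> / (i b)\<^bsup>\<nu>+1\<^esup>\<close>; \<open>powr\<close> on \<open>complex\<close> is the principal branch.\<close>

definition cfb_factor :: "real \<Rightarrow> real^2^2 \<Rightarrow> complex" where
  "cfb_factor \<nu> m = of_real (c_const \<nu>) / (\<i> * of_real (m$1$2)) powr of_real (\<nu> + 1)"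

definition cfb_transform :: "real \<Rightarrow> real^2^2 \<Rightarrow> (real \<Rightarrow> complex) \<Rightarrow> real \<Rightarrow> complex" where
  "cfb_transform \<nu> m f x = cfb_factor \<nu> m * (\<integral>y. kernel_K \<nu> m x y * f y \<partial>bessel_measure \<nu>)"

text \<open>
  \<open>E\<close> acts on representatives of the classes in \<open>Lp p \<nu>\<close>, so linearity and the extension property
  are required up to null sets only.
\<close>

definition is_bounded_extension ::
    "real \<Rightarrow> real^2^2 \<Rightarrow> real \<Rightarrow> real \<Rightarrow> ((real \<Rightarrow> complex) \<Rightarrow> real \<Rightarrow> complex) \<Rightarrow> bool" where
  "is_bounded_extension \<nu> m p q E \<longleftrightarrow>
     (\<forall>f \<in> Lp p \<nu>. E f \<in> Lp q \<nu>) \<and>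
     (\<forall>f \<in> Lp p \<nu>. \<forall>g \<in> Lp p \<nu>.
        AE x in bessel_measure \<nu>. E (\<lambda>y. f y + g y) x = E f x + E g x) \<and>
     (\<forall>k. \<forall>f \<in> Lp p \<nu>. AE x in bessel_measure \<nu>. E (\<lambda>y. k * f y) x = k * E f x) \<and>
     (\<exists>C. \<forall>f \<in> Lp p \<nu>. Lp_norm q \<nu> (E f) \<le> C * Lp_norm p \<nu> f) \<and>
     (\<forall>f \<in> Lp 1 \<nu> \<inter> Lp p \<nu>. AE x in bessel_measure \<nu>. E f x = cfb_transform \<nu> m f x)"

text \<open>
  The transform on \<open>Lp p \<nu>\<close> for \<open>1 < p \<le> 2\<close>, with conjugate exponent \<open>q = p / (p - 1)\<close>. Since
  \<open>Lp 1 \<nu> \<inter> Lp p \<nu>\<close> is dense in \<open>Lp p \<nu>\<close>, the bounded extension is unique up to null sets; the choice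
  operator only picks representatives.
\<close>

definition cfb_transform_Lp ::
    "real \<Rightarrow> real^2^2 \<Rightarrow> real \<Rightarrow> (real \<Rightarrow> complex) \<Rightarrow> real \<Rightarrow> complex" where
  "cfb_transform_Lp \<nu> m p = (SOME E. is_bounded_extension \<nu> m p (p / (p - 1)) E)"

text \<open>
  The integrals below are \<open>0\<close> by convention at the null set of points where they do not converge.
\<close>

definition bessel_translation :: "real \<Rightarrow> real \<Rightarrow> (real \<Rightarrow> complex) \<Rightarrow> real \<Rightarrow> complex" where
  "bessel_translation \<nu> x f y =
     of_real (Gamma (\<nu> + 1) / (sqrt pi * Gamma (\<nu> + 1 / 2))) *
     (\<integral>\<theta>. f (sqrt (x\<^sup>2 + y\<^sup>2 - 2 * x * y * cos \<theta>)) * of_real (sin \<theta> powr (2 * \<nu>))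
        \<partial>lebesgue_on {0..pi})"

text \<open>The translation and convolution associated with the inverse of \<open>m\<close>, in the entries of \<open>m\<close>.\<close>

definition translation_inv ::
    "real \<Rightarrow> real^2^2 \<Rightarrow> real \<Rightarrow> (real \<Rightarrow> complex) \<Rightarrow> real \<Rightarrow> complex" where
  "translation_inv \<nu> m x f y =
     exp (- (\<i> / 2) * of_real (m$1$1 / m$1$2 * (x\<^sup>2 + y\<^sup>2))) *
     bessel_translation \<nu> x (\<lambda>s. exp (\<i> / 2 * of_real (m$1$1 / m$1$2 * s\<^sup>2)) * f s) y"

definition convolution_inv ::
    "real \<Rightarrow> real^2^2 \<Rightarrow> (real \<Rightarrow> complex) \<Rightarrow> (real \<Rightarrow> complex) \<Rightarrow> real \<Rightarrow> complex" where
  "convolution_inv \<nu> m f g x =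
     (\<integral>y. translation_inv \<nu> m x f y * (exp (\<i> * of_real (m$1$1 / m$1$2 * y\<^sup>2)) * g y)
        \<partial>bessel_measure \<nu>)"

end

theory Submission
  imports Defs "HOL-Probability.Probability_Measure"
begin

text \<open>
  Multiplying by the chirp \<open>e\<^bsup>(i/2)(a/b)y\<^sup>2\<^esup>\<close> removes the matrix from the problem. If \<open>F\<close> and \<open>G\<close> are the
  chirped versions of \<open>f\<close> and \<open>g\<close>, the canonical transform of \<open>f\<close> at \<open>x\<close> is a chirp in \<open>x\<close> times the
  Hankel transform of \<open>F\<close> at \<open>x/b\<close> (\<open>cfb_transform_eq\<close>), and the convolution of \<open>f\<close> and \<open>g\<close> is a chirp
  in \<open>x\<close> times the classical Bessel convolution of \<open>F\<close> and \<open>G\<close> (\<open>convolution_inv_eq\<close>). The first part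
  therefore says that the Hankel transform turns the Bessel convolution into a product
  (\<open>hankel_bessel_conv\<close>). By Fubini this follows from two facts.

  \<^item> The functions \<open>j\<^sub>\<nu>(t \<cdot>)\<close> are eigenfunctions of all Bessel translations
    (\<open>bessel_j_product_formula\<close>). Both sides are power series in the squares of the arguments; the
    angular integrals of the powers are known from the moments of the cosine, and comparing coefficients
    leaves the identity of Chu and Vandermonde.
  \<^item> The Bessel translations are self-adjoint (\<open>translate_self_adjoint\<close>). The weight
    \<open>x\<^bsup>2\<nu>+1\<^esup> sin\<^bsup>2\<nu>\<^esup> \<theta> dx d\<theta>\<close> is the measure \<open>v\<^bsup>2\<nu>\<^esup> du dv\<close> on the upper half-plane in polar
    coordinates, and \<open>x\<close> and \<open>(x\<^sup>2 + y\<^sup>2 - 2xy cos \<theta>)\<^bsup>1/2\<^esup>\<close> are the distances of a point from \<open>(0,0)\<close> and from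
    \<open>(y,0)\<close>. The reflection in the line \<open>u = y/2\<close> preserves that measure and exchanges the two distances
    (\<open>nn_integral_side_symmetric\<close>).

  The second part needs a proof that the bounded extension to \<open>L\<^sup>p\<close> exists, that is, a Hausdorff-Young
  inequality, with any constant. The bound from \<open>L\<^sup>1\<close> to \<open>L\<^sup>\<infinity>\<close> is \<open>|j\<^sub>\<nu>| \<le> 1\<close>, which is read off from
  Poisson's integral. For \<open>L\<^sup>2\<close>, damp the square of the Hankel transform by \<open>e\<^bsup>-\<epsilon>t\<^sup>2\<^esup>\<close>: by the product
  formula the resulting quadratic form has a kernel that is a translate of a Gaussian, hence nonnegative,
  and whose total mass does not depend on \<open>\<epsilon>\<close>, so that Schur's test applies and \<open>\<epsilon>\<close> can be sent to \<open>0\<close>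
  (\<open>hankel_L2_bound\<close>). Cutting functions at a height that depends on the level of the transform
  interpolates between these bounds as in Marcinkiewicz' theorem (\<open>interpolation_lt_2\<close>), and limits of the
  transforms of truncations define the extension (\<open>hausdorff_young_extension\<close>).

  Given any bounded extension, the identity on \<open>L\<^sup>p\<close> follows by density: Young's inequality
  (\<open>bessel_conv_Lp\<close>) makes both sides continuous in \<open>g\<close>, and the part of \<open>g\<close> where \<open>|g| \<ge> 1/n\<close> belongs to
  \<open>L\<^sup>1 \<inter> L\<^sup>p\<close>, where the first part applies.

  The functions in question are Lebesgue measurable only. Fubini's theorem is used for Borel functions on
  products, so that every function is first replaced by a Borel function that agrees with it almost
  everywhere (\<open>borel_version_exists\<close>); translations respect this replacement (\<open>AE_side\<close>).
\<close>

section \<open>Change of variables on the line\<close>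

text \<open>
  The integral of \<open>|f|\<^sup>p\<close> with values in \<open>[0, \<infinity>]\<close>, so that bounds for it include the finiteness.
\<close>

abbreviation pow_int :: "real \<Rightarrow> 'a measure \<Rightarrow> ('a \<Rightarrow> 'b::real_normed_vector) \<Rightarrow> ennreal" where
  "pow_int p M f \<equiv> \<integral>\<^sup>+x. ennreal (norm (f x) powr p) \<partial>M"

text \<open>
  For indicators of bounded Borel sets this is the change of variables for absolutely integrable functions.
  Exhausting the line by bounded sets identifies two measures, and an equality of measures carries over to all
  nonnegative functions, whether their integrals are finite or not.
\<close>

lemma nn_integral_substitution_inj:
  fixes f :: "real \<Rightarrow> ennreal" and g g' :: "real \<Rightarrow> real"
  assumes S[measurable]: "S \<in> sets borel" and gS[measurable]: "g ` S \<in> sets borel"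
    and g[measurable]: "g \<in> borel_measurable borel" and g'[measurable]: "g' \<in> borel_measurable borel"
    and der: "\<And>x. x \<in> S \<Longrightarrow> (g has_field_derivative g' x) (at x within S)"
    and inj: "inj_on g S"
    and f[measurable]: "f \<in> borel_measurable borel"
  shows "(\<integral>\<^sup>+x\<in>g ` S. f x \<partial>lborel) = (\<integral>\<^sup>+x\<in>S. ennreal \<bar>g' x\<bar> * f (g x) \<partial>lborel)"
proof -
  let ?N = "density lborel (indicator (g ` S))"
  let ?M = "distr (density lborel (\<lambda>x. ennreal \<bar>g' x\<bar> * indicator S x)) borel g"
  have S': "S \<in> sets lebesgue" using S by simp
  have bnd: "emeasure ?N B = emeasure ?M B" if B[measurable]: "B \<in> sets borel" and Bb: "bounded B" for B
  proof -
    let ?f = "indicator B :: real \<Rightarrow> real"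
    have fm: "B \<inter> g ` S \<in> lmeasurable"
      by (rule bounded_set_imp_lmeasurable) (use Bb bounded_subset in \<open>auto\<close>)
    have ai: "?f absolutely_integrable_on g ` S"
    proof -
      have "(\<lambda>x. indicator (B \<inter> g ` S) x :: real) absolutely_integrable_on UNIV"
        using fm by (simp add: lmeasurable_iff_integrable set_integrable_def fmeasurable_def)
      then show ?thesis
        by (simp add: set_integrable_def indicator_inter_arith mult.commute)
    qed
    have *: "(\<lambda>x. \<bar>g' x\<bar> * ?f (g x)) absolutely_integrable_on S"
        "integral S (\<lambda>x. \<bar>g' x\<bar> * ?f (g x)) = integral (g ` S) ?f"
      using has_absolute_integral_change_of_variables_1'[OF S' der inj, of ?f "integral (g ` S) ?f"] ai
      by auto
    have h1: "((\<lambda>x. \<bar>g' x\<bar> * ?f (g x)) has_integral integral (g ` S) ?f) S"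
      using * absolutely_integrable_on_def has_integral_integral by metis
    have h2: "(?f has_integral integral (g ` S) ?f) (g ` S)"
      using ai absolutely_integrable_on_def has_integral_integral by blast
    have "(\<integral>\<^sup>+x\<in>g ` S. ennreal (?f x) \<partial>lborel) = ennreal (integral (g ` S) ?f)"
      by (rule nn_integral_has_integral_lebesgue'[OF _ h2]) auto
    also have "\<dots> = (\<integral>\<^sup>+x\<in>S. ennreal (\<bar>g' x\<bar> * ?f (g x)) \<partial>lborel)"
      by (rule nn_integral_has_integral_lebesgue'[OF _ h1, symmetric]) auto
    finally have e: "(\<integral>\<^sup>+x\<in>g ` S. ennreal (?f x) \<partial>lborel) = (\<integral>\<^sup>+x\<in>S. ennreal (\<bar>g' x\<bar> * ?f (g x)) \<partial>lborel)" .
    have "emeasure ?N B = (\<integral>\<^sup>+x\<in>g ` S. ennreal (?f x) \<partial>lborel)"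
      by (subst emeasure_density) (auto intro!: nn_integral_cong split: split_indicator)
    also have "\<dots> = (\<integral>\<^sup>+x. ennreal \<bar>g' x\<bar> * indicator S x * indicator (g -` B) x \<partial>lborel)"
      unfolding e by (auto intro!: nn_integral_cong split: split_indicator)
    also have "\<dots> = emeasure ?M B"
      using measurable_sets[OF g B]
      by (subst emeasure_distr, measurable, subst emeasure_density) auto
    finally show ?thesis .
  qed
  have "?N = ?M"
  proof (rule measure_eqI)
    show "sets ?N = sets ?M" by simp
    fix B assume "B \<in> sets ?N"
    then have B[measurable]: "B \<in> sets borel" by simp
    have U: "(\<Union>n::nat. B \<inter> {- real n..real n}) = B"
    proof -
      have "\<exists>n::nat. - real n \<le> x \<and> x \<le> real n" for x
        by (metis abs_le_iff minus_le_iff real_arch_simple)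
      then show ?thesis by auto
    qed
    have inc: "incseq (\<lambda>n::nat. B \<inter> {- real n..real n})"
      by (auto simp: incseq_def)
    have rng: "range (\<lambda>n::nat. B \<inter> {- real n..real n}) \<subseteq> sets borel" by auto
    have "emeasure ?N B = (SUP n. emeasure ?N (B \<inter> {- real n..real n}))"
      using SUP_emeasure_incseq[of "\<lambda>n::nat. B \<inter> {- real n..real n}" ?N, OF _ inc] rng U by simp
    also have "\<dots> = (SUP n. emeasure ?M (B \<inter> {- real n..real n}))"
      by (intro SUP_cong refl bnd) (auto intro: bounded_Int)
    also have "\<dots> = emeasure ?M B"
      using SUP_emeasure_incseq[of "\<lambda>n::nat. B \<inter> {- real n..real n}" ?M, OF _ inc] rng U by simp
    finally show "emeasure ?N B = emeasure ?M B" .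
  qed
  then have "(\<integral>\<^sup>+x. f x \<partial>?N) = (\<integral>\<^sup>+x. f x \<partial>?M)" by simp
  then show ?thesis
    by (simp add: nn_integral_density nn_integral_distr mult_ac)
qed

section \<open>The angular measure and its moments\<close>

definition angle_const :: "real \<Rightarrow> real" where
  "angle_const \<nu> = Gamma (\<nu> + 1) / (sqrt pi * Gamma (\<nu> + 1 / 2))"

text \<open>
  The weight of the Bessel translations, normalized to a probability measure.
\<close>

definition angle_measure :: "real \<Rightarrow> real measure" where
  "angle_measure \<nu> =
     density lborel (\<lambda>\<theta>. ennreal (indicator {0<..<pi} \<theta> * (angle_const \<nu> * sin \<theta> powr (2 * \<nu>))))"

text \<open>
  The restriction of the weighted Lebesgue measure of the function spaces to Borel sets, on which Fubini's
  theorem can be used without completing products.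
\<close>

definition radial_measure :: "real \<Rightarrow> real measure" where
  "radial_measure \<nu> = density lborel (\<lambda>y. ennreal (indicator {0<..} y * y powr (2 * \<nu> + 1)))"

lemma sets_angle_measure[simp, measurable_cong]: "sets (angle_measure \<nu>) = sets borel"
  and space_angle_measure[simp]: "space (angle_measure \<nu>) = UNIV"
  by (simp_all add: angle_measure_def)

lemma sets_radial_measure[simp, measurable_cong]: "sets (radial_measure \<nu>) = sets borel"
  and space_radial_measure[simp]: "space (radial_measure \<nu>) = UNIV"
  by (simp_all add: radial_measure_def)

lemma image_half_one_minus_cos: "(\<lambda>\<theta>. (1 - cos \<theta>) / 2) ` {0<..<pi} = {0<..<1}"
proof safe
  fix \<theta> :: real assume t: "\<theta> \<in> {0<..<pi}"
  have "cos \<theta> < 1" using t cos_monotone_0_pi[of 0 \<theta>] by simp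
  moreover have "cos \<theta> > -1" using t cos_monotone_0_pi[of \<theta> pi] by simp
  ultimately show "(1 - cos \<theta>) / 2 \<in> {0<..<1}" by auto
next
  fix u :: real assume u: "u \<in> {0<..<1}"
  have "cos (arccos (1 - 2 * u)) = 1 - 2 * u" using u by (intro cos_arccos) auto
  moreover have "0 < arccos (1 - 2 * u) \<and> arccos (1 - 2 * u) < pi"
    using u by (intro arccos_lt_bounded) auto
  ultimately show "u \<in> (\<lambda>\<theta>. (1 - cos \<theta>) / 2) ` {0<..<pi}"
    by (intro image_eqI[of _ _ "arccos (1 - 2 * u)"]) auto
qed

lemma Gamma_legendre_duplication_real:
  assumes "(z::real) > 0"
  shows "Gamma z * Gamma (z + 1/2) = 2 powr (1 - 2 * z) * sqrt pi * Gamma (2 * z)"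
proof -
  have nz: "complex_of_real w \<notin> \<int>\<^sub>\<le>\<^sub>0" if "w > 0" for w
    using that by (auto elim!: nonpos_Ints_cases simp: complex_eq_iff)
  have "complex_of_real (z + 1/2) \<notin> \<int>\<^sub>\<le>\<^sub>0" using assms by (intro nz) simp
  then have z2: "complex_of_real z + 1/2 \<notin> \<int>\<^sub>\<le>\<^sub>0" by simp
  have "complex_of_real (Gamma z * Gamma (z + 1/2)) =
      Gamma (complex_of_real z) * Gamma (complex_of_real z + 1/2)"
    by (simp add: Gamma_complex_of_real[symmetric])
  also have "\<dots> = exp ((1 - 2*complex_of_real z) * of_real (ln 2)) * of_real (sqrt pi) * Gamma (2 * complex_of_real z)"
    by (rule Gamma_legendre_duplication[OF nz[OF assms] z2])
  also have "\<dots> = complex_of_real (exp ((1 - 2*z) * ln 2) * sqrt pi * Gamma (2 * z))"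
    by (simp add: Gamma_complex_of_real[symmetric] exp_of_real[symmetric])
  finally show ?thesis by (simp only: of_real_eq_iff powr_def) simp
qed

locale bessel_order =
  fixes \<nu> :: real
  assumes nu: "\<nu> > - 1 / 2"
begin

abbreviation radial ("\<rho>") where "\<rho> \<equiv> radial_measure \<nu>"
abbreviation angular ("\<alpha>") where "\<alpha> \<equiv> angle_measure \<nu>"
abbreviation bessel ("\<beta>") where "\<beta> \<equiv> bessel_measure \<nu>"

lemma angle_const_pos: "angle_const \<nu> > 0"
  using nu by (auto simp: angle_const_def intro!: divide_pos_pos mult_pos_pos Gamma_real_pos)

text \<open>
  The substitution \<open>u = (1 - cos \<theta>) / 2\<close> gives \<open>4u(1 - u) = sin\<^sup>2 \<theta>\<close> and turns the integral into a
  multiple of \<open>B(\<nu> + 1/2, \<nu> + 1/2)\<close>; the duplication formula of Legendre then produces the constant of the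
  Bessel translation.
\<close>

lemma nn_integral_sin_powr:
  "(\<integral>\<^sup>+\<theta>\<in>{0<..<pi}. ennreal (sin \<theta> powr (2 * \<nu>)) \<partial>lborel) = ennreal (1 / angle_const \<nu>)"
proof -
  let ?a = "\<nu> + 1 / 2"
  let ?f = "\<lambda>u::real. ennreal (2 * (4 * u * (1 - u)) powr (\<nu> - 1/2))"
  have a: "?a > 0" using nu by simp
  have "(\<integral>\<^sup>+\<theta>\<in>{0<..<pi}. ennreal (sin \<theta> powr (2 * \<nu>)) \<partial>lborel) =
      (\<integral>\<^sup>+\<theta>\<in>{0<..<pi}. ennreal \<bar>sin \<theta> / 2\<bar> * ?f ((1 - cos \<theta>) / 2) \<partial>lborel)"
  proof (rule nn_integral_cong, goal_cases)
    case (1 \<theta>)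
    show ?case
    proof (cases "\<theta> \<in> {0<..<pi}")
      case True
      then have s: "sin \<theta> > 0" by (simp add: sin_gt_zero)
      have "4 * ((1 - cos \<theta>) / 2) * (1 - (1 - cos \<theta>) / 2) = (sin \<theta>)\<^sup>2"
        by (simp add: sin_squared_eq field_simps) (simp add: power2_eq_square algebra_simps)
      also have "\<dots> = sin \<theta> powr 2" using s by simp
      finally have e: "4 * ((1 - cos \<theta>) / 2) * (1 - (1 - cos \<theta>) / 2) = sin \<theta> powr 2" .
      have "\<bar>sin \<theta> / 2\<bar> * (2 * (4 * ((1 - cos \<theta>) / 2) * (1 - (1 - cos \<theta>) / 2)) powr (\<nu> - 1/2))
          = sin \<theta> powr 1 * sin \<theta> powr (2 * \<nu> - 1)"
        unfolding e powr_powr using s by (simp add: algebra_simps)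
      also have "\<dots> = sin \<theta> powr (2 * \<nu>)" unfolding powr_add[symmetric] by simp
      finally show ?thesis using True by (simp add: ennreal_mult'[symmetric])
    qed simp
  qed
  also have "\<dots> = (\<integral>\<^sup>+u\<in>(\<lambda>\<theta>. (1 - cos \<theta>) / 2) ` {0<..<pi}. ?f u \<partial>lborel)"
  proof (rule nn_integral_substitution_inj[symmetric])
    show "inj_on (\<lambda>\<theta>. (1 - cos \<theta>) / 2) {0<..<pi}"
      by (auto simp: inj_on_def intro!: cos_inj_pi)
    show "(\<lambda>\<theta>. (1 - cos \<theta>) / 2) ` {0<..<pi} \<in> sets borel"
      by (simp add: image_half_one_minus_cos)
  qed (auto intro!: derivative_eq_intros)
  also have "\<dots> = (\<integral>\<^sup>+u\<in>{0..1}. ennreal (4 powr \<nu> * (u powr (?a - 1) * (1 - u) powr (?a - 1))) \<partial>lborel)"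
    unfolding image_half_one_minus_cos
  proof (rule nn_integral_cong_AE, use AE_lborel_singleton[of 0] AE_lborel_singleton[of 1] in eventually_elim)
    case (elim u)
    have "2 * (4 * u * (1 - u)) powr (\<nu> - 1/2) = 4 powr \<nu> * (u powr (?a - 1) * (1 - u) powr (?a - 1))"
      if "0 < u" "u < 1"
    proof -
      have "(4::real) powr \<nu> = 4 powr (1/2) * 4 powr (\<nu> - 1/2)"
        unfolding powr_add[symmetric] by simp
      also have "(4::real) powr (1/2) = 2" by (simp add: powr_half_sqrt)
      finally have "(4::real) powr \<nu> = 2 * 4 powr (\<nu> - 1/2)" .
      moreover have "(4 * u * (1 - u)) powr (\<nu> - 1/2) = 4 powr (\<nu> - 1/2) * u powr (\<nu> - 1/2) * (1 - u) powr (\<nu> - 1/2)"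
        using that by (simp add: powr_mult)
      ultimately show ?thesis by simp
    qed
    then show ?case using elim by (auto split: split_indicator)
  qed
  also have "\<dots> = ennreal (4 powr \<nu> * Beta ?a ?a)"
    using has_integral_mult_right[OF has_integral_Beta_real[OF a a], of "4 powr \<nu>"]
    by (intro nn_integral_has_integral_lebesgue') auto
  also have "4 powr \<nu> * Beta ?a ?a = 1 / angle_const \<nu>"
  proof -
    have "Gamma ?a * Gamma (\<nu> + 1) = 2 powr (- 2 * \<nu>) * sqrt pi * Gamma (2 * ?a)"
      using Gamma_legendre_duplication_real[OF a] by (simp add: algebra_simps)
    also have "(2::real) powr (- 2 * \<nu>) = 1 / 4 powr \<nu>"
    proof -
      have "(2::real) powr (2 * \<nu>) = (2 powr 2) powr \<nu>" by (simp only: powr_powr)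
      then show ?thesis by (simp add: powr_minus field_simps)
    qed
    finally have "Gamma ?a * Gamma (\<nu> + 1) * 4 powr \<nu> = sqrt pi * Gamma (?a + ?a)"
      unfolding mult_2 by simp
    moreover have "Gamma ?a > 0" "Gamma (\<nu> + 1) > 0" "Gamma (?a + ?a) > 0"
      using nu by (auto intro!: Gamma_real_pos)
    moreover have "P * (A * A / D) = 1 / (B / (r * A))"
      if "A * B * P = r * D" "A > 0" "B > 0" "D > 0" for A B D P r :: real
      using that by (simp add: field_simps)
    ultimately show ?thesis unfolding angle_const_def Beta_def by blast
  qed
  finally show ?thesis .
qed

lemma prob_space_angle_measure: "prob_space \<alpha>"
proof
  have "emeasure \<alpha> (space \<alpha>) =
      (\<integral>\<^sup>+\<theta>. ennreal (angle_const \<nu>) * (ennreal (sin \<theta> powr (2 * \<nu>)) * indicator {0<..<pi} \<theta>) \<partial>lborel)"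
    unfolding angle_measure_def using angle_const_pos
    by (subst emeasure_density)
       (auto intro!: nn_integral_cong simp: ennreal_mult'[symmetric] split: split_indicator)
  also have "\<dots> = ennreal (angle_const \<nu>) * ennreal (1 / angle_const \<nu>)"
    by (subst nn_integral_cmult) (simp_all add: nn_integral_sin_powr)
  also have "\<dots> = 1"
    using angle_const_pos by (simp add: ennreal_mult'[symmetric])
  finally show "emeasure \<alpha> (space \<alpha>) = 1" .
qed

sublocale A: prob_space "\<alpha>" by (rule prob_space_angle_measure)

lemma integrable_angle_bounded:
  fixes f :: "real \<Rightarrow> 'b::{banach, second_countable_topology}"
  assumes "f \<in> borel_measurable borel" "\<And>\<theta>. norm (f \<theta>) \<le> B"
  shows "integrable \<alpha> f"
proof -
  show ?thesis using assms by (intro A.integrable_const_bound[where B=B]) auto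
qed

text \<open>
  Integrate the derivative of \<open>cos\<^sup>n \<theta> sin\<^bsup>2\<nu>+1\<^esup> \<theta>\<close>, which vanishes at both endpoints because \<open>2\<nu> + 1 > 0\<close>.
  For \<open>n = 0\<close> the factor \<open>n\<close> makes the truncated exponent \<open>n - 1\<close> harmless, and the first moment is \<open>0\<close>.
\<close>

lemma angle_moment_step:
  "(2 * \<nu> + 1) * (\<integral>\<theta>. cos \<theta> ^ (n + 1) \<partial>\<alpha>) =
     real n * (\<integral>\<theta>. cos \<theta> ^ (n - 1) * (1 - (cos \<theta>)\<^sup>2) \<partial>\<alpha>)"
proof -
  let ?P = "\<lambda>\<theta>::real. (2 * \<nu> + 1) * cos \<theta> ^ (n + 1) - real n * (cos \<theta> ^ (n - 1) * (1 - (cos \<theta>)\<^sup>2))"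
  let ?w = "\<lambda>\<theta>::real. indicator {0<..<pi} \<theta> * (angle_const \<nu> * sin \<theta> powr (2 * \<nu>))"
  have b: "norm (cos \<theta> ^ k) \<le> 1" for k and \<theta> :: real
    by (simp add: power_abs power_le_one)
  have i1: "integrable \<alpha> (\<lambda>\<theta>. cos \<theta> ^ (n + 1))"
    by (rule integrable_angle_bounded[where B=1, OF _ b]) simp
  have i2: "integrable \<alpha> (\<lambda>\<theta>. cos \<theta> ^ (n - 1) * (1 - (cos \<theta>)\<^sup>2))"
  proof (rule integrable_angle_bounded[where B=1])
    fix \<theta> :: real
    have "0 \<le> 1 - (cos \<theta>)\<^sup>2" "1 - (cos \<theta>)\<^sup>2 \<le> 1" by (simp_all add: abs_square_le_1)
    then show "norm (cos \<theta> ^ (n - 1) * (1 - (cos \<theta>)\<^sup>2)) \<le> 1"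
      unfolding norm_mult using b[of \<theta> "n-1"] by (intro mult_le_one) auto
  qed simp
  have iP: "integrable \<alpha> ?P" using i1 i2 by simp
  have "integrable lborel (\<lambda>\<theta>. ?w \<theta> * ?P \<theta>)"
    using iP angle_const_pos unfolding angle_measure_def
    by (subst (asm) integrable_density) (auto simp del: mult_cancel_left)
  then have "((\<lambda>\<theta>. ?w \<theta> * ?P \<theta>) has_integral (\<integral>\<theta>. ?w \<theta> * ?P \<theta> \<partial>lborel)) UNIV"
    by (rule has_integral_integral_lborel)
  also have "(\<integral>\<theta>. ?w \<theta> * ?P \<theta> \<partial>lborel) = (\<integral>\<theta>. ?P \<theta> \<partial>\<alpha>)"
    unfolding angle_measure_def using angle_const_pos by (subst integral_density) auto
  finally have 1: "((\<lambda>\<theta>. ?w \<theta> * ?P \<theta>) has_integral (\<integral>\<theta>. ?P \<theta> \<partial>\<alpha>)) UNIV" .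
  let ?F = "\<lambda>\<theta>. angle_const \<nu> * (cos \<theta> ^ n * sin \<theta> powr (2 * \<nu> + 1))"
  have "((\<lambda>\<theta>. ?w \<theta> * ?P \<theta>) has_integral (?F pi - ?F 0)) {0..pi}"
  proof (rule fundamental_theorem_of_calculus_interior)
    show "continuous_on {0..pi} ?F"
      using nu by (intro continuous_intros continuous_on_powr') (auto simp: sin_ge_zero)
    fix \<theta> assume t: "\<theta> \<in> {0<..<pi}"
    then have s: "sin \<theta> > 0" by (simp add: sin_gt_zero)
    let ?S = "sin \<theta> powr (2 * \<nu>)"
    have e: "sin \<theta> powr (2 * \<nu> + 1) = ?S * sin \<theta>" "sin \<theta> powr (2 * \<nu> + 1 - 1) = ?S"
      using s by (simp_all add: powr_add)
    have "(?F has_real_derivative angle_const \<nu> * (cos \<theta> ^ n * ((2 * \<nu> + 1) * ?S * cos \<theta>)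
        - real n * cos \<theta> ^ (n - 1) * sin \<theta> * (?S * sin \<theta>))) (at \<theta>)"
      unfolding e(1)[symmetric] using s
      by (auto intro!: derivative_eq_intros simp: powr_diff algebra_simps)
    also have "cos \<theta> ^ n * ((2 * \<nu> + 1) * ?S * cos \<theta>) - real n * cos \<theta> ^ (n - 1) * sin \<theta> * (?S * sin \<theta>)
        = ?S * ((2 * \<nu> + 1) * cos \<theta> ^ (n + 1) - real n * (cos \<theta> ^ (n - 1) * (sin \<theta>)\<^sup>2))"
      by (simp add: algebra_simps power2_eq_square)
    also have "angle_const \<nu> * \<dots> = ?w \<theta> * ?P \<theta>"
      using t by (simp add: sin_squared_eq)
    finally have "(?F has_real_derivative ?w \<theta> * ?P \<theta>) (at \<theta>)" .
    then show "(?F has_vector_derivative ?w \<theta> * ?P \<theta>) (at \<theta>)"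
      by (simp add: has_real_derivative_iff_has_vector_derivative)
  qed simp
  then have "((\<lambda>\<theta>. ?w \<theta> * ?P \<theta>) has_integral 0) {0..pi}" using nu by simp
  then have "((\<lambda>\<theta>. ?w \<theta> * ?P \<theta>) has_integral 0) UNIV"
    by (rule has_integral_on_superset) auto
  with 1 have "(\<integral>\<theta>. ?P \<theta> \<partial>\<alpha>) = 0" by (rule has_integral_unique)
  then show ?thesis using i1 i2 by simp
qed

lemma angle_moment_odd: "(\<integral>\<theta>. cos \<theta> ^ (2 * k + 1) \<partial>\<alpha>) = 0"
  and angle_moment_even: "(\<integral>\<theta>. cos \<theta> ^ (2 * k) \<partial>\<alpha>) =
    fact (2 * k) / (4 ^ k * fact k * pochhammer (\<nu> + 1) k)"
proof -
  let ?M = "\<lambda>k. \<integral>\<theta>. cos \<theta> ^ k \<partial>\<alpha>"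
  have i: "integrable \<alpha> (\<lambda>\<theta>. cos \<theta> ^ k)" for k
    by (rule integrable_angle_bounded[where B=1]) (simp_all add: power_abs power_le_one)
  have step: "(2 * \<nu> + 2 + real k) * ?M (k + 2) = real (k + 1) * ?M k" for k
  proof -
    have "(\<integral>\<theta>. cos \<theta> ^ k * (1 - (cos \<theta>)\<^sup>2) \<partial>\<alpha>) = (\<integral>\<theta>. cos \<theta> ^ k - cos \<theta> ^ (k + 2) \<partial>\<alpha>)"
      by (rule Bochner_Integration.integral_cong) (auto simp: algebra_simps power2_eq_square)
    also have "\<dots> = ?M k - ?M (k + 2)" by (intro Bochner_Integration.integral_diff i)
    finally have "(\<integral>\<theta>. cos \<theta> ^ k * (1 - (cos \<theta>)\<^sup>2) \<partial>\<alpha>) = ?M k - ?M (k + 2)" .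
    then have "(2 * \<nu> + 1) * ?M (k + 2) = real (k + 1) * (?M k - ?M (k + 2))"
      using angle_moment_step[of "k + 1"] by (simp only: add_diff_cancel_right' add.assoc one_add_one)
    then show ?thesis by (simp add: algebra_simps)
  qed
  have M1: "?M 1 = 0" using angle_moment_step[of 0] nu by simp
  show "?M (2 * k + 1) = 0"
  proof (induction k)
    case (Suc k)
    then show ?case using step[of "2 * k + 1"] nu by simp
  qed (use M1 in simp)
  show "?M (2 * k) = fact (2 * k) / (4 ^ k * fact k * pochhammer (\<nu> + 1) k)"
  proof (induction k)
    case 0
    then show ?case using A.prob_space by simp
  next
    case (Suc k)
    let ?m = "?M (2 * Suc k)"
    have p: "pochhammer (\<nu> + 1) k > 0" using nu by (intro pochhammer_pos) simp
    have q: "\<nu> + 1 + real k > 0" using nu by simp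
    have "2 * (\<nu> + 1 + real k) * m = (2 * real k + 1) * X"
      if "(2 * \<nu> + 2 + real (2 * k)) * m = real (2 * k + 1) * X" for m X
      using that by (simp add: algebra_simps)
    from this[OF step[of "2 * k", unfolded Suc]]
    have "2 * (\<nu> + 1 + real k) * ?m = (2 * real k + 1) * (fact (2 * k) / (4 ^ k * fact k * pochhammer (\<nu> + 1) k))"
      by simp
    then have "?m = (2 * real k + 1) * (fact (2 * k) / (4 ^ k * fact k * pochhammer (\<nu> + 1) k)) / (2 * (\<nu> + 1 + real k))"
      using q by (intro iffD2[OF eq_divide_eq]) (simp add: mult.commute)
    also have "\<dots> = fact (2 * Suc k) / (4 ^ Suc k * fact (Suc k) * pochhammer (\<nu> + 1) (Suc k))"
      using p q by (simp add: pochhammer_Suc divide_simps) (simp add: algebra_simps)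
    finally show ?case .
  qed
qed

end

section \<open>The normalized Bessel function\<close>

lemma pochhammer_shift_gbinomial:
  fixes c :: real
  assumes "k \<le> i"
  shows "pochhammer (c + of_nat k) (i - k) / fact (i - k) = (c + of_nat i - 1) gchoose (i - k)"
  using assms by (simp add: gbinomial_pochhammer' of_nat_diff algebra_simps)

text \<open>
  After multiplication by \<open>(c)\<^sub>i / i!\<close> the terms are products of generalized binomial coefficients, and the sum
  is Vandermonde's convolution.
\<close>

lemma chu_vandermonde_pochhammer:
  fixes c :: real
  assumes c: "c > 0"
  shows "(\<Sum>k\<le>i. of_nat (i choose k) * of_nat (j choose k) * fact k / pochhammer c k)
    = pochhammer c (i + j) / (pochhammer c i * pochhammer c j)"
proof -
  have pos: "pochhammer c n > 0" for n using c by (rule pochhammer_pos)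
  have split: "pochhammer c i = pochhammer c k * pochhammer (c + of_nat k) (i - k)" if "k \<le> i" for k
    using pochhammer_product[OF that, of c] by simp
  have "(\<Sum>k\<le>i. of_nat (i choose k) * of_nat (j choose k) * fact k / pochhammer c k) =
      (\<Sum>k\<le>i. fact i / pochhammer c i * ((of_nat j gchoose k) * ((c + of_nat i - 1) gchoose (i - k))))"
  proof (rule sum.cong[OF refl])
    fix k assume "k \<in> {..i}"
    then have k: "k \<le> i" by simp
    have nz: "pochhammer c k \<noteq> 0" "pochhammer (c + of_nat k) (i - k) \<noteq> 0"
      using pos[of i] split[OF k] by auto
    have "real (i choose k) = fact i / (fact k * fact (i - k))"
      using binomial_fact[OF k] by simp
    then show "of_nat (i choose k) * of_nat (j choose k) * fact k / pochhammer c k =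
        fact i / pochhammer c i * ((of_nat j gchoose k) * ((c + of_nat i - 1) gchoose (i - k)))"
      unfolding pochhammer_shift_gbinomial[OF k, symmetric] split[OF k]
      using nz by (simp add: binomial_gbinomial field_simps)
  qed
  also have "\<dots> = fact i / pochhammer c i * (\<Sum>k\<in>{0..i}. (of_nat j gchoose k) * ((c + of_nat i - 1) gchoose (i - k)))"
    by (simp add: sum_distrib_left atMost_atLeast0)
  also have "\<dots> = fact i / pochhammer c i * ((c + of_nat j + of_nat i - 1) gchoose i)"
    by (simp add: gbinomial_Vandermonde algebra_simps)
  also have "\<dots> = pochhammer (c + of_nat j) i / pochhammer c i"
    using pochhammer_shift_gbinomial[of 0 i "c + of_nat j"] by (simp add: field_simps)
  also have "\<dots> = pochhammer c (i + j) / (pochhammer c i * pochhammer c j)"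
    using pos[of j] pochhammer_product[of j "i + j" c] by (simp add: field_simps)
  finally show ?thesis .
qed

text \<open>
  The coefficients of \<open>j\<^sub>\<nu>\<close> as a power series in \<open>x\<^sup>2\<close>, with the quotient of Gamma values written as a
  Pochhammer symbol.
\<close>

definition bessel_coeff :: "real \<Rightarrow> nat \<Rightarrow> real" where
  "bessel_coeff \<nu> n = (-1) ^ n / (4 ^ n * fact n * pochhammer (\<nu> + 1) n)"

context bessel_order
begin

lemma pochhammer_nu_pos: "pochhammer (\<nu> + 1) n > 0"
  using nu by (intro pochhammer_pos) simp

text \<open>
  The products \<open>4\<^sup>n (\<nu> + 1)\<^sub>n\<close> are bounded below by \<open>1/2\<close>, so that the exponential series is a majorant.
\<close>

lemma summable_bessel_coeff: "summable (\<lambda>n. \<bar>bessel_coeff \<nu> n\<bar> * \<bar>w\<bar> ^ n)"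
proof -
  have "\<bar>bessel_coeff \<nu> n\<bar> * \<bar>w\<bar> ^ n \<le> 2 * \<bar>w\<bar> ^ n / fact n" for n
  proof -
    have p: "pochhammer (\<nu> + 1) n * 4 ^ n \<ge> 1 / 2"
    proof (cases n)
      case (Suc m)
      have "pochhammer (\<nu> + 1) n * 4 ^ n = (\<nu> + 1) * 4 * (pochhammer (\<nu> + 2) m * 4 ^ m)"
        by (simp add: Suc pochhammer_rec algebra_simps)
      moreover have "pochhammer (\<nu> + 2) m * 4 ^ m \<ge> 1"
      proof (induction m)
        case (Suc m)
        have "1 * 1 \<le> (pochhammer (\<nu> + 2) m * 4 ^ m) * ((\<nu> + 2 + real m) * 4)"
          using nu by (intro mult_mono Suc) (auto intro!: mult_nonneg_nonneg pochhammer_nonneg)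
        then show ?case by (simp add: pochhammer_Suc algebra_simps)
      qed simp
      moreover have "(\<nu> + 1) * 4 * y \<ge> 1 / 2" if "y \<ge> 1" for y
      proof -
        have "(1/2) * 1 \<le> ((\<nu> + 1) * 4) * y" using that nu by (intro mult_mono) auto
        then show ?thesis by simp
      qed
      ultimately show ?thesis by simp
    qed simp
    have "\<bar>bessel_coeff \<nu> n\<bar> = 1 / ((pochhammer (\<nu> + 1) n * 4 ^ n) * fact n)"
      using pochhammer_nu_pos[of n] by (simp add: bessel_coeff_def abs_mult power_abs)
    also have "\<dots> \<le> 1 / ((1/2) * fact n)"
      using p pochhammer_nu_pos[of n] by (intro divide_left_mono mult_right_mono mult_pos_pos) auto
    finally have "\<bar>bessel_coeff \<nu> n\<bar> \<le> 2 / fact n" by simp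
    then have "\<bar>bessel_coeff \<nu> n\<bar> * \<bar>w\<bar> ^ n \<le> 2 / fact n * \<bar>w\<bar> ^ n"
      by (intro mult_right_mono) auto
    then show ?thesis by simp
  qed
  moreover have "summable (\<lambda>n. 2 * \<bar>w\<bar> ^ n / fact n)"
    using summable_mult[OF summable_exp[of "\<bar>w\<bar>"], of 2] by (simp add: field_simps)
  ultimately show ?thesis
    by (auto intro: summable_comparison_test'[of "\<lambda>n. 2 * \<bar>w\<bar> ^ n / fact n" 0])
qed

lemma summable_bessel_coeff': "summable (\<lambda>n. bessel_coeff \<nu> n * w ^ n)"
proof (rule summable_rabs_cancel)
  show "summable (\<lambda>n. \<bar>bessel_coeff \<nu> n * w ^ n\<bar>)"
    using summable_bessel_coeff[of w] by (simp add: abs_mult power_abs)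
qed

lemma bessel_j_eq: "bessel_j \<nu> x = (\<Sum>n. bessel_coeff \<nu> n * (x\<^sup>2) ^ n)"
proof -
  have g: "Gamma (real n + \<nu> + 1) = pochhammer (\<nu> + 1) n * Gamma (\<nu> + 1)" for n
  proof -
    have "\<nu> + 1 \<notin> \<int>\<^sub>\<le>\<^sub>0" using nu by (auto elim!: nonpos_Ints_cases)
    then have "pochhammer (\<nu> + 1) n = Gamma (\<nu> + 1 + real n) / Gamma (\<nu> + 1)"
      by (rule pochhammer_Gamma)
    moreover have "Gamma (\<nu> + 1) > 0" using nu by (intro Gamma_real_pos) auto
    ultimately show ?thesis by (simp add: field_simps)
  qed
  have p: "(x / 2) ^ (2 * n) = (x\<^sup>2) ^ n / 4 ^ n" for n
    by (simp add: power_divide power_mult)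
  have "Gamma (\<nu> + 1) > 0" using nu by (intro Gamma_real_pos) auto
  then show ?thesis unfolding bessel_j_def g p bessel_coeff_def
    by (intro suminf_cong) (simp add: field_simps)
qed

lemma continuous_bessel_j: "continuous_on UNIV (bessel_j \<nu>)"
proof -
  have "isCont (\<lambda>w. \<Sum>n. bessel_coeff \<nu> n * w ^ n) w" for w :: real
    by (rule isCont_powser[where K="\<bar>w\<bar> + 1"]) (auto intro: summable_bessel_coeff')
  then have "continuous_on UNIV (\<lambda>w. \<Sum>n. bessel_coeff \<nu> n * w ^ n)"
    by (simp add: continuous_on_eq_continuous_at)
  then have "continuous_on UNIV ((\<lambda>w. \<Sum>n. bessel_coeff \<nu> n * w ^ n) \<circ> (\<lambda>x::real. x\<^sup>2))"
    by (intro continuous_on_compose continuous_intros) (auto intro: continuous_on_subset)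
  then show ?thesis by (simp add: bessel_j_eq[abs_def] o_def)
qed

lemma measurable_j[measurable]: "bessel_j \<nu> \<in> borel_measurable borel"
  using continuous_bessel_j by (rule borel_measurable_continuous_onI)

lemma angle_integral_power_series:
  fixes f :: "real \<Rightarrow> real" and a :: "nat \<Rightarrow> real"
  assumes f[measurable]: "f \<in> borel_measurable borel" and B: "\<And>\<theta>. \<bar>f \<theta>\<bar> \<le> B"
    and s: "summable (\<lambda>n. \<bar>a n\<bar> * \<bar>B\<bar> ^ n)"
  shows "(\<integral>\<theta>. (\<Sum>n. a n * f \<theta> ^ n) \<partial>\<alpha>) = (\<Sum>n. a n * (\<integral>\<theta>. f \<theta> ^ n \<partial>\<alpha>))"
proof -
  have le: "\<bar>a n * f \<theta> ^ n\<bar> \<le> \<bar>a n\<bar> * \<bar>B\<bar> ^ n" for n \<theta>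
    using B[of \<theta>] unfolding abs_mult power_abs
    by (intro mult_left_mono power_mono) auto
  have i: "integrable \<alpha> (\<lambda>\<theta>. a n * f \<theta> ^ n)" for n
    by (rule integrable_angle_bounded[where B="\<bar>a n\<bar> * \<bar>B\<bar> ^ n"]) (use le in auto)
  have "(\<integral>\<theta>. (\<Sum>n. a n * f \<theta> ^ n) \<partial>\<alpha>) = (\<Sum>n. \<integral>\<theta>. a n * f \<theta> ^ n \<partial>\<alpha>)"
  proof (rule integral_suminf[OF i])
    show "AE \<theta> in \<alpha>. summable (\<lambda>n. norm (a n * f \<theta> ^ n))"
      by (rule AE_I2, rule summable_comparison_test'[OF s, of 0]) (use le in auto)
    have "(\<integral>\<theta>. norm (a n * f \<theta> ^ n) \<partial>\<alpha>) \<le> (\<integral>\<theta>. \<bar>a n\<bar> * \<bar>B\<bar> ^ n \<partial>\<alpha>)" for n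
      by (intro integral_mono integrable_norm i) (use le in auto)
    then have "(\<integral>\<theta>. norm (a n * f \<theta> ^ n) \<partial>\<alpha>) \<le> \<bar>a n\<bar> * \<bar>B\<bar> ^ n" for n
      using A.prob_space by simp
    then show "summable (\<lambda>n. \<integral>\<theta>. norm (a n * f \<theta> ^ n) \<partial>\<alpha>)"
      by (auto intro!: summable_comparison_test'[OF s, of 0])
  qed
  then show ?thesis by simp
qed

text \<open>
  Poisson's integral: integrate the cosine series term by term and insert the even moments.
\<close>

lemma bessel_j_poisson: "bessel_j \<nu> x = (\<integral>\<theta>. cos (x * cos \<theta>) \<partial>\<alpha>)"
proof -
  let ?a = "\<lambda>n. (-1) ^ n / fact (2 * n) :: real"
  have sm: "summable (\<lambda>n. \<bar>?a n\<bar> * \<bar>w\<bar> ^ n)" for w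
  proof -
    have eq: "norm (\<bar>?a n\<bar> * \<bar>w\<bar> ^ n) = 1 / fact (2 * n) * \<bar>w\<bar> ^ n" for n
      unfolding real_norm_def abs_mult abs_divide by (simp add: power_abs)
    have le: "norm (\<bar>?a n\<bar> * \<bar>w\<bar> ^ n) \<le> 1 / fact n * \<bar>w\<bar> ^ n" for n
    proof -
      have "(1::real) / fact (2 * n) \<le> 1 / fact n"
        by (intro divide_left_mono fact_mono) auto
      then show ?thesis unfolding eq by (rule mult_right_mono) simp
    qed
    have "summable (\<lambda>n. 1 / fact n * \<bar>w\<bar> ^ n)"
      using summable_exp[of "\<bar>w\<bar>"] by (simp add: inverse_eq_divide)
    then show ?thesis using le by (rule summable_comparison_test')
  qed
  have cs: "cos y = (\<Sum>n. ?a n * (y\<^sup>2) ^ n)" for y :: real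
  proof -
    have "(\<lambda>n. (- 1) ^ n / fact (2 * n) * y ^ (2 * n)) sums cos y" by (rule cos_paired)
    then show ?thesis by (simp add: sums_iff power_mult)
  qed
  have le: "\<bar>(x * cos \<theta>)\<^sup>2\<bar> \<le> x\<^sup>2" for \<theta>
  proof -
    have "(cos \<theta>)\<^sup>2 \<le> 1" by (simp add: abs_square_le_1)
    then have "x\<^sup>2 * (cos \<theta>)\<^sup>2 \<le> x\<^sup>2" by (rule mult_left_le) simp
    then show ?thesis by (simp only: power_mult_distrib abs_of_nonneg zero_le_mult_iff zero_le_power2 simp_thms)
  qed
  have "(\<integral>\<theta>. cos (x * cos \<theta>) \<partial>\<alpha>) = (\<Sum>n. ?a n * (\<integral>\<theta>. ((x * cos \<theta>)\<^sup>2) ^ n \<partial>\<alpha>))"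
    unfolding cs[of "x * cos \<theta>" for \<theta>]
    by (rule angle_integral_power_series[OF _ le]) (use sm[of "x\<^sup>2"] in simp_all)
  also have "\<dots> = (\<Sum>n. bessel_coeff \<nu> n * (x\<^sup>2) ^ n)"
  proof (rule suminf_cong)
    fix n
    have "(\<integral>\<theta>. ((x * cos \<theta>)\<^sup>2) ^ n \<partial>\<alpha>) = (x\<^sup>2) ^ n * (\<integral>\<theta>. cos \<theta> ^ (2 * n) \<partial>\<alpha>)"
      by (simp only: power_mult_distrib power_mult Bochner_Integration.integral_mult_right_zero)
    also have "\<dots> = (x\<^sup>2) ^ n * (fact (2 * n) / (4 ^ n * fact n * pochhammer (\<nu> + 1) n))"
      by (simp add: angle_moment_even)
    finally show "?a n * (\<integral>\<theta>. ((x * cos \<theta>)\<^sup>2) ^ n \<partial>\<alpha>) = bessel_coeff \<nu> n * (x\<^sup>2) ^ n"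
      by (simp add: bessel_coeff_def)
  qed
  finally show ?thesis unfolding bessel_j_eq by (rule sym)
qed

lemma abs_bessel_j_le_1: "\<bar>bessel_j \<nu> x\<bar> \<le> 1"
proof -
  have "\<bar>\<integral>\<theta>. cos (x * cos \<theta>) \<partial>\<alpha>\<bar> \<le> (\<integral>\<theta>. \<bar>cos (x * cos \<theta>)\<bar> \<partial>\<alpha>)"
    by (rule integral_abs_bound)
  also have "\<dots> \<le> (\<integral>\<theta>. 1 \<partial>\<alpha>)"
    by (intro integral_mono integrable_angle_bounded[where B=1]) auto
  also have "\<dots> = 1" using A.prob_space by simp
  finally show ?thesis by (simp only: bessel_j_poisson)
qed

end

section \<open>The product formula\<close>

text \<open>
  The third side of a triangle in which sides of lengths \<open>x\<close> and \<open>y\<close> enclose the angle \<open>\<theta>\<close>.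
\<close>

definition side :: "real \<Rightarrow> real \<Rightarrow> real \<Rightarrow> real" where
  "side x y \<theta> = sqrt (x\<^sup>2 + y\<^sup>2 - 2 * x * y * cos \<theta>)"

lemma side_radicand:
  fixes x y :: real
  shows "x\<^sup>2 + y\<^sup>2 - 2 * x * y * cos \<theta> = (x - y * cos \<theta>)\<^sup>2 + (y * sin \<theta>)\<^sup>2"
  unfolding power2_diff power_mult_distrib sin_squared_eq by (simp add: algebra_simps)

lemma side_squared: "(side x y \<theta>)\<^sup>2 = x\<^sup>2 + y\<^sup>2 - 2 * x * y * cos \<theta>"
  by (simp add: side_def side_radicand)

lemma side_commute: "side x y = side y x"
  by (simp add: side_def fun_eq_iff algebra_simps)

lemma side_measurable[measurable (raw)]:
  assumes [measurable]: "f \<in> borel_measurable M" "g \<in> borel_measurable M" "h \<in> borel_measurable M"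
  shows "(\<lambda>z. side (f z) (g z) (h z)) \<in> borel_measurable M"
  unfolding side_def by measurable

lemma sum_even_only:
  fixes f :: "nat \<Rightarrow> real"
  assumes "\<And>k. f (2 * k + 1) = 0" "\<And>k. k > n \<Longrightarrow> f k = 0"
  shows "(\<Sum>k\<le>n. f k) = (\<Sum>k\<le>n. f (2 * k))"
proof -
  have *: "(\<Sum>k\<le>2 * m + 1. f k) = (\<Sum>k\<le>m. f (2 * k))" for m
    by (induction m) (use assms(1)[of 0] assms(1)[of "Suc _"] in auto)
  have "(\<Sum>k\<le>n. f k) = (\<Sum>k\<le>2 * n + 1. f k)"
    by (rule sum.mono_neutral_left) (use assms(2) in auto)
  with * show ?thesis by simp
qed

context bessel_order
begin

text \<open>
  Expand the power in \<open>cos \<theta>\<close>; the odd moments vanish. The even ones are multiplied by \<open>(x\<^sup>2 y\<^sup>2)\<^sup>k\<close> and a power of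
  \<open>x\<^sup>2 + y\<^sup>2\<close>. Expanding the latter as well and collecting the monomials \<open>x\<^bsup>2i\<^esup> y\<^bsup>2(n-i)\<^esup>\<close> leaves a sum over
  \<open>k\<close> that the identity of Chu and Vandermonde evaluates.
\<close>

lemma angle_integral_side_power:
  fixes x y :: real
  shows "(\<integral>\<theta>. (x\<^sup>2 + y\<^sup>2 - 2 * x * y * cos \<theta>) ^ n \<partial>\<alpha>) =
    (\<Sum>i\<le>n. fact n * pochhammer (\<nu> + 1) n * (x\<^sup>2) ^ i * (y\<^sup>2) ^ (n - i) /
       (fact i * fact (n - i) * pochhammer (\<nu> + 1) i * pochhammer (\<nu> + 1) (n - i)))"
proof -
  let ?X = "x\<^sup>2" and ?Y = "y\<^sup>2" and ?p = "pochhammer (\<nu> + 1)"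
  define M where "M k = (\<integral>\<theta>. cos \<theta> ^ k \<partial>\<alpha>)" for k
  have ic: "integrable \<alpha> (\<lambda>\<theta>. cos \<theta> ^ k)" for k
    by (rule integrable_angle_bounded[where B=1]) (simp_all add: power_abs power_le_one)
  define t where "t k i = fact n / (fact k * ?p k * fact (i - k) * fact (n - i - k)) * ?X ^ i * ?Y ^ (n - i)" for k i
  have "(\<integral>\<theta>. (?X + ?Y - 2 * x * y * cos \<theta>) ^ n \<partial>\<alpha>) =
      (\<integral>\<theta>. (\<Sum>k\<le>n. real (n choose k) * (- 2 * x * y) ^ k * (?X + ?Y) ^ (n - k) * cos \<theta> ^ k) \<partial>\<alpha>)"
  proof (rule Bochner_Integration.integral_cong[OF refl])
    fix \<theta> :: real
    have "(?X + ?Y - 2 * x * y * cos \<theta>) ^ n = ((- 2 * x * y) * cos \<theta> + (?X + ?Y)) ^ n"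
      by (simp add: algebra_simps)
    also have "\<dots> = (\<Sum>k\<le>n. real (n choose k) * ((- 2 * x * y) * cos \<theta>) ^ k * (?X + ?Y) ^ (n - k))"
      by (rule binomial_ring)
    finally show "(?X + ?Y - 2 * x * y * cos \<theta>) ^ n =
        (\<Sum>k\<le>n. real (n choose k) * (- 2 * x * y) ^ k * (?X + ?Y) ^ (n - k) * cos \<theta> ^ k)"
      by (simp only: power_mult_distrib mult_ac)
  qed
  also have "\<dots> = (\<Sum>k\<le>n. real (n choose k) * (- 2 * x * y) ^ k * (?X + ?Y) ^ (n - k) * M k)"
    unfolding M_def by (subst Bochner_Integration.integral_sum) (auto intro: ic)
  also have "\<dots> = (\<Sum>k\<le>n. real (n choose (2 * k)) * (- 2 * x * y) ^ (2 * k) * (?X + ?Y) ^ (n - 2 * k) * M (2 * k))"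
    by (rule sum_even_only) (auto simp: M_def angle_moment_odd[simplified])
  also have "\<dots> = (\<Sum>k\<le>n. \<Sum>i\<le>n. if k \<le> i \<and> k \<le> n - i then t k i else 0)"
  proof (rule sum.cong[OF refl])
    fix k assume "k \<in> {..n}"
    show "real (n choose (2 * k)) * (- 2 * x * y) ^ (2 * k) * (?X + ?Y) ^ (n - 2 * k) * M (2 * k) =
        (\<Sum>i\<le>n. if k \<le> i \<and> k \<le> n - i then t k i else 0)"
    proof (cases "2 * k \<le> n")
      case False
      have "(\<Sum>i\<le>n. if k \<le> i \<and> k \<le> n - i then t k i else 0) = 0"
        by (rule sum.neutral) (use False in auto)
      then show ?thesis using False by simp
    next
      case True
      have c: "real (n choose (2 * k)) * fact (2 * k) = fact n / fact (n - 2 * k)"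
        using binomial_fact[OF True, where 'a=real] by simp
      have "(- 2 * x * y) ^ (2 * k) = 4 ^ k * (?X * ?Y) ^ k"
        by (simp add: power_mult power_mult_distrib)
      then have "real (n choose (2 * k)) * (- 2 * x * y) ^ (2 * k) * (?X + ?Y) ^ (n - 2 * k) * M (2 * k) =
          (real (n choose (2 * k)) * fact (2 * k)) / (fact k * ?p k) * (?X * ?Y) ^ k * (?X + ?Y) ^ (n - 2 * k)"
        unfolding M_def angle_moment_even by simp
      also have "\<dots> = (\<Sum>l\<le>n - 2 * k. fact n / fact (n - 2 * k) / (fact k * ?p k) * (?X * ?Y) ^ k *
            (real (n - 2 * k choose l) * ?X ^ l * ?Y ^ (n - 2 * k - l)))"
        unfolding c binomial_ring by (simp add: sum_distrib_left)
      also have "\<dots> = (\<Sum>l\<le>n - 2 * k. t k (k + l))"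
      proof (rule sum.cong[OF refl])
        fix l assume "l \<in> {..n - 2 * k}"
        then have l: "l \<le> n - 2 * k" by simp
        have b: "real (n - 2 * k choose l) = fact (n - 2 * k) / (fact l * fact (n - 2 * k - l))"
          using binomial_fact[OF l] .
        have e1: "n - (k + l) - k = n - 2 * k - l" "n - (k + l) = k + (n - 2 * k - l)" using l True by auto
        show "fact n / fact (n - 2 * k) / (fact k * ?p k) * (?X * ?Y) ^ k *
            (real (n - 2 * k choose l) * ?X ^ l * ?Y ^ (n - 2 * k - l)) = t k (k + l)"
          unfolding t_def b e1(1) unfolding e1(2) power_add power_mult_distrib by (simp add: mult_ac)
      qed
      also have "\<dots> = (\<Sum>i\<in>{k..n - k}. t k i)"
        by (rule sum.reindex_bij_witness[of _ "\<lambda>i. i - k" "\<lambda>l. k + l"]) (use True in auto)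
      also have "\<dots> = (\<Sum>i\<in>{i\<in>{..n}. k \<le> i \<and> k \<le> n - i}. t k i)"
        by (rule sum.cong) (use True in auto)
      also have "\<dots> = (\<Sum>i\<le>n. if k \<le> i \<and> k \<le> n - i then t k i else 0)"
        by (rule sum.inter_filter) simp
      finally show ?thesis .
    qed
  qed
  also have "\<dots> = (\<Sum>i\<le>n. \<Sum>k\<le>n. if k \<le> i \<and> k \<le> n - i then t k i else 0)"
    by (rule sum.swap)
  also have "\<dots> = (\<Sum>i\<le>n. fact n * ?p n * ?X ^ i * ?Y ^ (n - i) / (fact i * fact (n - i) * ?p i * ?p (n - i)))"
  proof (rule sum.cong[OF refl])
    fix i assume "i \<in> {..n}"
    then have i: "i \<le> n" by simp
    have "(\<Sum>k\<le>n. if k \<le> i \<and> k \<le> n - i then t k i else 0) = (\<Sum>k\<le>i. if k \<le> n - i then t k i else 0)"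
      by (rule sum.mono_neutral_cong_right) (use i in auto)
    also have "\<dots> = (\<Sum>k\<le>i. fact n / (fact i * fact (n - i)) * ?X ^ i * ?Y ^ (n - i) *
        (real (i choose k) * real (n - i choose k) * fact k / ?p k))"
    proof (rule sum.cong[OF refl])
      fix k assume "k \<in> {..i}"
      then have k: "k \<le> i" by simp
      show "(if k \<le> n - i then t k i else 0) = fact n / (fact i * fact (n - i)) * ?X ^ i * ?Y ^ (n - i) *
        (real (i choose k) * real (n - i choose k) * fact k / ?p k)"
      proof (cases "k \<le> n - i")
        case True
        show ?thesis
          unfolding binomial_fact[OF k] binomial_fact[OF True] t_def using True by simp
      qed simp
    qed
    also have "\<dots> = fact n / (fact i * fact (n - i)) * ?X ^ i * ?Y ^ (n - i) * (?p (i + (n - i)) / (?p i * ?p (n - i)))"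
      unfolding sum_distrib_left[symmetric]
      using chu_vandermonde_pochhammer[of "\<nu> + 1" i "n - i"] nu by simp
    also have "i + (n - i) = n" using i by simp
    finally show "(\<Sum>k\<le>n. if k \<le> i \<and> k \<le> n - i then t k i else 0) =
        fact n * ?p n * ?X ^ i * ?Y ^ (n - i) / (fact i * fact (n - i) * ?p i * ?p (n - i))"
      by (simp add: mult_ac)
  qed
  finally show ?thesis .
qed

text \<open>
  The right-hand side is a Cauchy product of power series, and its terms are exactly the angular integrals of
  the powers of the squared third side.
\<close>

lemma bessel_j_product_formula:
  "(\<integral>\<theta>. bessel_j \<nu> (side x y \<theta>) \<partial>\<alpha>) = bessel_j \<nu> x * bessel_j \<nu> y"
proof -
  let ?B = "(\<bar>x\<bar> + \<bar>y\<bar>)\<^sup>2" and ?a = "bessel_coeff \<nu>"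
  have le: "\<bar>x\<^sup>2 + y\<^sup>2 - 2 * x * y * cos \<theta>\<bar> \<le> ?B" for \<theta>
  proof -
    have "\<bar>x * y * cos \<theta>\<bar> \<le> \<bar>x * y\<bar>"
      unfolding abs_mult[of "x * y"] by (rule mult_left_le) auto
    then have "- (x * y * cos \<theta>) \<le> \<bar>x * y\<bar>" by (rule abs_le_D2)
    then have "- (2 * x * y * cos \<theta>) \<le> 2 * \<bar>x\<bar> * \<bar>y\<bar>" by (simp add: abs_mult)
    moreover have "0 \<le> x\<^sup>2 + y\<^sup>2 - 2 * x * y * cos \<theta>" by (simp add: side_radicand)
    ultimately show ?thesis by (simp add: power2_sum)
  qed
  have "(\<integral>\<theta>. bessel_j \<nu> (side x y \<theta>) \<partial>\<alpha>) =
      (\<integral>\<theta>. (\<Sum>n. ?a n * (x\<^sup>2 + y\<^sup>2 - 2 * x * y * cos \<theta>) ^ n) \<partial>\<alpha>)"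
    by (simp only: bessel_j_eq side_squared)
  also have "\<dots> = (\<Sum>n. ?a n * (\<integral>\<theta>. (x\<^sup>2 + y\<^sup>2 - 2 * x * y * cos \<theta>) ^ n \<partial>\<alpha>))"
    by (rule angle_integral_power_series[OF _ le]) (use summable_bessel_coeff[of ?B] in simp_all)
  also have "\<dots> = (\<Sum>n. \<Sum>i\<le>n. (?a i * (x\<^sup>2) ^ i) * (?a (n - i) * (y\<^sup>2) ^ (n - i)))"
  proof (rule suminf_cong)
    fix n
    have p: "pochhammer (\<nu> + 1) k \<noteq> 0" for k using pochhammer_nu_pos[of k] by simp
    show "?a n * (\<integral>\<theta>. (x\<^sup>2 + y\<^sup>2 - 2 * x * y * cos \<theta>) ^ n \<partial>\<alpha>) =
        (\<Sum>i\<le>n. (?a i * (x\<^sup>2) ^ i) * (?a (n - i) * (y\<^sup>2) ^ (n - i)))"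
      unfolding angle_integral_side_power sum_distrib_left
    proof (rule sum.cong[OF refl])
      fix i assume "i \<in> {..n}"
      then have n: "n = i + (n - i)" by simp
      have e: "(-1::real) ^ n = (-1) ^ i * (-1) ^ (n - i)" "(4::real) ^ n = 4 ^ i * 4 ^ (n - i)"
        by (subst n, simp add: power_add)+
      show "?a n * (fact n * pochhammer (\<nu> + 1) n * (x\<^sup>2) ^ i * (y\<^sup>2) ^ (n - i) /
         (fact i * fact (n - i) * pochhammer (\<nu> + 1) i * pochhammer (\<nu> + 1) (n - i)))
        = (?a i * (x\<^sup>2) ^ i) * (?a (n - i) * (y\<^sup>2) ^ (n - i))"
        unfolding bessel_coeff_def e using p by (simp add: mult_ac)
    qed
  qed
  also have "\<dots> = (\<Sum>n. ?a n * (x\<^sup>2) ^ n) * (\<Sum>n. ?a n * (y\<^sup>2) ^ n)"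
    by (rule Cauchy_product[symmetric])
       (use summable_bessel_coeff[of "x\<^sup>2"] summable_bessel_coeff[of "y\<^sup>2"] in \<open>simp_all add: abs_mult power_abs\<close>)
  finally show ?thesis by (simp only: bessel_j_eq)
qed

lemma bessel_j_product_formula_scaled:
  "(\<integral>\<theta>. bessel_j \<nu> (l * side x y \<theta>) \<partial>\<alpha>) = bessel_j \<nu> (l * x) * bessel_j \<nu> (l * y)"
proof -
  have "bessel_j \<nu> (l * side x y \<theta>) = bessel_j \<nu> (side (l * x) (l * y) \<theta>)" for \<theta>
  proof -
    have "(l * side x y \<theta>)\<^sup>2 = (side (l * x) (l * y) \<theta>)\<^sup>2"
      unfolding power_mult_distrib side_squared by (simp add: algebra_simps power2_eq_square)
    then show ?thesis by (simp only: bessel_j_eq)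
  qed
  then show ?thesis by (simp only: bessel_j_product_formula)
qed

end

section \<open>Symmetry of translations in the half-plane\<close>

lemma borel_measurable_curried:
  assumes "case_prod f \<in> borel_measurable (borel \<Otimes>\<^sub>M borel)"
    and "a \<in> borel_measurable N" "b \<in> borel_measurable N"
  shows "(\<lambda>z. f (a z) (b z)) \<in> borel_measurable N"
  using measurable_compose[OF measurable_Pair[OF assms(2,3)] assms(1)] by simp

text \<open>
  Two substitutions on the line: \<open>u = v cot \<theta>\<close> for fixed \<open>v\<close>, and then \<open>v = r sin \<theta>\<close> for fixed \<open>\<theta>\<close>.
\<close>

lemma nn_integral_polar_half_plane:
  fixes f :: "real \<Rightarrow> real \<Rightarrow> ennreal"
  assumes f[measurable]: "case_prod f \<in> borel_measurable (borel \<Otimes>\<^sub>M borel)"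
  shows "(\<integral>\<^sup>+u. (\<integral>\<^sup>+v\<in>{0<..}. f u v \<partial>lborel) \<partial>lborel) =
    (\<integral>\<^sup>+r\<in>{0<..}. (\<integral>\<^sup>+\<theta>\<in>{0<..<pi}. ennreal r * f (r * cos \<theta>) (r * sin \<theta>) \<partial>lborel) \<partial>lborel)"
proof -
  note [measurable (raw)] = borel_measurable_curried[OF f]
  have "(\<integral>\<^sup>+u. \<integral>\<^sup>+v. f u v * indicator {0<..} v \<partial>lborel \<partial>lborel) = (\<integral>\<^sup>+v. \<integral>\<^sup>+u. f u v * indicator {0<..} v \<partial>lborel \<partial>lborel)"
    by (rule lborel_pair.Fubini') measurable
  also have "\<dots> = (\<integral>\<^sup>+v. \<integral>\<^sup>+\<theta>. indicator {0<..} v * indicator {0<..<pi} \<theta> * (ennreal (v / (sin \<theta>)\<^sup>2) * f (v * (cos \<theta> / sin \<theta>)) v) \<partial>lborel \<partial>lborel)"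
  proof (rule nn_integral_cong)
    fix v :: real
    show "(\<integral>\<^sup>+u. f u v * indicator {0<..} v \<partial>lborel) =
        (\<integral>\<^sup>+\<theta>. indicator {0<..} v * indicator {0<..<pi} \<theta> * (ennreal (v / (sin \<theta>)\<^sup>2) * f (v * (cos \<theta> / sin \<theta>)) v) \<partial>lborel)"
    proof (cases "v > 0")
      case True
      let ?g = "\<lambda>\<theta>. v * (cos \<theta> / sin \<theta>)"
      have sp: "sin \<theta> > 0" if "\<theta> \<in> {0<..<pi}" for \<theta> using that by (simp add: sin_gt_zero)
      have der: "(?g has_real_derivative - v / (sin \<theta>)\<^sup>2) (at \<theta> within S)" if "\<theta> \<in> {0<..<pi}" for \<theta> S
      proof -
        have e: "- sin \<theta> * sin \<theta> - cos \<theta> * cos \<theta> = -1"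
          using sin_cos_squared_add[of \<theta>] by (simp add: power2_eq_square)
        have "((\<lambda>\<theta>. cos \<theta> / sin \<theta>) has_real_derivative (- sin \<theta> * sin \<theta> - cos \<theta> * cos \<theta>) / (sin \<theta> * sin \<theta>)) (at \<theta> within S)"
          using sp[OF that] by (auto intro!: derivative_eq_intros)
        then have "(?g has_real_derivative v * ((- sin \<theta> * sin \<theta> - cos \<theta> * cos \<theta>) / (sin \<theta> * sin \<theta>))) (at \<theta> within S)"
          by (rule DERIV_cmult)
        then show ?thesis unfolding e by (simp add: power2_eq_square)
      qed
      have inj: "inj_on ?g {0<..<pi}"
      proof (rule linorder_inj_onI')
        fix s t assume st: "s \<in> {0<..<pi}" "t \<in> {0<..<pi}" "s < t"
        have "?g t < ?g s"
        proof (rule DERIV_neg_imp_decreasing[OF st(3)])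
          fix x assume "s \<le> x" "x \<le> t"
          then have x: "x \<in> {0<..<pi}" using st by auto
          show "\<exists>y. DERIV ?g x :> y \<and> y < 0"
            using der[OF x, of UNIV] sp[OF x] True by (intro exI conjI) auto
        qed
        then show "?g s \<noteq> ?g t" by simp
      qed
      have im: "?g ` {0<..<pi} = UNIV"
      proof -
        \<comment> \<open>The preimage of \<open>w\<close> under the scaled cotangent is \<open>arccot (w / v)\<close>, written with the arc tangent.\<close>
        have "w \<in> ?g ` {0<..<pi}" for w
        proof (rule image_eqI[of _ _ "pi / 2 - arctan (w / v)"])
          have b: "- (pi / 2) < arctan (w / v)" "arctan (w / v) < pi / 2"
            by (rule arctan_lbound arctan_ubound)+
          then show "pi / 2 - arctan (w / v) \<in> {0<..<pi}" by auto
          have "cos (pi / 2 - arctan (w / v)) / sin (pi / 2 - arctan (w / v)) = tan (arctan (w / v))"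
            unfolding tan_def by (simp add: cos_sin_eq[symmetric] sin_cos_eq[symmetric] cos_diff sin_diff)
          then show "w = ?g (pi / 2 - arctan (w / v))" using True by (simp add: tan_arctan)
        qed
        then show ?thesis by auto
      qed
      have "(\<integral>\<^sup>+u\<in>?g ` {0<..<pi}. f u v \<partial>lborel) = (\<integral>\<^sup>+\<theta>\<in>{0<..<pi}. ennreal \<bar>- v / (sin \<theta>)\<^sup>2\<bar> * f (?g \<theta>) v \<partial>lborel)"
        by (rule nn_integral_substitution_inj[where g = ?g and g' = "\<lambda>\<theta>. - v / (sin \<theta>)\<^sup>2"])
           (use der inj im in simp_all)
      then show ?thesis using True im by (simp add: mult_ac)
    qed simp
  qed
  also have "\<dots> = (\<integral>\<^sup>+\<theta>. \<integral>\<^sup>+v. indicator {0<..} v * indicator {0<..<pi} \<theta> * (ennreal (v / (sin \<theta>)\<^sup>2) * f (v * (cos \<theta> / sin \<theta>)) v) \<partial>lborel \<partial>lborel)"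
    by (rule lborel_pair.Fubini') measurable
  also have "\<dots> = (\<integral>\<^sup>+\<theta>. \<integral>\<^sup>+r. indicator {0<..} r * indicator {0<..<pi} \<theta> * (ennreal r * f (r * cos \<theta>) (r * sin \<theta>)) \<partial>lborel \<partial>lborel)"
  proof (rule nn_integral_cong)
    fix \<theta> :: real
    show "(\<integral>\<^sup>+v. indicator {0<..} v * indicator {0<..<pi} \<theta> * (ennreal (v / (sin \<theta>)\<^sup>2) * f (v * (cos \<theta> / sin \<theta>)) v) \<partial>lborel) =
        (\<integral>\<^sup>+r. indicator {0<..} r * indicator {0<..<pi} \<theta> * (ennreal r * f (r * cos \<theta>) (r * sin \<theta>)) \<partial>lborel)"
    proof (cases "\<theta> \<in> {0<..<pi}")
      case True
      then have s: "sin \<theta> > 0" by (simp add: sin_gt_zero)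
      let ?h = "\<lambda>v. indicator {0<..} v * (ennreal (v / (sin \<theta>)\<^sup>2) * f (v * (cos \<theta> / sin \<theta>)) v)"
      have "(\<integral>\<^sup>+v. ?h v \<partial>lborel) = ennreal \<bar>sin \<theta>\<bar> * (\<integral>\<^sup>+r. ?h (0 + sin \<theta> * r) \<partial>lborel)"
        using s by (intro nn_integral_real_affine) auto
      also have "\<dots> = (\<integral>\<^sup>+r. ennreal \<bar>sin \<theta>\<bar> * ?h (0 + sin \<theta> * r) \<partial>lborel)"
        by (rule nn_integral_cmult[symmetric]) measurable
      also have "\<dots> = (\<integral>\<^sup>+r. indicator {0<..} r * (ennreal r * f (r * cos \<theta>) (r * sin \<theta>)) \<partial>lborel)"
      proof (rule nn_integral_cong)
        fix r :: real
        show "ennreal \<bar>sin \<theta>\<bar> * ?h (0 + sin \<theta> * r) = indicator {0<..} r * (ennreal r * f (r * cos \<theta>) (r * sin \<theta>))"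
        proof (cases "r > 0")
          case True
          have "ennreal (sin \<theta>) * ennreal (sin \<theta> * r / (sin \<theta>)\<^sup>2) = ennreal r"
            using s True by (simp add: ennreal_mult'[symmetric] power2_eq_square)
          then show ?thesis using s True by (simp add: mult.assoc[symmetric]) (simp add: mult_ac)
        qed (use s in \<open>simp add: zero_less_mult_iff\<close>)
      qed
      finally show ?thesis using True by simp
    qed simp
  qed
  also have "\<dots> = (\<integral>\<^sup>+r. \<integral>\<^sup>+\<theta>. indicator {0<..} r * indicator {0<..<pi} \<theta> * (ennreal r * f (r * cos \<theta>) (r * sin \<theta>)) \<partial>lborel \<partial>lborel)"
    by (rule lborel_pair.Fubini') measurable
  also have "\<dots> = (\<integral>\<^sup>+r\<in>{0<..}. (\<integral>\<^sup>+\<theta>\<in>{0<..<pi}. ennreal r * f (r * cos \<theta>) (r * sin \<theta>) \<partial>lborel) \<partial>lborel)"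
    by (intro nn_integral_cong) (auto split: split_indicator simp: mult_ac)
  finally show ?thesis .
qed

lemma sigma_finite_radial_measure: "sigma_finite_measure (radial_measure \<nu>)"
  unfolding radial_measure_def by (subst sigma_finite_measure.sigma_finite_iff_density_finite[OF sigma_finite_lborel]) auto

context bessel_order
begin

sublocale R: sigma_finite_measure "\<rho>" by (rule sigma_finite_radial_measure)
sublocale RA: pair_sigma_finite "\<rho>" "\<alpha>" ..
sublocale RR: pair_sigma_finite "\<rho>" "\<rho>" ..

lemma nn_integral_angle:
  assumes [measurable]: "f \<in> borel_measurable borel"
  shows "(\<integral>\<^sup>+\<theta>. f \<theta> \<partial>\<alpha>) = (\<integral>\<^sup>+\<theta>\<in>{0<..<pi}. ennreal (angle_const \<nu> * sin \<theta> powr (2 * \<nu>)) * f \<theta> \<partial>lborel)"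
  unfolding angle_measure_def
  by (subst nn_integral_density) (auto intro!: nn_integral_cong split: split_indicator)

lemma nn_integral_radial:
  assumes [measurable]: "f \<in> borel_measurable borel"
  shows "(\<integral>\<^sup>+y. f y \<partial>\<rho>) = (\<integral>\<^sup>+y\<in>{0<..}. ennreal (y powr (2 * \<nu> + 1)) * f y \<partial>lborel)"
  unfolding radial_measure_def
  by (subst nn_integral_density) (auto intro!: nn_integral_cong split: split_indicator)

text \<open>
  With \<open>u = x cos \<theta>\<close> and \<open>v = x sin \<theta>\<close> the weights combine to \<open>v\<^bsup>2\<nu>\<^esup> du dv\<close>, and the third side is the distance
  of \<open>(u, v)\<close> from \<open>(y, 0)\<close>.
\<close>

lemma nn_integral_side_half_plane:
  fixes h :: "real \<Rightarrow> real \<Rightarrow> ennreal"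
  assumes h[measurable]: "case_prod h \<in> borel_measurable (borel \<Otimes>\<^sub>M borel)"
  shows "(\<integral>\<^sup>+x. \<integral>\<^sup>+\<theta>. h x (side x y \<theta>) \<partial>\<alpha> \<partial>\<rho>) =
    (\<integral>\<^sup>+u. (\<integral>\<^sup>+v\<in>{0<..}. ennreal (angle_const \<nu> * v powr (2 * \<nu>)) * h (sqrt (u\<^sup>2 + v\<^sup>2)) (sqrt ((u - y)\<^sup>2 + v\<^sup>2)) \<partial>lborel) \<partial>lborel)"
proof -
  note [measurable (raw)] = borel_measurable_curried[OF h]
  let ?f = "\<lambda>u v. ennreal (angle_const \<nu> * v powr (2 * \<nu>)) * h (sqrt (u\<^sup>2 + v\<^sup>2)) (sqrt ((u - y)\<^sup>2 + v\<^sup>2))"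
  have "(\<integral>\<^sup>+x. \<integral>\<^sup>+\<theta>. h x (side x y \<theta>) \<partial>\<alpha> \<partial>\<rho>) =
      (\<integral>\<^sup>+x\<in>{0<..}. ennreal (x powr (2 * \<nu> + 1)) * (\<integral>\<^sup>+\<theta>\<in>{0<..<pi}. ennreal (angle_const \<nu> * sin \<theta> powr (2 * \<nu>)) * h x (side x y \<theta>) \<partial>lborel) \<partial>lborel)"
    by (subst nn_integral_radial, measurable, subst nn_integral_angle) auto
  also have "\<dots> = (\<integral>\<^sup>+x\<in>{0<..}. (\<integral>\<^sup>+\<theta>\<in>{0<..<pi}. ennreal x * ?f (x * cos \<theta>) (x * sin \<theta>) \<partial>lborel) \<partial>lborel)"
  proof (rule nn_integral_cong)
    fix x :: real
    show "ennreal (x powr (2 * \<nu> + 1)) * (\<integral>\<^sup>+\<theta>\<in>{0<..<pi}. ennreal (angle_const \<nu> * sin \<theta> powr (2 * \<nu>)) * h x (side x y \<theta>) \<partial>lborel) * indicator {0<..} x =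
       (\<integral>\<^sup>+\<theta>\<in>{0<..<pi}. ennreal x * ?f (x * cos \<theta>) (x * sin \<theta>) \<partial>lborel) * indicator {0<..} x"
    proof (cases "x > 0")
      case True
      have "ennreal (x powr (2 * \<nu> + 1)) * (\<integral>\<^sup>+\<theta>\<in>{0<..<pi}. ennreal (angle_const \<nu> * sin \<theta> powr (2 * \<nu>)) * h x (side x y \<theta>) \<partial>lborel)
          = (\<integral>\<^sup>+\<theta>. ennreal (x powr (2 * \<nu> + 1)) * (ennreal (angle_const \<nu> * sin \<theta> powr (2 * \<nu>)) * h x (side x y \<theta>) * indicator {0<..<pi} \<theta>) \<partial>lborel)"
        by (rule nn_integral_cmult[symmetric]) measurable
      also have "\<dots> = (\<integral>\<^sup>+\<theta>\<in>{0<..<pi}. ennreal x * ?f (x * cos \<theta>) (x * sin \<theta>) \<partial>lborel)"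
      proof (rule nn_integral_cong)
        fix \<theta> :: real
        show "ennreal (x powr (2 * \<nu> + 1)) * (ennreal (angle_const \<nu> * sin \<theta> powr (2 * \<nu>)) * h x (side x y \<theta>) * indicator {0<..<pi} \<theta>)
            = ennreal x * ?f (x * cos \<theta>) (x * sin \<theta>) * indicator {0<..<pi} \<theta>"
        proof (cases "\<theta> \<in> {0<..<pi}")
          case t: True
          then have s: "sin \<theta> > 0" by (simp add: sin_gt_zero)
          have e1: "sqrt ((x * cos \<theta>)\<^sup>2 + (x * sin \<theta>)\<^sup>2) = x"
            using True by (simp add: power_mult_distrib distrib_left[symmetric])
          have e2: "sqrt ((x * cos \<theta> - y)\<^sup>2 + (x * sin \<theta>)\<^sup>2) = side x y \<theta>"
            unfolding side_commute[of x] unfolding side_def side_radicand by (simp add: power2_commute)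
          have "ennreal (x powr (2 * \<nu> + 1)) * ennreal (angle_const \<nu> * sin \<theta> powr (2 * \<nu>)) = 
              ennreal x * ennreal (angle_const \<nu> * (x * sin \<theta>) powr (2 * \<nu>))"
            using s True angle_const_pos
            by (simp add: ennreal_mult'[symmetric] powr_add powr_mult mult_ac)
          then show ?thesis using t unfolding e1 e2 by (simp add: mult.assoc[symmetric])
        qed simp
      qed
      finally show ?thesis by simp
    qed simp
  qed
  also have "\<dots> = (\<integral>\<^sup>+u. (\<integral>\<^sup>+v\<in>{0<..}. ?f u v \<partial>lborel) \<partial>lborel)"
    by (rule nn_integral_polar_half_plane[symmetric]) measurable
  finally show ?thesis .
qed

text \<open>
  The reflection \<open>u \<mapsto> y - u\<close> of the half-plane exchanges the distances from \<open>(0, 0)\<close> and from \<open>(y, 0)\<close>.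
\<close>

lemma nn_integral_side_symmetric:
  fixes h :: "real \<Rightarrow> real \<Rightarrow> ennreal"
  assumes h[measurable]: "case_prod h \<in> borel_measurable (borel \<Otimes>\<^sub>M borel)"
  shows "(\<integral>\<^sup>+x. \<integral>\<^sup>+\<theta>. h x (side x y \<theta>) \<partial>\<alpha> \<partial>\<rho>) =
    (\<integral>\<^sup>+x. \<integral>\<^sup>+\<theta>. h (side x y \<theta>) x \<partial>\<alpha> \<partial>\<rho>)"
proof -
  note [measurable (raw)] = borel_measurable_curried[OF h]
  let ?f = "\<lambda>u. \<integral>\<^sup>+v\<in>{0<..}. ennreal (angle_const \<nu> * v powr (2 * \<nu>)) * h (sqrt (u\<^sup>2 + v\<^sup>2)) (sqrt ((u - y)\<^sup>2 + v\<^sup>2)) \<partial>lborel"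
  have "(\<integral>\<^sup>+x. \<integral>\<^sup>+\<theta>. h x (side x y \<theta>) \<partial>\<alpha> \<partial>\<rho>) = (\<integral>\<^sup>+u. ?f u \<partial>lborel)"
    by (rule nn_integral_side_half_plane) measurable
  also have "\<dots> = ennreal \<bar>-1\<bar> * (\<integral>\<^sup>+u. ?f (y + (-1) * u) \<partial>lborel)"
    by (rule nn_integral_real_affine) auto
  also have "\<dots> = (\<integral>\<^sup>+u. (\<integral>\<^sup>+v\<in>{0<..}. ennreal (angle_const \<nu> * v powr (2 * \<nu>)) * h (sqrt ((u - y)\<^sup>2 + v\<^sup>2)) (sqrt (u\<^sup>2 + v\<^sup>2)) \<partial>lborel) \<partial>lborel)"
    by (simp add: power2_commute)
  also have "\<dots> = (\<integral>\<^sup>+x. \<integral>\<^sup>+\<theta>. h (side x y \<theta>) x \<partial>\<alpha> \<partial>\<rho>)"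
    by (rule nn_integral_side_half_plane[symmetric, of "\<lambda>a b. h b a"]) measurable
  finally show ?thesis .
qed

end

section \<open>Bessel translation, convolution and Hankel transform\<close>

text \<open>
  If \<open>f\<close> is not integrable, its Bochner integral is \<open>0\<close> by convention and the estimate is trivial.
\<close>

lemma norm_integral_le_nn_integral:
  fixes f :: "'a \<Rightarrow> 'b::{banach, second_countable_topology}"
  shows "ennreal (norm (\<integral>x. f x \<partial>M)) \<le> (\<integral>\<^sup>+x. ennreal (norm (f x)) \<partial>M)"
proof (cases "integrable M f")
  case True
  then show ?thesis by (rule integral_norm_bound_ennreal)
qed (simp add: not_integrable_integral_eq)

text \<open>
  Hoelder's inequality against the constant function \<open>1\<close>, for a finite measure. Young's inequality is applied to
  \<open>g / s\<close> and \<open>1\<close> with the number \<open>s\<close> for which both terms have the weights \<open>1/p\<close> and \<open>1/q\<close>. The number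
  \<open>c\<close> stands for the norm of a convolution at a point, which the integral of \<open>g\<close> bounds from above.
\<close>

lemma powr_mean_le:
  fixes g :: "'a \<Rightarrow> real"
  assumes A: "emeasure M (space M) \<le> ennreal A" "A > 0" and p: "p > 1"
    and g[measurable]: "g \<in> borel_measurable M" "\<And>x. g x \<ge> 0"
    and c: "c \<ge> 0" "ennreal c \<le> (\<integral>\<^sup>+x. ennreal (g x) \<partial>M)"
  shows "ennreal (c powr p) \<le> ennreal (A powr (p - 1)) * (\<integral>\<^sup>+x. ennreal (g x powr p) \<partial>M)"
proof (cases "\<integral>\<^sup>+x. ennreal (g x powr p) \<partial>M")
  case top
  then show ?thesis using A(2) by (simp add: ennreal_mult_top)
next
  case (real K)
  show ?thesis
  proof (cases "K = 0")
    case True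
    then have "AE x in M. ennreal (g x powr p) = 0"
      using real by (subst nn_integral_0_iff_AE[symmetric]) auto
    then have "AE x in M. ennreal (g x) = 0"
      by eventually_elim (use g(2) in \<open>auto simp: ennreal_eq_0_iff\<close>)
    then have "(\<integral>\<^sup>+x. ennreal (g x) \<partial>M) = 0"
      by (subst nn_integral_0_iff_AE) auto
    then show ?thesis using c p by simp
  next
    case False
    then have K: "K > 0" using real by simp
    define q where "q = p / (p - 1)"
    have q: "q > 1" "1 / p + 1 / q = 1" using p by (auto simp: q_def field_simps)
    \<comment> \<open>For this \<open>s\<close> the integrals of the two terms of Young's inequality are \<open>s A / p\<close> and \<open>s A / q\<close>.\<close>
    define s where "s = (K / A) powr (1 / p)"
    have s: "s > 0" using K A by (simp add: s_def)
    have sp: "s powr p = K / A" using K A p by (simp add: s_def powr_powr)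
    have "(\<integral>\<^sup>+x. ennreal (g x) \<partial>M) \<le> (\<integral>\<^sup>+x. ennreal (s / (p * s powr p)) * ennreal (g x powr p) + ennreal (s / q) \<partial>M)"
    proof (rule nn_integral_mono)
      fix x
      have "g x / s * 1 \<le> (g x / s) powr p / p + 1 powr q / q"
        using Youngs_inequality[OF p q(1) q(2), of "g x / s" 1] g(2)[of x] s by simp
      then have "g x \<le> s * ((g x / s) powr p / p + 1 / q)" using s by (simp add: field_simps)
      also have "\<dots> = s / (p * s powr p) * g x powr p + s / q"
        using s g(2)[of x] by (simp add: powr_divide field_simps)
      finally have "ennreal (g x) \<le> ennreal (s / (p * s powr p) * g x powr p + s / q)"
        by (rule ennreal_leI)
      also have "\<dots> = ennreal (s / (p * s powr p)) * ennreal (g x powr p) + ennreal (s / q)"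
        using s p q by (subst ennreal_plus) (auto simp: ennreal_mult[symmetric])
      finally show "ennreal (g x) \<le> ennreal (s / (p * s powr p)) * ennreal (g x powr p) + ennreal (s / q)" .
    qed
    also have "\<dots> = ennreal (s / (p * s powr p)) * ennreal K + ennreal (s / q) * emeasure M (space M)"
      using real by (simp add: nn_integral_add nn_integral_cmult)
    also have "\<dots> \<le> ennreal (s / (p * s powr p)) * ennreal K + ennreal (s / q) * ennreal A"
      by (intro add_left_mono mult_left_mono A) simp
    also have "\<dots> = ennreal (s / (p * s powr p) * K + s / q * A)"
      using s p q K A by (simp add: ennreal_mult[symmetric])
    also have "s / (p * s powr p) * K + s / q * A = s * A * (1 / p + 1 / q)"
      unfolding sp using K A p q by (simp add: field_simps)
    also have "\<dots> = s * A" using q by simp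
    finally have "ennreal c \<le> ennreal (s * A)" using c by simp
    then have "c \<le> s * A" using s A by simp
    then have "c powr p \<le> (s * A) powr p" using c p by (intro powr_mono2) auto
    also have "\<dots> = A powr (p - 1) * K"
      using s A K sp by (simp add: powr_mult powr_diff)
    finally show ?thesis using real A by (simp add: ennreal_mult[symmetric] ennreal_leI)
  qed
qed

context bessel_order
begin

definition translate :: "(real \<Rightarrow> complex) \<Rightarrow> real \<Rightarrow> real \<Rightarrow> complex" where
  "translate F x y = (\<integral>\<theta>. F (side x y \<theta>) \<partial>\<alpha>)"

definition bessel_conv :: "(real \<Rightarrow> complex) \<Rightarrow> (real \<Rightarrow> complex) \<Rightarrow> real \<Rightarrow> complex" where
  "bessel_conv F G x = (\<integral>y. translate F x y * G y \<partial>\<rho>)"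

definition hankel :: "(real \<Rightarrow> complex) \<Rightarrow> real \<Rightarrow> complex" where
  "hankel F t = (\<integral>y. of_real (bessel_j \<nu> (t * y)) * F y \<partial>\<rho>)"

lemma translate_measurable[measurable (raw)]:
  assumes F[measurable]: "F \<in> borel_measurable borel"
    and [measurable]: "a \<in> borel_measurable N" "b \<in> borel_measurable N"
  shows "(\<lambda>z. translate F (a z) (b z)) \<in> borel_measurable N"
  unfolding translate_def by measurable

text \<open>
  By symmetry the third side can be exchanged with \<open>x\<close>, after which the angle is integrated out.
\<close>

lemma nn_integral_translate_invariant:
  assumes [measurable]: "u \<in> borel_measurable borel"
  shows "(\<integral>\<^sup>+x. \<integral>\<^sup>+\<theta>. u (side x y \<theta>) \<partial>\<alpha> \<partial>\<rho>) = (\<integral>\<^sup>+x. u x \<partial>\<rho>)"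
proof -
  have "(\<integral>\<^sup>+x. \<integral>\<^sup>+\<theta>. u (side x y \<theta>) \<partial>\<alpha> \<partial>\<rho>) =
      (\<integral>\<^sup>+x. \<integral>\<^sup>+\<theta>. u x \<partial>\<alpha> \<partial>\<rho>)"
    by (rule nn_integral_side_symmetric[of "\<lambda>x s. u s"]) measurable
  then show ?thesis by (simp add: A.emeasure_space_1[simplified])
qed

text \<open>
  As an equality of measures, the symmetry applies to complex-valued integrands.
\<close>

lemma distr_side_symmetric:
  "distr (\<rho> \<Otimes>\<^sub>M \<alpha>) (borel \<Otimes>\<^sub>M borel) (\<lambda>(x, \<theta>). (x, side x y \<theta>)) =
   distr (\<rho> \<Otimes>\<^sub>M \<alpha>) (borel \<Otimes>\<^sub>M borel) (\<lambda>(x, \<theta>). (side x y \<theta>, x))"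
  (is "?P = ?Q")
proof (rule measure_eqI)
  fix B assume "B \<in> sets ?P"
  then have B[measurable]: "B \<in> sets (borel \<Otimes>\<^sub>M borel)" by simp
  let ?h = "\<lambda>x s. indicator B (x, s) :: ennreal"
  have h: "case_prod ?h \<in> borel_measurable (borel \<Otimes>\<^sub>M borel)" by measurable
  have "emeasure ?P B = (\<integral>\<^sup>+z. ?h (fst z) (snd z) \<partial>?P)"
    by (simp add: nn_integral_indicator[symmetric] del: nn_integral_indicator)
  also have "\<dots> = (\<integral>\<^sup>+x. \<integral>\<^sup>+\<theta>. ?h x (side x y \<theta>) \<partial>\<alpha> \<partial>\<rho>)"
    by (subst nn_integral_distr, measurable, subst A.nn_integral_fst[symmetric], measurable, (auto simp: case_prod_beta)?)
  also have "\<dots> = (\<integral>\<^sup>+x. \<integral>\<^sup>+\<theta>. ?h (side x y \<theta>) x \<partial>\<alpha> \<partial>\<rho>)"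
    by (rule nn_integral_side_symmetric[OF h])
  also have "\<dots> = (\<integral>\<^sup>+z. ?h (fst z) (snd z) \<partial>?Q)"
    by (subst nn_integral_distr, measurable, subst A.nn_integral_fst[symmetric], measurable, (auto simp: case_prod_beta)?)
  also have "\<dots> = emeasure ?Q B"
    by (simp add: nn_integral_indicator[symmetric] del: nn_integral_indicator)
  finally show "emeasure ?P B = emeasure ?Q B" .
qed simp

lemma translate_self_adjoint:
  assumes F: "integrable \<rho> F"
    and k[measurable]: "k \<in> borel_measurable borel" and B: "\<And>x. norm (k x) \<le> B"
  shows "(\<integral>x. translate F x y * k x \<partial>\<rho>) = (\<integral>x. F x * translate k x y \<partial>\<rho>)"
proof -
  have Fm[measurable]: "F \<in> borel_measurable borel" using borel_measurable_integrable[OF F] by simp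
  let ?RA = "\<rho> \<Otimes>\<^sub>M \<alpha>"
  have Fi: "integrable ?RA (\<lambda>(x, \<theta>). F x * k (side x y \<theta>))"
  proof (rule Bochner_Integration.integrable_bound)
    show "integrable ?RA (\<lambda>(x, \<theta>). of_real B * F x)"
    proof (rule RA.Fubini_integrable)
      show "(\<lambda>(x, \<theta>). of_real B * F x) \<in> borel_measurable ?RA" by measurable
      show "integrable \<rho> (\<lambda>x. \<integral>\<theta>. norm (case (x, \<theta>) of (x, \<theta>) \<Rightarrow> of_real B * F x) \<partial>\<alpha>)"
        using A.prob_space F by (simp add: norm_mult)
      show "AE x in \<rho>. integrable \<alpha> (\<lambda>\<theta>. case (x, \<theta>) of (x, \<theta>) \<Rightarrow> of_real B * F x)"
        by simp
    qed
    show "(\<lambda>(x, \<theta>). F x * k (side x y \<theta>)) \<in> borel_measurable ?RA" by measurable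
    show "AE z in ?RA. norm (case z of (x, \<theta>) \<Rightarrow> F x * k (side x y \<theta>)) \<le> norm (case z of (x, \<theta>) \<Rightarrow> of_real B * F x)"
    proof (rule AE_I2, clarify)
      fix x \<theta>
      have "norm (k (side x y \<theta>)) \<le> \<bar>B\<bar>" using B[of "side x y \<theta>"] by simp
      then show "norm (F x * k (side x y \<theta>)) \<le> norm (of_real B * F x)"
        by (simp add: norm_mult mult.commute[of "norm (F x)"] mult_right_mono)
    qed
  qed
  let ?P = "distr ?RA (borel \<Otimes>\<^sub>M borel) (\<lambda>(x, \<theta>). (x, side x y \<theta>))"
  let ?Q = "distr ?RA (borel \<Otimes>\<^sub>M borel) (\<lambda>(x, \<theta>). (side x y \<theta>, x))"
  have "integrable ?P (\<lambda>(x, s). F x * k s)"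
    using Fi[unfolded case_prod_beta] by (subst integrable_distr_eq) (auto simp: case_prod_beta)
  then have "integrable ?Q (\<lambda>(x, s). F x * k s)" by (simp only: distr_side_symmetric)
  then have Fi2: "integrable ?RA (\<lambda>(x, \<theta>). F (side x y \<theta>) * k x)"
    by (subst (asm) integrable_distr_eq) (simp_all add: case_prod_beta')
  have "(\<integral>x. translate F x y * k x \<partial>\<rho>) = (\<integral>x. \<integral>\<theta>. F (side x y \<theta>) * k x \<partial>\<alpha> \<partial>\<rho>)"
    by (simp add: translate_def)
  also have "\<dots> = (\<integral>z. (case z of (x, \<theta>) \<Rightarrow> F (side x y \<theta>) * k x) \<partial>?RA)"
    using RA.integral_fst'[OF Fi2] by simp
  also have "\<dots> = (\<integral>z. (case z of (x, s) \<Rightarrow> F x * k s) \<partial>?Q)"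
    by (subst integral_distr) (simp_all add: case_prod_beta')
  also have "\<dots> = (\<integral>z. (case z of (x, s) \<Rightarrow> F x * k s) \<partial>?P)" by (simp only: distr_side_symmetric)
  also have "\<dots> = (\<integral>z. (case z of (x, \<theta>) \<Rightarrow> F x * k (side x y \<theta>)) \<partial>?RA)"
    by (subst integral_distr) (simp_all add: case_prod_beta')
  also have "\<dots> = (\<integral>x. \<integral>\<theta>. F x * k (side x y \<theta>) \<partial>\<alpha> \<partial>\<rho>)"
    using RA.integral_fst'[OF Fi] by simp
  also have "\<dots> = (\<integral>x. F x * translate k x y \<partial>\<rho>)"
    by (simp add: translate_def)
  finally show ?thesis .
qed

lemma bessel_conv_measurable[measurable]:
  assumes [measurable]: "F \<in> borel_measurable borel" "G \<in> borel_measurable borel"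
  shows "bessel_conv F G \<in> borel_measurable borel"
  unfolding bessel_conv_def[abs_def] by measurable

text \<open>
  Symmetry moves the translation from \<open>F\<close> to \<open>G\<close>. On the right-hand side \<open>G\<close> is averaged over a measure that
  does not depend on \<open>x\<close>, and whose mass is finite if \<open>F\<close> is integrable.
\<close>

lemma nn_integral_conv_integrand_le:
  assumes [measurable]: "F \<in> borel_measurable borel" "G \<in> borel_measurable borel"
  shows "(\<integral>\<^sup>+y. ennreal (norm (translate F x y * G y)) \<partial>\<rho>)
    \<le> (\<integral>\<^sup>+y. \<integral>\<^sup>+\<theta>. ennreal (norm (F y)) * ennreal (norm (G (side x y \<theta>))) \<partial>\<alpha> \<partial>\<rho>)"
proof -
  have "(\<integral>\<^sup>+y. ennreal (norm (translate F x y * G y)) \<partial>\<rho>)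
    \<le> (\<integral>\<^sup>+y. \<integral>\<^sup>+\<theta>. ennreal (norm (F (side x y \<theta>))) * ennreal (norm (G y)) \<partial>\<alpha> \<partial>\<rho>)"
  proof (rule nn_integral_mono)
    fix y
    have "ennreal (norm (translate F x y * G y)) = ennreal (norm (translate F x y)) * ennreal (norm (G y))"
      by (simp add: norm_mult ennreal_mult)
    also have "\<dots> \<le> (\<integral>\<^sup>+\<theta>. ennreal (norm (F (side x y \<theta>))) \<partial>\<alpha>) * ennreal (norm (G y))"
      unfolding translate_def by (intro mult_right_mono norm_integral_le_nn_integral) simp
    also have "\<dots> = (\<integral>\<^sup>+\<theta>. ennreal (norm (F (side x y \<theta>))) * ennreal (norm (G y)) \<partial>\<alpha>)"
      by (rule nn_integral_multc[symmetric]) measurable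
    finally show "ennreal (norm (translate F x y * G y)) \<le> \<dots>" .
  qed
  also have "\<dots> = (\<integral>\<^sup>+y. \<integral>\<^sup>+\<theta>. ennreal (norm (F y)) * ennreal (norm (G (side x y \<theta>))) \<partial>\<alpha> \<partial>\<rho>)"
    unfolding side_commute[of x]
    by (rule nn_integral_side_symmetric[of "\<lambda>y s. ennreal (norm (F s)) * ennreal (norm (G y))"]) measurable
  finally show ?thesis .
qed

lemma nn_integral_conv_integrand_total:
  assumes [measurable]: "F \<in> borel_measurable borel" "u \<in> borel_measurable borel"
  shows "(\<integral>\<^sup>+x. \<integral>\<^sup>+y. \<integral>\<^sup>+\<theta>. ennreal (norm (F y)) * u (side x y \<theta>) \<partial>\<alpha> \<partial>\<rho> \<partial>\<rho>)
    = (\<integral>\<^sup>+y. ennreal (norm (F y)) \<partial>\<rho>) * (\<integral>\<^sup>+x. u x \<partial>\<rho>)"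
proof -
  have "(\<integral>\<^sup>+x. \<integral>\<^sup>+y. \<integral>\<^sup>+\<theta>. ennreal (norm (F y)) * u (side x y \<theta>) \<partial>\<alpha> \<partial>\<rho> \<partial>\<rho>)
      = (\<integral>\<^sup>+y. \<integral>\<^sup>+x. \<integral>\<^sup>+\<theta>. ennreal (norm (F y)) * u (side x y \<theta>) \<partial>\<alpha> \<partial>\<rho> \<partial>\<rho>)"
    by (rule RR.Fubini') measurable
  also have "\<dots> = (\<integral>\<^sup>+y. ennreal (norm (F y)) * (\<integral>\<^sup>+x. \<integral>\<^sup>+\<theta>. u (side x y \<theta>) \<partial>\<alpha> \<partial>\<rho>) \<partial>\<rho>)"
    by (simp add: nn_integral_cmult)
  also have "\<dots> = (\<integral>\<^sup>+y. ennreal (norm (F y)) \<partial>\<rho>) * (\<integral>\<^sup>+x. u x \<partial>\<rho>)"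
    by (simp add: nn_integral_translate_invariant nn_integral_multc)
  finally show ?thesis .
qed

text \<open>
  Fubini's theorem, self-adjointness of the translations and the product formula, in this order.
\<close>

lemma bessel_conv_L1:
  assumes F: "integrable \<rho> F" and G: "integrable \<rho> G"
  shows integrable_bessel_conv: "integrable \<rho> (bessel_conv F G)"
    and hankel_bessel_conv: "hankel (bessel_conv F G) t = hankel F t * hankel G t"
proof -
  have Fm[measurable]: "F \<in> borel_measurable borel" using borel_measurable_integrable[OF F] by simp
  have Gm[measurable]: "G \<in> borel_measurable borel" using borel_measurable_integrable[OF G] by simp
  let ?R = "\<rho>"
  let ?\<Phi> = "\<lambda>(x, y). translate F x y * G y"
  have \<Phi>m[measurable]: "?\<Phi> \<in> borel_measurable (borel \<Otimes>\<^sub>M borel)" by measurable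
  have int\<Phi>: "integrable (?R \<Otimes>\<^sub>M ?R) ?\<Phi>"
  proof (rule integrableI_bounded)
    show "?\<Phi> \<in> borel_measurable (?R \<Otimes>\<^sub>M ?R)" by measurable
    have "(\<integral>\<^sup>+z. ennreal (norm (?\<Phi> z)) \<partial>(?R \<Otimes>\<^sub>M ?R)) = (\<integral>\<^sup>+x. \<integral>\<^sup>+y. ennreal (norm (translate F x y * G y)) \<partial>?R \<partial>?R)"
      by (subst R.nn_integral_fst[symmetric]) (auto simp: case_prod_beta)
    also have "\<dots> \<le> (\<integral>\<^sup>+x. \<integral>\<^sup>+y. \<integral>\<^sup>+\<theta>. ennreal (norm (F y)) * ennreal (norm (G (side x y \<theta>))) \<partial>\<alpha> \<partial>?R \<partial>?R)"
      by (intro nn_integral_mono nn_integral_conv_integrand_le) measurable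
    also have "\<dots> = (\<integral>\<^sup>+y. ennreal (norm (F y)) \<partial>?R) * (\<integral>\<^sup>+x. ennreal (norm (G x)) \<partial>?R)"
      by (rule nn_integral_conv_integrand_total) measurable
    also have "\<dots> < \<infinity>"
      using F G by (simp add: integrable_iff_bounded ennreal_mult_less_top)
    finally show "(\<integral>\<^sup>+z. ennreal (norm (?\<Phi> z)) \<partial>(?R \<Otimes>\<^sub>M ?R)) < \<infinity>" .
  qed
  show "integrable ?R (bessel_conv F G)"
    using RR.integrable_fst'[OF int\<Phi>] by (simp add: bessel_conv_def[abs_def])
  let ?j = "\<lambda>x. complex_of_real (bessel_j \<nu> (t * x))"
  have jb: "norm (?j x) \<le> 1" for x using abs_bessel_j_le_1 by simp
  have intj: "integrable (?R \<Otimes>\<^sub>M ?R) (\<lambda>(x, y). ?j x * (translate F x y * G y))"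
  proof (rule Bochner_Integration.integrable_bound[OF int\<Phi>])
    show "(\<lambda>(x, y). ?j x * (translate F x y * G y)) \<in> borel_measurable (?R \<Otimes>\<^sub>M ?R)" by measurable
    show "AE z in ?R \<Otimes>\<^sub>M ?R. norm (case z of (x, y) \<Rightarrow> ?j x * (translate F x y * G y)) \<le> norm (?\<Phi> z)"
    proof (rule AE_I2, clarify)
      fix x y
      show "norm (?j x * (translate F x y * G y)) \<le> norm (translate F x y * G y)"
        unfolding norm_mult[of "?j x"] using jb[of x] by (intro mult_left_le_one_le) auto
    qed
  qed
  have "hankel (bessel_conv F G) t = (\<integral>x. \<integral>y. ?j x * (translate F x y * G y) \<partial>?R \<partial>?R)"
    by (simp add: hankel_def bessel_conv_def)
  also have "\<dots> = (\<integral>y. \<integral>x. ?j x * (translate F x y * G y) \<partial>?R \<partial>?R)"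
    by (rule RR.Fubini_integral[symmetric]) (rule intj)
  also have "\<dots> = (\<integral>y. G y * (\<integral>x. translate F x y * ?j x \<partial>?R) \<partial>?R)"
    by (simp add: mult_ac)
  also have "\<dots> = (\<integral>y. G y * (\<integral>x. F x * translate ?j x y \<partial>?R) \<partial>?R)"
    by (subst translate_self_adjoint[OF F _ jb]) simp_all
  also have "\<dots> = (\<integral>y. hankel F t * (?j y * G y) \<partial>?R)"
  proof -
    have "translate ?j x y = ?j x * ?j y" for x y
      by (simp add: translate_def bessel_j_product_formula_scaled)
    moreover have "(\<integral>x. F x * (?j x * ?j y) \<partial>?R) = hankel F t * ?j y" for y
    proof -
      have "(\<integral>x. F x * (?j x * ?j y) \<partial>?R) = (\<integral>x. ?j x * F x * ?j y \<partial>?R)"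
        by (simp only: mult_ac)
      then show ?thesis unfolding hankel_def by simp
    qed
    ultimately show ?thesis by (simp add: mult_ac)
  qed
  also have "\<dots> = hankel F t * hankel G t"
    by (simp add: hankel_def)
  finally show "hankel (bessel_conv F G) t = hankel F t * hankel G t" .
qed

text \<open>
  Young's inequality for \<open>L\<^sup>1 * L\<^sup>p\<close>: the power mean inequality for the measure \<open>|F(y)| dy d\<theta>\<close>, followed by an
  integration in \<open>x\<close> and invariance under translations. The finiteness of the integrals in the course of the proof
  also shows that the convolution integral converges for almost all \<open>x\<close>, so that the convolution is additive in \<open>G\<close>
  almost everywhere.
\<close>

lemma bessel_conv_Lp:
  assumes F: "integrable \<rho> F" and p: "p > 1"
  obtains C where "C > 0" "\<And>G. G \<in> borel_measurable borel \<Longrightarrow>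
      pow_int p \<rho> (bessel_conv F G)
        \<le> ennreal C * pow_int p \<rho> G"
    "\<And>G. G \<in> borel_measurable borel \<Longrightarrow> pow_int p \<rho> G < \<infinity> \<Longrightarrow>
       AE x in \<rho>. integrable \<rho> (\<lambda>y. translate F x y * G y)"
proof -
  have Fm[measurable]: "F \<in> borel_measurable borel" using borel_measurable_integrable[OF F] by simp
  let ?R = "\<rho>" and ?A = "\<alpha>"
  obtain a where a: "a \<ge> 0" "(\<integral>\<^sup>+y. ennreal (norm (F y)) \<partial>?R) = ennreal a"
    using F unfolding integrable_iff_bounded by (metis less_top enn2real_nonneg ennreal_enn2real infinity_ennreal_def)
  define W where "W = density (?R \<Otimes>\<^sub>M ?A) (\<lambda>(y, \<theta>). ennreal (norm (F y)))"
  have [measurable_cong]: "sets W = sets (?R \<Otimes>\<^sub>M ?A)" by (simp add: W_def)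
  have W: "(\<integral>\<^sup>+z. h z \<partial>W) = (\<integral>\<^sup>+y. \<integral>\<^sup>+\<theta>. ennreal (norm (F y)) * h (y, \<theta>) \<partial>?A \<partial>?R)"
    if [measurable]: "h \<in> borel_measurable (borel \<Otimes>\<^sub>M borel)" for h
    unfolding W_def
    by (subst nn_integral_density, measurable, subst A.nn_integral_fst[symmetric]) (auto simp: case_prod_beta)
  have massW: "emeasure W (space W) \<le> ennreal (a + 1)"
  proof -
    have "emeasure W (space W) = (\<integral>\<^sup>+z. 1 \<partial>W)" by simp
    also have "\<dots> = ennreal a" using a by (subst W) (auto simp: A.emeasure_space_1[simplified])
    also have "\<dots> \<le> ennreal (a + 1)" by (rule ennreal_leI) simp
    finally show ?thesis .
  qed
  define I where "I G x = (\<integral>\<^sup>+y. \<integral>\<^sup>+\<theta>. ennreal (norm (F y)) * ennreal (norm (G (side x y \<theta>)) powr p) \<partial>?A \<partial>?R)" for G :: "real \<Rightarrow> complex" and x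
  have IW: "I G x = pow_int p W (\<lambda>z. G (side x (fst z) (snd z)))"
    if [measurable]: "G \<in> borel_measurable borel" for G x
    unfolding I_def by (subst W) auto
  have Itot: "(\<integral>\<^sup>+x. I G x \<partial>?R) = ennreal a * pow_int p ?R G"
    if [measurable]: "G \<in> borel_measurable borel" for G
    unfolding I_def a(2)[symmetric] by (rule nn_integral_conv_integrand_total[of F "\<lambda>x. ennreal (norm (G x) powr p)"]) measurable
  have Im: "I G \<in> borel_measurable borel" if [measurable]: "G \<in> borel_measurable borel" for G
    unfolding I_def by measurable
  have le: "(\<integral>\<^sup>+y. ennreal (norm (translate F x y * G y)) \<partial>?R) \<le> (\<integral>\<^sup>+z. ennreal (norm (G (side x (fst z) (snd z)))) \<partial>W)"
    if [measurable]: "G \<in> borel_measurable borel" for G x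
    by (subst W, measurable) (use nn_integral_conv_integrand_le[of F G x] in simp)
  \<comment> \<open>The shift by \<open>1\<close> keeps the mass bound positive if \<open>F\<close> vanishes almost everywhere.\<close>
  define C where "C = (a + 1) powr (p - 1) * (a + 1)"
  show ?thesis
  proof (rule that[of C])
    show "C > 0" using a by (simp add: C_def)
    fix G :: "real \<Rightarrow> complex" assume G[measurable]: "G \<in> borel_measurable borel"
    have "pow_int p ?R (bessel_conv F G) \<le> (\<integral>\<^sup>+x. ennreal ((a + 1) powr (p - 1)) * I G x \<partial>?R)"
    proof (rule nn_integral_mono)
      fix x
      show "ennreal (norm (bessel_conv F G x) powr p) \<le> ennreal ((a + 1) powr (p - 1)) * I G x"
        unfolding IW[OF G]
      proof (rule powr_mean_le[OF massW _ p])
        show "ennreal (norm (bessel_conv F G x)) \<le> (\<integral>\<^sup>+z. ennreal (norm (G (side x (fst z) (snd z)))) \<partial>W)"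
          unfolding bessel_conv_def using norm_integral_le_nn_integral le[OF G] by (rule order_trans)
      qed (use a in auto)
    qed
    also have "\<dots> = ennreal ((a + 1) powr (p - 1)) * (ennreal a * pow_int p ?R G)"
      using Im[OF G] by (simp add: nn_integral_cmult Itot)
    also have "\<dots> \<le> ennreal ((a + 1) powr (p - 1)) * (ennreal (a + 1) * pow_int p ?R G)"
      by (intro mult_left_mono mult_right_mono ennreal_leI) auto
    also have "\<dots> = ennreal C * pow_int p ?R G"
      using a by (simp add: C_def ennreal_mult mult_ac)
    finally show "pow_int p ?R (bessel_conv F G) \<le> ennreal C * pow_int p ?R G" .
    assume fin: "pow_int p ?R G < \<infinity>"
    have "AE x in ?R. I G x \<noteq> \<infinity>"
      using fin Im[OF G] by (intro nn_integral_PInf_AE) (auto simp: Itot ennreal_mult_eq_top_iff)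
    then show "AE x in ?R. integrable ?R (\<lambda>y. translate F x y * G y)"
    proof eventually_elim
      case (elim x)
      have "(\<integral>\<^sup>+y. ennreal (norm (translate F x y * G y)) \<partial>?R) \<le> (\<integral>\<^sup>+z. ennreal (norm (G (side x (fst z) (snd z)))) \<partial>W)"
        by (rule le[OF G])
      also have "\<dots> \<le> (\<integral>\<^sup>+z. ennreal (norm (G (side x (fst z) (snd z))) powr p) + 1 \<partial>W)"
      proof (rule nn_integral_mono)
        fix z
        let ?n = "norm (G (side x (fst z) (snd z)))"
        have "?n \<le> ?n powr p + 1"
        proof (cases "?n \<le> 1")
          case False
          then have "?n powr 1 \<le> ?n powr p" using p by (intro powr_mono) auto
          then show ?thesis by simp
        next
          case True
          then show ?thesis by (intro add_increasing) auto
        qed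
        then have "ennreal ?n \<le> ennreal (?n powr p + 1)" by (rule ennreal_leI)
        then show "ennreal ?n \<le> ennreal (?n powr p) + 1" by simp
      qed
      also have "\<dots> = I G x + emeasure W (space W)"
        by (subst nn_integral_add) (auto simp: IW[OF G])
      also have "\<dots> < \<infinity>" using elim massW by (auto simp: less_top[symmetric] top_unique)
      finally show ?case by (intro integrableI_bounded) measurable
    qed
  qed
qed

end

section \<open>The bound on square integrable functions\<close>

text \<open>
  Fatou's lemma, in the form in which upper bounds pass to limits.
\<close>

lemma nn_integral_le_of_tendsto:
  fixes f :: "nat \<Rightarrow> 'a \<Rightarrow> real"
  assumes f[measurable]: "\<And>n. f n \<in> borel_measurable M"
    and lim: "AE x in M. (\<lambda>n. f n x) \<longlonglongrightarrow> g x"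
    and le: "\<And>n. (\<integral>\<^sup>+x. ennreal (f n x) \<partial>M) \<le> c n" and c: "c \<longlonglongrightarrow> C"
  shows "(\<integral>\<^sup>+x. ennreal (g x) \<partial>M) \<le> C"
proof -
  have "(\<integral>\<^sup>+x. ennreal (g x) \<partial>M) = (\<integral>\<^sup>+x. liminf (\<lambda>n. ennreal (f n x)) \<partial>M)"
  proof (rule nn_integral_cong_AE, use lim in eventually_elim)
    case (elim x)
    then have "(\<lambda>n. ennreal (f n x)) \<longlonglongrightarrow> ennreal (g x)" by (intro tendsto_ennrealI)
    then show ?case by (intro lim_imp_Liminf[symmetric]) auto
  qed
  also have "\<dots> \<le> liminf (\<lambda>n. \<integral>\<^sup>+x. ennreal (f n x) \<partial>M)"
    by (rule nn_integral_liminf) measurable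
  also have "\<dots> \<le> liminf c" by (intro Liminf_mono always_eventually allI le)
  also have "\<dots> = C" using c by (intro lim_imp_Liminf) auto
  finally show ?thesis .
qed

text \<open>
  The substitution \<open>u = \<epsilon> t\<^sup>2\<close> in Euler's integral.
\<close>

lemma nn_integral_gaussian_moment:
  assumes e: "\<epsilon> > (0::real)" and s: "s > 0"
  shows "(\<integral>\<^sup>+t\<in>{0<..}. ennreal (t powr (2 * s - 1) * exp (- \<epsilon> * t\<^sup>2)) \<partial>lborel) = ennreal (Gamma s / (2 * \<epsilon> powr s))"
proof -
  let ?g = "\<lambda>t::real. \<epsilon> * t\<^sup>2" and ?f = "\<lambda>u::real. ennreal (u powr (s - 1) / exp u)"
  have im: "?g ` {0<..} = {0<..}"
  proof (intro equalityI subsetI)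
    fix u :: real assume "u \<in> {0<..}"
    then show "u \<in> ?g ` {0<..}" using e
      by (intro image_eqI[of _ _ "sqrt (u / \<epsilon>)"]) auto
  qed (use e in auto)
  have "ennreal (2 * \<epsilon> powr s) * (\<integral>\<^sup>+t\<in>{0<..}. ennreal (t powr (2 * s - 1) * exp (- \<epsilon> * t\<^sup>2)) \<partial>lborel)
      = (\<integral>\<^sup>+t. ennreal (2 * \<epsilon> powr s) * (ennreal (t powr (2 * s - 1) * exp (- \<epsilon> * t\<^sup>2)) * indicator {0<..} t) \<partial>lborel)"
    by (rule nn_integral_cmult[symmetric]) measurable
  also have "\<dots> = (\<integral>\<^sup>+t\<in>{0<..}. ennreal \<bar>2 * \<epsilon> * t\<bar> * ?f (?g t) \<partial>lborel)"
  proof (rule nn_integral_cong)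
    fix t :: real
    show "ennreal (2 * \<epsilon> powr s) * (ennreal (t powr (2 * s - 1) * exp (- \<epsilon> * t\<^sup>2)) * indicator {0<..} t) =
        ennreal \<bar>2 * \<epsilon> * t\<bar> * ?f (?g t) * indicator {0<..} t"
    proof (cases "t > 0")
      case True
      have "(\<epsilon> * t\<^sup>2) powr (s - 1) = \<epsilon> powr (s - 1) * t powr (2 * s - 2)"
      proof -
        have "t\<^sup>2 = t powr 2" using True by simp
        then have "(t\<^sup>2) powr (s - 1) = t powr (2 * (s - 1))" by (simp only: powr_powr)
        then show ?thesis using e True by (simp add: powr_mult algebra_simps)
      qed
      then have "2 * \<epsilon> * t * ((\<epsilon> * t\<^sup>2) powr (s - 1) / exp (\<epsilon> * t\<^sup>2)) =
          2 * (\<epsilon> * \<epsilon> powr (s - 1)) * ((t * t powr (2 * s - 2)) * exp (- \<epsilon> * t\<^sup>2))"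
        by (simp add: exp_minus field_simps)
      moreover have "\<epsilon> * \<epsilon> powr (s - 1) = \<epsilon> powr s" using e by (simp add: powr_diff)
      moreover have "t * t powr (2 * s - 2) = t powr (2 * s - 1)"
        using True by (simp add: powr_diff power2_eq_square)
      ultimately have "2 * \<epsilon> * t * ((\<epsilon> * t\<^sup>2) powr (s - 1) / exp (\<epsilon> * t\<^sup>2)) =
          2 * \<epsilon> powr s * (t powr (2 * s - 1) * exp (- \<epsilon> * t\<^sup>2))"
        by (simp only:)
      then show ?thesis using True e by (simp add: ennreal_mult'[symmetric])
    qed simp
  qed
  also have "\<dots> = (\<integral>\<^sup>+u\<in>?g ` {0<..}. ?f u \<partial>lborel)"
  proof (rule nn_integral_substitution_inj[symmetric, where g = ?g and g' = "\<lambda>t. 2 * \<epsilon> * t" and f = ?f])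
    show "inj_on ?g {0<..}" using e by (auto simp: inj_on_def)
    show "?g ` {0<..} \<in> sets borel" unfolding im by simp
  qed (auto intro!: derivative_eq_intros)
  also have "\<dots> = (\<integral>\<^sup>+u. ennreal (indicator {0..} u * u powr (s - 1) / exp u) \<partial>lborel)"
    unfolding im
    by (rule nn_integral_cong_AE, use AE_lborel_singleton[of 0] in eventually_elim) (auto split: split_indicator)
  also have "\<dots> = ennreal (Gamma s)" using s by (simp add: Gamma_conv_nn_integral_real)
  finally have *: "ennreal (2 * \<epsilon> powr s) * (\<integral>\<^sup>+t\<in>{0<..}. ennreal (t powr (2 * s - 1) * exp (- \<epsilon> * t\<^sup>2)) \<partial>lborel) = ennreal (Gamma s)"
    (is "_ * ?I = _") .
  have c: "2 * \<epsilon> powr s > 0" using e by simp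
  have "?I = ennreal (1 / (2 * \<epsilon> powr s)) * (ennreal (2 * \<epsilon> powr s) * ?I)"
    unfolding mult.assoc[symmetric] using c by (simp add: ennreal_mult[symmetric] del: ennreal_mult)
  also have "\<dots> = ennreal (Gamma s / (2 * \<epsilon> powr s))"
    unfolding * using c s by (simp add: ennreal_mult[symmetric] Gamma_real_pos less_imp_le)
  finally show ?thesis .
qed

context bessel_order
begin

lemma radial_gaussian_moment:
  assumes e: "\<epsilon> > 0"
  shows "(\<integral>\<^sup>+t. ennreal ((t\<^sup>2) ^ n * exp (- \<epsilon> * t\<^sup>2)) \<partial>\<rho>) =
      ennreal (Gamma (\<nu> + 1) * pochhammer (\<nu> + 1) n / (2 * \<epsilon> powr (\<nu> + 1) * \<epsilon> ^ n))" (is "?L = ennreal ?c")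
    and "integrable \<rho> (\<lambda>t. (t\<^sup>2) ^ n * exp (- \<epsilon> * t\<^sup>2))"
    and "(\<integral>t. (t\<^sup>2) ^ n * exp (- \<epsilon> * t\<^sup>2) \<partial>\<rho>) =
      Gamma (\<nu> + 1) * pochhammer (\<nu> + 1) n / (2 * \<epsilon> powr (\<nu> + 1) * \<epsilon> ^ n)"
proof -
  let ?s = "\<nu> + 1 + real n"
  have "?L = (\<integral>\<^sup>+t\<in>{0<..}. ennreal (t powr (2 * \<nu> + 1)) * ennreal ((t\<^sup>2) ^ n * exp (- \<epsilon> * t\<^sup>2)) \<partial>lborel)"
    by (rule nn_integral_radial) measurable
  also have "\<dots> = (\<integral>\<^sup>+t\<in>{0<..}. ennreal (t powr (2 * ?s - 1) * exp (- \<epsilon> * t\<^sup>2)) \<partial>lborel)"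
  proof (rule nn_integral_cong)
    fix t :: real
    show "ennreal (t powr (2 * \<nu> + 1)) * ennreal ((t\<^sup>2) ^ n * exp (- \<epsilon> * t\<^sup>2)) * indicator {0<..} t =
        ennreal (t powr (2 * ?s - 1) * exp (- \<epsilon> * t\<^sup>2)) * indicator {0<..} t"
    proof (cases "t > 0")
      case True
      have "(t\<^sup>2) ^ n = t powr (2 * real n)"
        using powr_realpow[OF True, of "2 * n"] by (simp add: power_mult)
      then have "t powr (2 * \<nu> + 1) * (t\<^sup>2) ^ n = t powr (2 * ?s - 1)"
        by (simp add: powr_add[symmetric] algebra_simps)
      then show ?thesis by (simp add: ennreal_mult[symmetric] mult.assoc[symmetric])
    qed simp
  qed
  also have "\<dots> = ennreal (Gamma ?s / (2 * \<epsilon> powr ?s))"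
    by (rule nn_integral_gaussian_moment) (use e nu in auto)
  also have "Gamma ?s / (2 * \<epsilon> powr ?s) = ?c"
  proof -
    have "\<nu> + 1 \<notin> \<int>\<^sub>\<le>\<^sub>0" using nu by (auto elim!: nonpos_Ints_cases)
    then have "pochhammer (\<nu> + 1) n = Gamma ?s / Gamma (\<nu> + 1)" by (rule pochhammer_Gamma)
    moreover have "Gamma (\<nu> + 1) > 0" using nu by (intro Gamma_real_pos) auto
    ultimately have "Gamma ?s = Gamma (\<nu> + 1) * pochhammer (\<nu> + 1) n" by (simp add: field_simps)
    moreover have "\<epsilon> powr ?s = \<epsilon> powr (\<nu> + 1) * \<epsilon> ^ n"
      using e by (simp add: powr_add[of \<epsilon> "\<nu> + 1"] powr_realpow)
    ultimately show ?thesis by simp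
  qed
  finally show L: "?L = ennreal ?c" .
  have c: "?c \<ge> 0" using nu e pochhammer_nu_pos[of n]
    by (intro divide_nonneg_nonneg mult_nonneg_nonneg less_imp_le[OF Gamma_real_pos]) auto
  show i: "integrable \<rho> (\<lambda>t. (t\<^sup>2) ^ n * exp (- \<epsilon> * t\<^sup>2))"
    by (rule integrableI_nn_integral_finite[OF _ _ L]) (use c in auto)
  show "(\<integral>t. (t\<^sup>2) ^ n * exp (- \<epsilon> * t\<^sup>2) \<partial>\<rho>) = ?c"
    using L c by (subst integral_eq_nn_integral) auto
qed

text \<open>
  The Gaussian moments cancel the Pochhammer symbols of the Bessel series, and an exponential series remains.
\<close>

lemma hankel_gaussian:
  assumes e: "\<epsilon> > 0"
  shows "(\<integral>t. bessel_j \<nu> (t * s) * exp (- \<epsilon> * t\<^sup>2) \<partial>\<rho>) =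
    Gamma (\<nu> + 1) / (2 * \<epsilon> powr (\<nu> + 1)) * exp (- s\<^sup>2 / (4 * \<epsilon>))"
proof -
  let ?R = "\<rho>"
  define f where "f n t = bessel_coeff \<nu> n * (s\<^sup>2) ^ n * ((t\<^sup>2) ^ n * exp (- \<epsilon> * t\<^sup>2))" for n and t :: real
  define K where "K = Gamma (\<nu> + 1) / (2 * \<epsilon> powr (\<nu> + 1))"
  have K: "K > 0" using nu e by (auto simp: K_def intro!: divide_pos_pos Gamma_real_pos)
  have fi: "integrable ?R (f n)" for n
    unfolding f_def by (intro integrable_mult_right radial_gaussian_moment(2) e)
  have p: "pochhammer (\<nu> + 1) n > 0" for n by (rule pochhammer_nu_pos)
  have intf: "(\<integral>t. f n t \<partial>?R) = K * ((- s\<^sup>2 / (4 * \<epsilon>)) ^ n / fact n)" for n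
  proof -
    have "(\<integral>t. f n t \<partial>?R) = bessel_coeff \<nu> n * (s\<^sup>2) ^ n * (Gamma (\<nu> + 1) * pochhammer (\<nu> + 1) n / (2 * \<epsilon> powr (\<nu> + 1) * \<epsilon> ^ n))"
      unfolding f_def using radial_gaussian_moment(3)[OF e] by simp
    also have "\<dots> = K * ((- s\<^sup>2 / (4 * \<epsilon>)) ^ n / fact n)"
      using p[of n] unfolding bessel_coeff_def K_def power_divide power_minus[of "s\<^sup>2"] power_mult_distrib by (simp add: mult_ac)
    finally show ?thesis .
  qed
  have intnf: "(\<integral>t. norm (f n t) \<partial>?R) = K * ((s\<^sup>2 / (4 * \<epsilon>)) ^ n / fact n)" for n
  proof -
    have "(\<integral>t. norm (f n t) \<partial>?R) = (\<integral>t. \<bar>bessel_coeff \<nu> n\<bar> * (s\<^sup>2) ^ n * ((t\<^sup>2) ^ n * exp (- \<epsilon> * t\<^sup>2)) \<partial>?R)"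
      unfolding f_def by (simp add: abs_mult power_abs)
    also have "\<dots> = \<bar>bessel_coeff \<nu> n\<bar> * (s\<^sup>2) ^ n * (Gamma (\<nu> + 1) * pochhammer (\<nu> + 1) n / (2 * \<epsilon> powr (\<nu> + 1) * \<epsilon> ^ n))"
      using radial_gaussian_moment(3)[OF e] by simp
    also have "\<dots> = K * ((s\<^sup>2 / (4 * \<epsilon>)) ^ n / fact n)"
      using p[of n] by (simp add: bessel_coeff_def K_def power_divide power_mult_distrib abs_mult power_abs mult_ac)
    finally show ?thesis .
  qed
  have sexp: "(\<lambda>n. w ^ n / fact n) sums exp w" for w :: real
    using exp_converges[of w] by (simp add: divide_inverse mult.commute)
  have "(\<integral>t. bessel_j \<nu> (t * s) * exp (- \<epsilon> * t\<^sup>2) \<partial>?R) = (\<integral>t. (\<Sum>n. f n t) \<partial>?R)"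
  proof (rule Bochner_Integration.integral_cong[OF refl])
    fix t :: real
    have "bessel_j \<nu> (t * s) * exp (- \<epsilon> * t\<^sup>2) = (\<Sum>n. bessel_coeff \<nu> n * ((t * s)\<^sup>2) ^ n * exp (- \<epsilon> * t\<^sup>2))"
      unfolding bessel_j_eq by (rule suminf_mult2) (rule summable_bessel_coeff')
    then show "bessel_j \<nu> (t * s) * exp (- \<epsilon> * t\<^sup>2) = (\<Sum>n. f n t)"
      unfolding f_def by (simp add: power_mult_distrib mult_ac)
  qed
  also have "\<dots> = (\<Sum>n. \<integral>t. f n t \<partial>?R)"
  proof (rule integral_suminf[OF fi])
    show "AE t in ?R. summable (\<lambda>n. norm (f n t))"
    proof (rule AE_I2)
      fix t
      have "norm (f n t) = \<bar>bessel_coeff \<nu> n\<bar> * \<bar>s\<^sup>2 * t\<^sup>2\<bar> ^ n * exp (- \<epsilon> * t\<^sup>2)" for n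
        unfolding f_def by (simp add: abs_mult power_abs power_mult_distrib)
      then show "summable (\<lambda>n. norm (f n t))"
        using summable_mult2[OF summable_bessel_coeff[of "s\<^sup>2 * t\<^sup>2"], of "exp (- \<epsilon> * t\<^sup>2)"] by (simp only:)
    qed
    show "summable (\<lambda>n. \<integral>t. norm (f n t) \<partial>?R)"
      unfolding intnf using sexp[of "s\<^sup>2 / (4 * \<epsilon>)"] by (intro summable_mult) (rule sums_summable)
  qed
  also have "\<dots> = K * exp (- s\<^sup>2 / (4 * \<epsilon>))"
    unfolding intf using sums_mult[OF sexp[of "- s\<^sup>2 / (4 * \<epsilon>)"], of K] by (simp only: sums_iff)
  finally show ?thesis by (simp only: K_def)
qed

lemma nn_integral_gaussian_radial:
  assumes e: "\<epsilon> > 0"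
  shows "(\<integral>\<^sup>+t. ennreal (exp (- \<epsilon> * t\<^sup>2)) \<partial>\<rho>) = ennreal (Gamma (\<nu> + 1) / (2 * \<epsilon> powr (\<nu> + 1)))"
  using radial_gaussian_moment(1)[OF e, of 0] by simp

text \<open>
  Weber's second exponential integral. It is the kernel of the quadratic form
  \<open>F \<mapsto> \<integral> e\<^bsup>-\<epsilon>t\<^sup>2\<^esup> |H F(l t)|\<^sup>2\<close>, where \<open>H\<close> is the Hankel transform.
\<close>

definition weber_kernel :: "real \<Rightarrow> real \<Rightarrow> real \<Rightarrow> real \<Rightarrow> real" where
  "weber_kernel l \<epsilon> y z = (\<integral>t. exp (- \<epsilon> * t\<^sup>2) * (bessel_j \<nu> (l * t * y) * bessel_j \<nu> (l * t * z)) \<partial>\<rho>)"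

lemma integrable_gaussian_radial: "\<epsilon> > 0 \<Longrightarrow> integrable \<rho> (\<lambda>t. exp (- \<epsilon> * t\<^sup>2))"
  using radial_gaussian_moment(2)[of \<epsilon> 0] by simp

lemma integrable_gaussian_bounded:
  fixes k :: "real \<Rightarrow> complex"
  assumes "\<epsilon> > 0" and [measurable]: "k \<in> borel_measurable borel" and B: "\<And>t. norm (k t) \<le> B"
  shows "integrable \<rho> (\<lambda>t. of_real (exp (- \<epsilon> * t\<^sup>2)) * k t)"
proof (rule Bochner_Integration.integrable_bound)
  show "integrable \<rho> (\<lambda>t. B * exp (- \<epsilon> * t\<^sup>2))"
    by (intro integrable_mult_right integrable_gaussian_radial assms)
  have "norm (of_real (exp (- \<epsilon> * t\<^sup>2)) * k t) \<le> norm (B * exp (- \<epsilon> * t\<^sup>2))" for t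
  proof -
    have "norm (k t) \<le> \<bar>B\<bar>" using B[of t] by linarith
    then show ?thesis by (simp add: norm_mult abs_mult mult.commute[of _ "exp _"])
  qed
  then show "AE t in \<rho>. norm (of_real (exp (- \<epsilon> * t\<^sup>2)) * k t) \<le> norm (B * exp (- \<epsilon> * t\<^sup>2))" by simp
qed simp

text \<open>
  The product formula merges the two Bessel functions, and the Hankel transform of the Gaussian is known: the
  kernel is a Bessel translate of a Gaussian. Its positivity, which the definition does not show, follows.
\<close>

lemma weber_kernel_eq:
  assumes e: "\<epsilon> > 0"
  shows "weber_kernel l \<epsilon> y z =
    (\<integral>\<theta>. Gamma (\<nu> + 1) / (2 * \<epsilon> powr (\<nu> + 1)) * exp (- (l * side y z \<theta>)\<^sup>2 / (4 * \<epsilon>)) \<partial>\<alpha>)"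
proof -
  let ?f = "\<lambda>(t, \<theta>). exp (- \<epsilon> * t\<^sup>2) * bessel_j \<nu> (l * t * side y z \<theta>)"
  have "integrable (\<rho> \<Otimes>\<^sub>M \<alpha>) ?f"
  proof (rule integrableI_bounded)
    show "?f \<in> borel_measurable (\<rho> \<Otimes>\<^sub>M \<alpha>)" by measurable
    have "(\<integral>\<^sup>+z. ennreal (norm (?f z)) \<partial>(\<rho> \<Otimes>\<^sub>M \<alpha>)) \<le>
        (\<integral>\<^sup>+z. ennreal (exp (- \<epsilon> * (fst z)\<^sup>2)) \<partial>(\<rho> \<Otimes>\<^sub>M \<alpha>))"
    proof (rule nn_integral_mono)
      fix w :: "real \<times> real"
      have "norm (?f w) = exp (- \<epsilon> * (fst w)\<^sup>2) * \<bar>bessel_j \<nu> (l * fst w * side y z (snd w))\<bar>"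
        by (simp add: case_prod_beta abs_mult)
      also have "\<dots> \<le> exp (- \<epsilon> * (fst w)\<^sup>2)"
        by (rule mult_left_le[OF abs_bessel_j_le_1]) simp
      finally show "ennreal (norm (?f w)) \<le> ennreal (exp (- \<epsilon> * (fst w)\<^sup>2))" by (rule ennreal_leI)
    qed
    also have "\<dots> = (\<integral>\<^sup>+t. ennreal (exp (- \<epsilon> * t\<^sup>2)) \<partial>\<rho>)"
      by (subst A.nn_integral_fst[symmetric]) (auto simp: A.emeasure_space_1[simplified])
    also have "\<dots> < \<infinity>" unfolding nn_integral_gaussian_radial[OF e] by simp
    finally show "(\<integral>\<^sup>+z. ennreal (norm (?f z)) \<partial>(\<rho> \<Otimes>\<^sub>M \<alpha>)) < \<infinity>" .
  qed
  note int = this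
  have "weber_kernel l \<epsilon> y z = (\<integral>t. \<integral>\<theta>. exp (- \<epsilon> * t\<^sup>2) * bessel_j \<nu> (l * t * side y z \<theta>) \<partial>\<alpha> \<partial>\<rho>)"
    unfolding weber_kernel_def by (simp add: bessel_j_product_formula_scaled)
  also have "\<dots> = (\<integral>\<theta>. \<integral>t. exp (- \<epsilon> * t\<^sup>2) * bessel_j \<nu> (l * t * side y z \<theta>) \<partial>\<rho> \<partial>\<alpha>)"
    using RA.Fubini_integral[of "\<lambda>t \<theta>. exp (- \<epsilon> * t\<^sup>2) * bessel_j \<nu> (l * t * side y z \<theta>)"] int by simp
  also have "\<dots> = (\<integral>\<theta>. Gamma (\<nu> + 1) / (2 * \<epsilon> powr (\<nu> + 1)) * exp (- (l * side y z \<theta>)\<^sup>2 / (4 * \<epsilon>)) \<partial>\<alpha>)"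
  proof (rule Bochner_Integration.integral_cong[OF refl])
    fix \<theta>
    show "(\<integral>t. exp (- \<epsilon> * t\<^sup>2) * bessel_j \<nu> (l * t * side y z \<theta>) \<partial>\<rho>) =
        Gamma (\<nu> + 1) / (2 * \<epsilon> powr (\<nu> + 1)) * exp (- (l * side y z \<theta>)\<^sup>2 / (4 * \<epsilon>))"
      using hankel_gaussian[OF e, of "l * side y z \<theta>"] by (simp only: mult_ac)
  qed
  finally show ?thesis .
qed

lemma weber_kernel_nonneg: "\<epsilon> > 0 \<Longrightarrow> weber_kernel l \<epsilon> y z \<ge> 0"
  unfolding weber_kernel_eq using nu
  by (intro integral_nonneg_AE AE_I2 mult_nonneg_nonneg divide_nonneg_nonneg less_imp_le[OF Gamma_real_pos]) auto

lemma weber_kernel_commute: "weber_kernel l \<epsilon> y z = weber_kernel l \<epsilon> z y"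
  unfolding weber_kernel_def by (simp add: mult.commute)

lemma weber_kernel_measurable[measurable]:
  "case_prod (weber_kernel l \<epsilon>) \<in> borel_measurable (borel \<Otimes>\<^sub>M borel)"
  unfolding weber_kernel_def[abs_def] by measurable

text \<open>
  Translations preserve the mass of the Gaussian, and the powers of \<open>\<epsilon>\<close> cancel.
\<close>

lemma weber_kernel_mass:
  assumes e: "\<epsilon> > 0" and l: "l \<noteq> 0"
  shows "(\<integral>\<^sup>+y. ennreal (weber_kernel l \<epsilon> y z) \<partial>\<rho>) = ennreal ((Gamma (\<nu> + 1))\<^sup>2 / 4 * (4 / l\<^sup>2) powr (\<nu> + 1))"
proof -
  let ?K = "Gamma (\<nu> + 1) / (2 * \<epsilon> powr (\<nu> + 1))"
  let ?G = "\<lambda>s::real. ?K * exp (- (l * s)\<^sup>2 / (4 * \<epsilon>))"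
  have G0: "Gamma (\<nu> + 1) > 0" using nu by (intro Gamma_real_pos) simp
  have K: "?K > 0" using G0 e by simp
  have "ennreal (weber_kernel l \<epsilon> y z) = (\<integral>\<^sup>+\<theta>. ennreal (?G (side y z \<theta>)) \<partial>\<alpha>)" for y
    unfolding weber_kernel_eq[OF e]
  proof (rule nn_integral_eq_integral[symmetric])
    have "exp (- (l * side y z \<theta>)\<^sup>2 / (4 * \<epsilon>)) \<le> 1" for \<theta> using e by simp
    then show "integrable \<alpha> (\<lambda>\<theta>. ?G (side y z \<theta>))"
      using e by (intro integrable_mult_right integrable_angle_bounded[where B=1]) auto
    show "AE \<theta> in \<alpha>. 0 \<le> ?G (side y z \<theta>)"
      using K by (intro AE_I2 mult_nonneg_nonneg) auto
  qed
  then have "(\<integral>\<^sup>+y. ennreal (weber_kernel l \<epsilon> y z) \<partial>\<rho>) = (\<integral>\<^sup>+y. ennreal (?G y) \<partial>\<rho>)"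
    using nn_integral_translate_invariant[of "\<lambda>s. ennreal (?G s)" z] by simp
  also have "\<dots> = ennreal ?K * (\<integral>\<^sup>+y. ennreal (exp (- (l\<^sup>2 / (4 * \<epsilon>)) * y\<^sup>2)) \<partial>\<rho>)"
    using K by (subst nn_integral_cmult[symmetric]) (auto simp: ennreal_mult'[symmetric] power_mult_distrib)
  also have "\<dots> = ennreal (?K * (Gamma (\<nu> + 1) / (2 * (l\<^sup>2 / (4 * \<epsilon>)) powr (\<nu> + 1))))"
    using e l K G0 by (subst nn_integral_gaussian_radial) (auto simp: ennreal_mult'[symmetric])
  also have "?K * (Gamma (\<nu> + 1) / (2 * (l\<^sup>2 / (4 * \<epsilon>)) powr (\<nu> + 1))) = (Gamma (\<nu> + 1))\<^sup>2 / 4 * (4 / l\<^sup>2) powr (\<nu> + 1)"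
    using e l by (simp add: powr_divide powr_mult power2_eq_square field_simps)
  finally show ?thesis .
qed

lemma norm_hankel_le: "norm (hankel F t) \<le> (\<integral>y. norm (F y) \<partial>\<rho>)" if F: "integrable \<rho> F"
proof -
  have [measurable]: "F \<in> borel_measurable borel" using borel_measurable_integrable[OF F] by simp
  have le: "norm (of_real (bessel_j \<nu> (t * y)) * F y) \<le> norm (F y)" for y
    using abs_bessel_j_le_1[of "t * y"] by (simp add: norm_mult mult_left_le_one_le)
  have "norm (hankel F t) \<le> (\<integral>y. norm (of_real (bessel_j \<nu> (t * y)) * F y) \<partial>\<rho>)"
    unfolding hankel_def by (rule integral_norm_bound)
  also have "\<dots> \<le> (\<integral>y. norm (F y) \<partial>\<rho>)"
    by (intro integral_mono integrable_norm F Bochner_Integration.integrable_bound[OF F] AE_I2 le) measurable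
  finally show ?thesis .
qed

lemma hankel_measurable[measurable]:
  assumes [measurable]: "F \<in> borel_measurable borel"
  shows "hankel F \<in> borel_measurable borel"
  unfolding hankel_def[abs_def] by measurable

text \<open>
  Schur's test: bound \<open>|F(y) F(z)|\<close> by the mean of \<open>|F(y)|\<^sup>2\<close> and \<open>|F(z)|\<^sup>2\<close> and integrate the nonnegative symmetric
  kernel in the other variable.
\<close>

lemma hankel_L2_damped:
  assumes F: "integrable \<rho> F" and e: "\<epsilon> > 0" and l: "l \<noteq> 0"
  shows "(\<integral>\<^sup>+t. ennreal (exp (- \<epsilon> * t\<^sup>2) * (norm (hankel F (l * t)))\<^sup>2) \<partial>\<rho>)
    \<le> ennreal ((Gamma (\<nu> + 1))\<^sup>2 / 4 * (4 / l\<^sup>2) powr (\<nu> + 1)) * (\<integral>\<^sup>+y. ennreal ((norm (F y))\<^sup>2) \<partial>\<rho>)"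
    (is "_ \<le> ?M * _")
proof -
  let ?R = "\<rho>"
  have Fm[measurable]: "F \<in> borel_measurable borel" using borel_measurable_integrable[OF F] by simp
  let ?w = "\<lambda>t. complex_of_real (exp (- \<epsilon> * t\<^sup>2))"
  let ?H = "\<lambda>t. hankel F (l * t)"
  let ?j = "\<lambda>t y. complex_of_real (bessel_j \<nu> (l * t * y))"
  let ?K = "weber_kernel l \<epsilon>"
  have jb: "norm (?j t y) \<le> 1" for t y using abs_bessel_j_le_1 by simp
  define B where "B = (\<integral>y. norm (F y) \<partial>?R)"
  have HB: "norm (?H t) \<le> B" for t unfolding B_def by (rule norm_hankel_le[OF F])
  \<comment> \<open>The Gaussian integrates the bounded factor in \<open>t\<close>, and \<open>g\<close> is integrable in \<open>z\<close>.\<close>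
  have int2: "integrable (?R \<Otimes>\<^sub>M ?R) (\<lambda>(t, z). ?w t * k t z * g z)"
    if [measurable]: "(\<lambda>(t, z). k t z) \<in> borel_measurable (borel \<Otimes>\<^sub>M borel)" and kb: "\<And>t z. norm (k t z) \<le> b"
      and g: "integrable ?R g" for k :: "real \<Rightarrow> real \<Rightarrow> complex" and g b
  proof (rule integrableI_bounded)
    have [measurable]: "g \<in> borel_measurable borel" using borel_measurable_integrable[OF g] by simp
    show "(\<lambda>(t, z). ?w t * k t z * g z) \<in> borel_measurable (?R \<Otimes>\<^sub>M ?R)" by measurable
    have "(\<integral>\<^sup>+x. ennreal (norm (case x of (t, z) \<Rightarrow> ?w t * k t z * g z)) \<partial>(?R \<Otimes>\<^sub>M ?R))
        \<le> (\<integral>\<^sup>+x. (case x of (t, z) \<Rightarrow> ennreal \<bar>b\<bar> * (ennreal (exp (- \<epsilon> * t\<^sup>2)) * ennreal (norm (g z)))) \<partial>(?R \<Otimes>\<^sub>M ?R))"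
    proof (rule nn_integral_mono, clarify)
      fix t z
      have "norm (k t z) \<le> \<bar>b\<bar>" using kb[of t z] by linarith
      then have "norm (?w t * k t z * g z) \<le> \<bar>b\<bar> * (exp (- \<epsilon> * t\<^sup>2) * norm (g z))"
        by (simp add: norm_mult mult_right_mono mult.assoc mult.left_commute[of "exp _"])
      then show "ennreal (norm (?w t * k t z * g z)) \<le> ennreal \<bar>b\<bar> * (ennreal (exp (- \<epsilon> * t\<^sup>2)) * ennreal (norm (g z)))"
        by (simp add: ennreal_mult[symmetric] ennreal_leI)
    qed
    also have "\<dots> = ennreal \<bar>b\<bar> * ((\<integral>\<^sup>+t. ennreal (exp (- \<epsilon> * t\<^sup>2)) \<partial>?R) * (\<integral>\<^sup>+z. ennreal (norm (g z)) \<partial>?R))"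
      by (subst R.nn_integral_fst[symmetric]) (auto simp: nn_integral_cmult nn_integral_multc)
    also have "\<dots> < \<infinity>"
      using g by (simp add: nn_integral_gaussian_radial[OF e, simplified] integrable_iff_bounded ennreal_mult_less_top)
    finally show "(\<integral>\<^sup>+x. ennreal (norm (case x of (t, z) \<Rightarrow> ?w t * k t z * g z)) \<partial>(?R \<Otimes>\<^sub>M ?R)) < \<infinity>" .
  qed
  \<comment> \<open>The Gaussian makes the double integral absolutely convergent, so that Fubini applies.\<close>
  have inner: "(\<integral>t. ?w t * (?j t z * ?H t) \<partial>?R) = (\<integral>y. of_real (?K y z) * F y \<partial>?R)" for z
  proof -
    have "(\<integral>t. ?w t * (?j t z * ?H t) \<partial>?R) = (\<integral>t. \<integral>y. ?w t * (?j t z * ?j t y) * F y \<partial>?R \<partial>?R)"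
      unfolding hankel_def by (simp add: mult.assoc)
    also have "\<dots> = (\<integral>y. \<integral>t. ?w t * (?j t z * ?j t y) * F y \<partial>?R \<partial>?R)"
    proof (rule RR.Fubini_integral[symmetric])
      show "integrable (?R \<Otimes>\<^sub>M ?R) (\<lambda>(t, y). ?w t * (?j t z * ?j t y) * F y)"
        by (rule int2[of _ 1]) (use F jb in \<open>auto simp: norm_mult intro!: mult_le_one\<close>)
    qed
    also have "\<dots> = (\<integral>y. of_real (?K y z) * F y \<partial>?R)"
    proof (rule Bochner_Integration.integral_cong[OF refl])
      fix y
      have "(\<integral>t. ?w t * (?j t z * ?j t y) * F y \<partial>?R) = (\<integral>t. ?w t * (?j t z * ?j t y) \<partial>?R) * F y"
        by simp
      also have "(\<integral>t. ?w t * (?j t z * ?j t y) \<partial>?R) = of_real (?K y z)"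
        unfolding weber_kernel_def integral_complex_of_real[symmetric] by (simp add: mult_ac)
      finally show "(\<integral>t. ?w t * (?j t z * ?j t y) * F y \<partial>?R) = of_real (?K y z) * F y" .
    qed
    finally show ?thesis .
  qed
  have "(\<integral>t. ?w t * (?H t * cnj (?H t)) \<partial>?R) = (\<integral>t. \<integral>z. ?w t * (?H t * ?j t z) * cnj (F z) \<partial>?R \<partial>?R)"
  proof (rule Bochner_Integration.integral_cong[OF refl])
    fix t
    have "cnj (?H t) = (\<integral>z. ?j t z * cnj (F z) \<partial>?R)"
      unfolding hankel_def Bochner_Integration.integral_cnj[symmetric] by simp
    then show "?w t * (?H t * cnj (?H t)) = (\<integral>z. ?w t * (?H t * ?j t z) * cnj (F z) \<partial>?R)"
      by (simp add: mult.assoc)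
  qed
  also have "\<dots> = (\<integral>z. \<integral>t. ?w t * (?H t * ?j t z) * cnj (F z) \<partial>?R \<partial>?R)"
  proof (rule RR.Fubini_integral[symmetric])
    have "norm (?H t * ?j t z) \<le> B" for t z
      using mult_mono[OF HB[of t] jb[of t z]] HB[of 0] norm_ge_zero[of "?H 0"] by (simp add: norm_mult)
    then show "integrable (?R \<Otimes>\<^sub>M ?R) (\<lambda>(t, z). ?w t * (?H t * ?j t z) * cnj (F z))"
      using F by (intro int2[of _ B]) auto
  qed
  also have "\<dots> = (\<integral>z. cnj (F z) * (\<integral>y. of_real (?K y z) * F y \<partial>?R) \<partial>?R)"
    unfolding inner[symmetric] by (simp add: mult_ac)
  finally have eq: "(\<integral>t. ?w t * (?H t * cnj (?H t)) \<partial>?R) = (\<integral>z. cnj (F z) * (\<integral>y. of_real (?K y z) * F y \<partial>?R) \<partial>?R)" .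
  have K0: "?K y z \<ge> 0" for y z by (rule weber_kernel_nonneg[OF e])
  let ?n = "\<lambda>y. ennreal ((norm (F y))\<^sup>2)"
  have "(\<integral>\<^sup>+t. ennreal (exp (- \<epsilon> * t\<^sup>2) * (norm (?H t))\<^sup>2) \<partial>?R) = ennreal (norm (\<integral>t. ?w t * (?H t * cnj (?H t)) \<partial>?R))"
  proof -
    have [measurable]: "(\<lambda>z. cnj z) \<in> borel_measurable borel"
      by (intro borel_measurable_continuous_onI continuous_intros)
    have i: "integrable ?R (\<lambda>t. ?w t * (?H t * cnj (?H t)))"
    proof (rule integrable_gaussian_bounded[OF e, where B="B * B"])
      show "norm (?H t * cnj (?H t)) \<le> B * B" for t
        using mult_mono[OF HB[of t] HB[of t]] norm_ge_zero[of "?H t"] HB[of t] by (simp add: norm_mult)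
    qed measurable
    have r: "?w t * (?H t * cnj (?H t)) = complex_of_real (exp (- \<epsilon> * t\<^sup>2) * (norm (?H t))\<^sup>2)" for t
      by (simp only: of_real_mult complex_norm_square)
    have i': "integrable ?R (\<lambda>t. exp (- \<epsilon> * t\<^sup>2) * (norm (?H t))\<^sup>2)"
      using i unfolding r complex_of_real_integrable_eq .
    have "(\<integral>t. ?w t * (?H t * cnj (?H t)) \<partial>?R) = complex_of_real (\<integral>t. exp (- \<epsilon> * t\<^sup>2) * (norm (?H t))\<^sup>2 \<partial>?R)"
      unfolding r by (rule integral_complex_of_real)
    moreover have "0 \<le> (\<integral>t. exp (- \<epsilon> * t\<^sup>2) * (norm (?H t))\<^sup>2 \<partial>?R)" by (intro integral_nonneg_AE AE_I2) simp
    ultimately have "norm (\<integral>t. ?w t * (?H t * cnj (?H t)) \<partial>?R) = (\<integral>t. exp (- \<epsilon> * t\<^sup>2) * (norm (?H t))\<^sup>2 \<partial>?R)" by simp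
    then show ?thesis using i' by (simp add: nn_integral_eq_integral)
  qed
  also have "\<dots> \<le> (\<integral>\<^sup>+z. ennreal (norm (cnj (F z) * (\<integral>y. of_real (?K y z) * F y \<partial>?R))) \<partial>?R)"
    unfolding eq by (rule norm_integral_le_nn_integral)
  also have "\<dots> \<le> (\<integral>\<^sup>+z. \<integral>\<^sup>+y. ennreal (1/2) * (?n z * ennreal (?K z y) + ennreal (?K y z) * ?n y) \<partial>?R \<partial>?R)"
  proof (rule nn_integral_mono)
    fix z
    have "ennreal (norm (cnj (F z) * (\<integral>y. of_real (?K y z) * F y \<partial>?R))) =
        ennreal (norm (F z)) * ennreal (norm (\<integral>y. of_real (?K y z) * F y \<partial>?R))"
      by (simp add: norm_mult ennreal_mult)
    also have "\<dots> \<le> ennreal (norm (F z)) * (\<integral>\<^sup>+y. ennreal (norm (of_real (?K y z) * F y)) \<partial>?R)"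
      by (intro mult_left_mono norm_integral_le_nn_integral) simp
    also have "\<dots> = (\<integral>\<^sup>+y. ennreal (norm (F z)) * ennreal (norm (of_real (?K y z) * F y)) \<partial>?R)"
      by (rule nn_integral_cmult[symmetric]) measurable
    also have "\<dots> \<le> (\<integral>\<^sup>+y. ennreal (1/2) * (?n z * ennreal (?K z y) + ennreal (?K y z) * ?n y) \<partial>?R)"
    proof (rule nn_integral_mono)
      fix y
      have "norm (F z) * norm (F y) \<le> 1/2 * ((norm (F z))\<^sup>2 + (norm (F y))\<^sup>2)"
        using sum_squares_bound[of "norm (F z)" "norm (F y)"] by simp
      then have "norm (F z) * norm (F y) * ?K y z \<le> 1/2 * ((norm (F z))\<^sup>2 + (norm (F y))\<^sup>2) * ?K y z"
        by (intro mult_right_mono K0)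
      then have "norm (F z) * norm (of_real (?K y z) * F y) \<le> 1/2 * ((norm (F z))\<^sup>2 * ?K z y + ?K y z * (norm (F y))\<^sup>2)"
        using K0[of y z] by (simp add: norm_mult weber_kernel_commute[of _ _ z y] algebra_simps)
      then have "ennreal (norm (F z) * norm (of_real (?K y z) * F y)) \<le> ennreal (1/2 * ((norm (F z))\<^sup>2 * ?K z y + ?K y z * (norm (F y))\<^sup>2))"
        by (rule ennreal_leI)
      then show "ennreal (norm (F z)) * ennreal (norm (of_real (?K y z) * F y)) \<le> ennreal (1/2) * (?n z * ennreal (?K z y) + ennreal (?K y z) * ?n y)"
        using K0[of y z] K0[of z y]
        by (subst (asm) ennreal_mult, simp, simp, subst (asm) ennreal_mult, simp, simp, subst (asm) ennreal_plus, simp, simp)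
           (simp only: ennreal_mult zero_le_power2 norm_ge_zero)
    qed
    finally show "ennreal (norm (cnj (F z) * (\<integral>y. of_real (?K y z) * F y \<partial>?R))) \<le> \<dots>" .
  qed
  also have "\<dots> = ennreal (1/2) * ((\<integral>\<^sup>+z. \<integral>\<^sup>+y. ?n z * ennreal (?K z y) \<partial>?R \<partial>?R) + (\<integral>\<^sup>+z. \<integral>\<^sup>+y. ennreal (?K y z) * ?n y \<partial>?R \<partial>?R))"
    by (simp add: nn_integral_cmult nn_integral_add)
  also have "(\<integral>\<^sup>+z. \<integral>\<^sup>+y. ennreal (?K y z) * ?n y \<partial>?R \<partial>?R) = (\<integral>\<^sup>+y. \<integral>\<^sup>+z. ennreal (?K y z) * ?n y \<partial>?R \<partial>?R)"
    by (rule RR.Fubini') measurable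
  also have "\<dots> = (\<integral>\<^sup>+y. ?n y * ?M \<partial>?R)"
    using weber_kernel_mass[OF e l] by (simp add: nn_integral_multc weber_kernel_commute[of _ _ _ "_::real"] mult.commute)
  also have "(\<integral>\<^sup>+z. \<integral>\<^sup>+y. ?n z * ennreal (?K z y) \<partial>?R \<partial>?R) = (\<integral>\<^sup>+z. ?n z * ?M \<partial>?R)"
  proof (rule nn_integral_cong)
    fix z
    have "(\<integral>\<^sup>+y. ennreal (?K z y) \<partial>?R) = ?M"
      unfolding weber_kernel_commute[of _ _ z] by (rule weber_kernel_mass[OF e l])
    then show "(\<integral>\<^sup>+y. ?n z * ennreal (?K z y) \<partial>?R) = ?n z * ?M" by (simp add: nn_integral_cmult)
  qed
  also have "ennreal (1/2) * ((\<integral>\<^sup>+z. ?n z * ?M \<partial>?R) + (\<integral>\<^sup>+y. ?n y * ?M \<partial>?R)) = (\<integral>\<^sup>+y. ?n y * ?M \<partial>?R)"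
  proof -
    have "ennreal (1/2) * (X + X) = X" for X :: ennreal
    proof -
      have "ennreal (1/2) * (X + X) = (ennreal (1/2) + ennreal (1/2)) * X" by (simp only: distrib_left distrib_right)
      also have "ennreal (1/2) + ennreal (1/2) = 1" by (subst ennreal_plus[symmetric]) auto
      finally show ?thesis by simp
    qed
    then show ?thesis .
  qed
  also have "\<dots> = ?M * (\<integral>\<^sup>+y. ?n y \<partial>?R)" by (simp add: nn_integral_multc mult.commute)
  finally show ?thesis .
qed

lemma hankel_L2_bound:
  assumes F: "integrable \<rho> F" and l: "l \<noteq> 0"
  shows "(\<integral>\<^sup>+t. ennreal ((norm (hankel F (l * t)))\<^sup>2) \<partial>\<rho>)
    \<le> ennreal ((Gamma (\<nu> + 1))\<^sup>2 / 4 * (4 / l\<^sup>2) powr (\<nu> + 1)) * (\<integral>\<^sup>+y. ennreal ((norm (F y))\<^sup>2) \<partial>\<rho>)"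
proof -
  have [measurable]: "F \<in> borel_measurable borel" using borel_measurable_integrable[OF F] by simp
  show ?thesis
  proof (rule nn_integral_le_of_tendsto[OF _ _ hankel_L2_damped[OF F _ l] tendsto_const])
    show "inverse (real (Suc n)) > 0" for n by simp
    show "AE t in \<rho>. (\<lambda>n. exp (- inverse (real (Suc n)) * t\<^sup>2) * (norm (hankel F (l * t)))\<^sup>2) \<longlonglongrightarrow> (norm (hankel F (l * t)))\<^sup>2"
    proof (rule AE_I2)
      fix t
      have "(\<lambda>n. exp (- inverse (real (Suc n)) * t\<^sup>2) * (norm (hankel F (l * t)))\<^sup>2) \<longlonglongrightarrow> exp (- 0 * t\<^sup>2) * (norm (hankel F (l * t)))\<^sup>2"
        by (intro tendsto_intros LIMSEQ_inverse_real_of_nat)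
      then show "(\<lambda>n. exp (- inverse (real (Suc n)) * t\<^sup>2) * (norm (hankel F (l * t)))\<^sup>2) \<longlonglongrightarrow> (norm (hankel F (l * t)))\<^sup>2" by simp
    qed
  qed measurable
qed

end

section \<open>Interpolation and extension by continuity\<close>

lemma nn_integral_powr_Ioo:
  assumes a: "a > 0" and c: "c \<ge> 0"
  shows "(\<integral>\<^sup>+t. ennreal (t powr (a - 1)) * indicator {0<..<c} t \<partial>lborel) = ennreal (c powr a / a)"
proof -
  have "(\<integral>\<^sup>+t. ennreal (t powr (a - 1)) * indicator {0<..<c} t \<partial>lborel) = (\<integral>\<^sup>+t\<in>{0..c}. ennreal (t powr (a - 1)) \<partial>lborel)"
    by (rule nn_integral_cong_AE, use AE_lborel_singleton[of 0] AE_lborel_singleton[of c] in eventually_elim)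
       (auto split: split_indicator)
  also have "\<dots> = ennreal (c powr a / a)"
    using has_integral_powr_from_0[of "a - 1" c] a c
    by (intro nn_integral_has_integral_lebesgue') auto
  finally show ?thesis .
qed

text \<open>
  The levels are written as \<open>2t\<close>, since \<open>T f\<close> is going to be split into two parts, each of which is compared with \<open>t\<close>.
\<close>

lemma powr_layer_cake:
  assumes q: "q > 0" and u: "u \<ge> 0"
  shows "ennreal (u powr q) = (\<integral>\<^sup>+t. ennreal (q * 2 powr q * t powr (q - 1)) * indicator {0<..<u / 2} t \<partial>lborel)"
proof -
  have "(\<integral>\<^sup>+t. ennreal (q * 2 powr q * t powr (q - 1)) * indicator {0<..<u / 2} t \<partial>lborel) =
      (\<integral>\<^sup>+t. ennreal (q * 2 powr q) * (ennreal (t powr (q - 1)) * indicator {0<..<u / 2} t) \<partial>lborel)"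
    using q by (simp add: ennreal_mult mult.assoc)
  also have "\<dots> = ennreal (q * 2 powr q) * ennreal ((u / 2) powr q / q)"
    using u by (subst nn_integral_cmult) (auto simp: nn_integral_powr_Ioo[OF q])
  also have "\<dots> = ennreal (u powr q)"
    using q u by (simp add: ennreal_mult[symmetric] powr_divide)
  finally show ?thesis ..
qed

lemma add3_powr_le:
  fixes a b c q :: real
  assumes "a \<ge> 0" "b \<ge> 0" "c \<ge> 0" "q > 0"
  shows "(a + b + c) powr q \<le> 3 powr q * (a powr q + b powr q + c powr q)"
proof -
  define m where "m = max a (max b c)"
  have "(a + b + c) powr q \<le> (3 * m) powr q"
    using assms by (intro powr_mono2) (auto simp: m_def)
  also have "\<dots> = 3 powr q * m powr q" using assms by (simp add: m_def powr_mult)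
  also have "m powr q \<le> a powr q + b powr q + c powr q"
    by (auto simp: m_def max_def)
  finally show ?thesis by simp
qed

lemma norm_diff3_powr_le:
  fixes a b c :: "'b::real_normed_vector"
  assumes "q > 0"
  shows "ennreal (norm (a - b - c) powr q) \<le> ennreal (3 powr q) * (ennreal (norm a powr q) + ennreal (norm b powr q) + ennreal (norm c powr q))"
proof -
  have "norm (a - b - c) \<le> norm a + norm b + norm c"
    using norm_triangle_ineq4[of "a - b" c] norm_triangle_ineq4[of a b] by linarith
  then have "norm (a - b - c) powr q \<le> (norm a + norm b + norm c) powr q"
    using assms by (intro powr_mono2) auto
  also have "\<dots> \<le> 3 powr q * (norm a powr q + norm b powr q + norm c powr q)"
    using assms by (intro add3_powr_le) auto
  finally have "ennreal (norm (a - b - c) powr q) \<le> ennreal (3 powr q * (norm a powr q + norm b powr q + norm c powr q))"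
    by (rule ennreal_leI)
  then show ?thesis by (simp add: ennreal_mult ennreal_plus)
qed

lemma nn_integral_norm_diff3_powr_le:
  fixes a b c :: "'a \<Rightarrow> 'b::{real_normed_vector, second_countable_topology}"
  assumes "q > 0" and [measurable]: "a \<in> borel_measurable M" "b \<in> borel_measurable M" "c \<in> borel_measurable M"
  shows "pow_int q M (\<lambda>x. a x - b x - c x) \<le> ennreal (3 powr q) *
    (pow_int q M a + pow_int q M b + pow_int q M c)"
proof -
  have "pow_int q M (\<lambda>x. a x - b x - c x) \<le> (\<integral>\<^sup>+x. ennreal (3 powr q) *
      (ennreal (norm (a x) powr q) + ennreal (norm (b x) powr q) + ennreal (norm (c x) powr q)) \<partial>M)"
    by (intro nn_integral_mono norm_diff3_powr_le assms)
  then show ?thesis by (simp add: nn_integral_cmult nn_integral_add)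
qed

text \<open>
  Identities between functions that are only known as limits in the mean are proved by bounding the integral of the
  difference by a null sequence.
\<close>

lemma AE_eq_zero_of_powr_integral:
  fixes D :: "'a \<Rightarrow> 'b::{real_normed_vector, second_countable_topology}"
  assumes q: "q > 0" and [measurable]: "D \<in> borel_measurable M"
    and le: "\<And>n::nat. pow_int q M D \<le> c n" and c: "c \<longlonglongrightarrow> 0"
  shows "AE x in M. D x = 0"
proof -
  have "pow_int q M D \<le> 0"
    by (rule LIMSEQ_le_const[OF c]) (use le in auto)
  then have "pow_int q M D = 0" by simp
  then have "AE x in M. ennreal (norm (D x) powr q) = 0"
    by (subst (asm) nn_integral_0_iff_AE) auto
  then show ?thesis by eventually_elim (auto simp: ennreal_eq_0_iff)
qed

text \<open>
  The weights \<open>2\<^sup>k\<close> leave a summable sequence of integrals. Hence almost everywhere the weighted differences are bounded,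
  and the differences themselves are dominated by a geometric series.
\<close>

lemma AE_convergent_of_fast_Cauchy:
  fixes u :: "nat \<Rightarrow> 'a \<Rightarrow> 'b::{banach, second_countable_topology}"
  assumes q: "q > 0" and u[measurable]: "\<And>k. u k \<in> borel_measurable M"
    and le: "\<And>k. pow_int q M (\<lambda>x. u (Suc k) x - u k x) \<le> ennreal ((1/2) ^ k * (1/2) powr (q * real k))"
  shows "AE x in M. convergent (\<lambda>k. u k x)"
proof -
  let ?D = "\<lambda>k x. 2 ^ k * norm (u (Suc k) x - u k x)"
  have D: "(\<integral>\<^sup>+x. ennreal (?D k x powr q) \<partial>M) \<le> ennreal ((1/2) ^ k)" for k
  proof -
    have "(\<integral>\<^sup>+x. ennreal (?D k x powr q) \<partial>M) = (\<integral>\<^sup>+x. ennreal (2 powr (q * real k)) * ennreal (norm (u (Suc k) x - u k x) powr q) \<partial>M)"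
    proof (rule nn_integral_cong)
      fix x
      have "(2 ^ k :: real) powr q = 2 powr (q * real k)"
        by (simp add: powr_realpow[symmetric] powr_powr mult.commute)
      then show "ennreal (?D k x powr q) = ennreal (2 powr (q * real k)) * ennreal (norm (u (Suc k) x - u k x) powr q)"
        by (simp add: powr_mult ennreal_mult)
    qed
    also have "\<dots> = ennreal (2 powr (q * real k)) * pow_int q M (\<lambda>x. u (Suc k) x - u k x)"
      by (rule nn_integral_cmult) measurable
    also have "\<dots> \<le> ennreal (2 powr (q * real k)) * ennreal ((1/2) ^ k * (1/2) powr (q * real k))"
      by (intro mult_left_mono le) simp
    also have "\<dots> = ennreal ((1/2) ^ k * (2 powr (q * real k) * (1/2) powr (q * real k)))"
      by (simp add: ennreal_mult[symmetric] mult_ac)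
    also have "2 powr (q * real k) * (1/2) powr (q * real k) = (1::real)"
      by (subst powr_mult[symmetric]) auto
    finally show ?thesis by simp
  qed
  have "(\<integral>\<^sup>+x. (\<Sum>k. ennreal (?D k x powr q)) \<partial>M) = (\<Sum>k. \<integral>\<^sup>+x. ennreal (?D k x powr q) \<partial>M)"
    by (rule nn_integral_suminf) measurable
  also have "\<dots> \<le> (\<Sum>k. ennreal ((1/2) ^ k))"
    by (intro suminf_le D) auto
  also have "\<dots> < \<infinity>"
    by (subst suminf_ennreal_eq[OF _ geometric_sums]) auto
  finally have "AE x in M. (\<Sum>k. ennreal (?D k x powr q)) \<noteq> \<infinity>"
    by (intro nn_integral_PInf_AE) auto
  then show ?thesis
  proof eventually_elim
    case (elim x)
    define S where "S = enn2real (\<Sum>k. ennreal (?D k x powr q))"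
    have b: "norm (u (Suc k) x - u k x) \<le> S powr (1 / q) * (1/2) ^ k" for k
    proof -
      have "ennreal (?D k x powr q) = (\<Sum>j\<in>{k}. ennreal (?D j x powr q))" by simp
      also have "\<dots> \<le> (\<Sum>k. ennreal (?D k x powr q))" by (rule sum_le_suminf) auto
      also have "\<dots> = ennreal S" using elim by (simp add: S_def less_top)
      finally have "?D k x powr q \<le> S" by (simp add: S_def)
      then have "(?D k x powr q) powr (1 / q) \<le> S powr (1 / q)"
        using q by (intro powr_mono2) auto
      then have "?D k x \<le> S powr (1 / q)" using q by (simp add: powr_powr)
      then show ?thesis by (simp add: field_simps)
    qed
    have "summable (\<lambda>k. u (Suc k) x - u k x)"
      by (rule summable_comparison_test'[OF summable_mult[OF summable_geometric], of "1/2" 0 _ "S powr (1 / q)"]) (use b in auto)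
    then have "convergent (\<lambda>n. \<Sum>k<n. u (Suc k) x - u k x)" by (simp add: summable_iff_convergent)
    then have "convergent (\<lambda>n. u n x - u 0 x)" by (simp only: sum_lessThan_telescope[of "\<lambda>k. u k x"])
    then have "convergent (\<lambda>n. (u n x - u 0 x) + u 0 x)" by (intro convergent_add convergent_const)
    then show ?case by simp
  qed
qed

text \<open>
  A space of functions, not of classes, as in the definition of the spaces \<open>L\<^sub>p\<^sub>,\<^sub>\<nu>\<close>.
\<close>

definition Lspace :: "real \<Rightarrow> 'a measure \<Rightarrow> ('a \<Rightarrow> complex) set" where
  "Lspace p M = {f \<in> borel_measurable M. integrable M (\<lambda>x. norm (f x) powr p)}"

text \<open>
  The endpoint bounds of the interpolation. Linearity is pointwise, as it is for integral operators, and both bounds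
  are required on \<open>L\<^sup>1\<close> only, where the operator is given by a convergent integral.
\<close>

locale L1_L2_operator = M: sigma_finite_measure M + N: sigma_finite_measure N
  for M :: "'a measure" and N :: "'b measure" +
  fixes T :: "('a \<Rightarrow> complex) \<Rightarrow> 'b \<Rightarrow> complex" and A B :: real
  assumes T_measurable: "integrable M f \<Longrightarrow> T f \<in> borel_measurable N"
    and T_add: "integrable M f \<Longrightarrow> integrable M g \<Longrightarrow> T (\<lambda>x. f x + g x) y = T f y + T g y"
    and T_cmult: "integrable M f \<Longrightarrow> T (\<lambda>x. k * f x) y = k * T f y"
    and T_L1: "integrable M f \<Longrightarrow> norm (T f y) \<le> A * (\<integral>x. norm (f x) \<partial>M)"
    and T_L2: "integrable M f \<Longrightarrow> (\<integral>\<^sup>+y. ennreal ((norm (T f y))\<^sup>2) \<partial>N) \<le> ennreal B * (\<integral>\<^sup>+x. ennreal ((norm (f x))\<^sup>2) \<partial>M)"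
    and A_pos: "A > 0" and B_nonneg: "B \<ge> 0"
begin

lemma T_diff: 
  assumes "integrable M f" "integrable M g"
  shows "T (\<lambda>x. f x - g x) y = T f y - T g y"
  using T_add[OF assms(1), of "\<lambda>x. - 1 * g x" y] T_cmult[OF assms(2), of "-1" y] assms by simp

text \<open>
  Cut \<open>f\<close> at the height for which the part above it has \<open>L\<^sup>1\<close> norm at most \<open>t / A\<close>. The transform of that part never
  exceeds \<open>t\<close>, so that a value above \<open>2t\<close> forces the transform of the lower part above \<open>t\<close>, and Chebyshev's
  inequality with the \<open>L\<^sup>2\<close> bound applies.
\<close>

lemma level_set_bound:
  assumes f: "integrable M f" and p: "1 < p" and K: "K > 0"
    and fK: "pow_int p M f \<le> ennreal K" and t: "t > 0"
  shows "(\<integral>\<^sup>+y. indicator {y. 2 * t < norm (T f y)} y \<partial>N) \<le>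
    ennreal (B / t\<^sup>2) * (\<integral>\<^sup>+x. ennreal ((norm (f x))\<^sup>2) * indicator {x. norm (f x) \<le> (A * K / t) powr (1 / (p - 1))} x \<partial>M)"
proof -
  \<comment> \<open>The solution of \<open>A K h\<^bsup>1-p\<^esup> = t\<close>.\<close>
  define h where "h = (A * K / t) powr (1 / (p - 1))"
  have h: "h > 0" using A_pos K t by (simp add: h_def)
  have hp: "h powr (p - 1) = A * K / t" using A_pos K t p by (simp add: h_def powr_powr)
  have fm[measurable]: "f \<in> borel_measurable M" using f by simp
  define f1 f2 where "f1 x = (if norm (f x) \<le> h then f x else 0)"
    and "f2 x = (if norm (f x) \<le> h then 0 else f x)" for x
  have m[measurable]: "f1 \<in> borel_measurable M" "f2 \<in> borel_measurable M"
    unfolding f1_def f2_def by measurable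
  have i1: "integrable M f1" by (rule Bochner_Integration.integrable_bound[OF f]) (auto simp: f1_def)
  have i2: "integrable M f2" by (rule Bochner_Integration.integrable_bound[OF f]) (auto simp: f2_def)
  have "(\<lambda>x. f1 x + f2 x) = f" by (auto simp: f1_def f2_def)
  with T_add[OF i1 i2] have T12: "T f y = T f1 y + T f2 y" for y by simp
  have "ennreal (\<integral>x. norm (f2 x) \<partial>M) = (\<integral>\<^sup>+x. ennreal (norm (f2 x)) \<partial>M)"
    using i2 by (simp add: nn_integral_eq_integral)
  also have "\<dots> \<le> (\<integral>\<^sup>+x. ennreal (t / (A * K)) * ennreal (norm (f x) powr p) \<partial>M)"
  proof (rule nn_integral_mono)
    fix x
    have "norm (f2 x) \<le> t / (A * K) * norm (f x) powr p"
    proof (cases "norm (f x) \<le> h")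
      case False
      then have "norm (f x) > 0" using h by linarith
      have "h powr (p - 1) \<le> norm (f x) powr (p - 1)"
        using False h p by (intro powr_mono2) auto
      then have "1 \<le> t / (A * K) * norm (f x) powr (p - 1)"
        unfolding hp using A_pos K t by (simp add: field_simps)
      then have "norm (f x) * 1 \<le> norm (f x) * (t / (A * K) * norm (f x) powr (p - 1))"
        by (intro mult_left_mono) auto
      also have "\<dots> = t / (A * K) * norm (f x) powr p"
        using \<open>norm (f x) > 0\<close> by (simp add: powr_diff)
      finally show ?thesis using False by (simp add: f2_def)
    qed (use A_pos K t in \<open>simp add: f2_def\<close>)
    then show "ennreal (norm (f2 x)) \<le> ennreal (t / (A * K)) * ennreal (norm (f x) powr p)"
      using A_pos K t by (simp add: ennreal_mult[symmetric] ennreal_leI)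
  qed
  also have "\<dots> = ennreal (t / (A * K)) * pow_int p M f"
    by (rule nn_integral_cmult) measurable
  also have "\<dots> \<le> ennreal (t / (A * K)) * ennreal K" by (intro mult_left_mono fK) simp
  also have "\<dots> = ennreal (t / A)" using A_pos K t by (simp add: ennreal_mult[symmetric])
  finally have "(\<integral>x. norm (f2 x) \<partial>M) \<le> t / A" using A_pos t by simp
  then have "A * (\<integral>x. norm (f2 x) \<partial>M) \<le> t" using A_pos by (simp add: field_simps)
  then have T2: "norm (T f2 y) \<le> t" for y using T_L1[OF i2, of y] by linarith
  have "(\<integral>\<^sup>+y. indicator {y. 2 * t < norm (T f y)} y \<partial>N) \<le> (\<integral>\<^sup>+y. ennreal (1 / t\<^sup>2) * ennreal ((norm (T f1 y))\<^sup>2) \<partial>N)"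
  proof (rule nn_integral_mono)
    fix y
    show "indicator {y. 2 * t < norm (T f y)} y \<le> ennreal (1 / t\<^sup>2) * ennreal ((norm (T f1 y))\<^sup>2)"
    proof (cases "2 * t < norm (T f y)")
      case True
      then have "t \<le> norm (T f1 y)" using T12[of y] T2[of y] norm_triangle_ineq[of "T f1 y" "T f2 y"] by simp
      then have "t\<^sup>2 \<le> (norm (T f1 y))\<^sup>2" using t by (intro power_mono) auto
      then have "1 \<le> 1 / t\<^sup>2 * (norm (T f1 y))\<^sup>2" using t by (simp add: field_simps)
      then have "ennreal 1 \<le> ennreal (1 / t\<^sup>2 * (norm (T f1 y))\<^sup>2)" by (rule ennreal_leI)
      then show ?thesis using True by (simp add: ennreal_mult[symmetric])
    qed simp
  qed
  also have "\<dots> = ennreal (1 / t\<^sup>2) * (\<integral>\<^sup>+y. ennreal ((norm (T f1 y))\<^sup>2) \<partial>N)"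
    by (rule nn_integral_cmult) (use T_measurable[OF i1] in simp)
  also have "\<dots> \<le> ennreal (1 / t\<^sup>2) * (ennreal B * (\<integral>\<^sup>+x. ennreal ((norm (f1 x))\<^sup>2) \<partial>M))"
    by (intro mult_left_mono T_L2 i1) simp
  also have "\<dots> = ennreal (B / t\<^sup>2) * (\<integral>\<^sup>+x. ennreal ((norm (f1 x))\<^sup>2) \<partial>M)"
    using B_nonneg by (simp add: mult.assoc[symmetric] ennreal_mult[symmetric])
  also have "(\<integral>\<^sup>+x. ennreal ((norm (f1 x))\<^sup>2) \<partial>M) = (\<integral>\<^sup>+x. ennreal ((norm (f x))\<^sup>2) * indicator {x. norm (f x) \<le> h} x \<partial>M)"
    by (intro nn_integral_cong) (auto simp: f1_def split: split_indicator)
  finally show ?thesis unfolding h_def .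
qed

text \<open>
  Integrate the bound for the level sets against \<open>q 2\<^sup>q t\<^bsup>q-1\<^esup> dt\<close> and exchange the integrals. For a fixed value \<open>v\<close> of
  \<open>|f|\<close> the cut restricts \<open>t\<close> to \<open>t \<le> A K v\<^bsup>1-p\<^esup>\<close>, and since \<open>q > 2\<close> the integral of \<open>t\<^bsup>q-3\<^esup>\<close> over this range
  converges and equals a multiple of \<open>v\<^bsup>p-2\<^esup>\<close>.
\<close>

lemma interpolation_lt_2:
  assumes p: "1 < p" "p < 2" and q: "q = p / (p - 1)"
    and f: "integrable M f" and K: "K > 0"
    and fK: "pow_int p M f \<le> ennreal K"
  shows "pow_int q N (T f) \<le> ennreal (q * 2 powr q * B * A powr (q - 2) / (q - 2) * K powr (q / p))"
proof -
  have q2: "q > 2" using p by (simp add: q field_simps)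
  have qp: "q / p = q - 1" using p by (simp add: q field_simps)
  interpret PN: pair_sigma_finite N lborel ..
  interpret PM: pair_sigma_finite M lborel ..
  have fm[measurable]: "f \<in> borel_measurable M" using f by simp
  have Tm[measurable]: "T f \<in> borel_measurable N" by (rule T_measurable[OF f])
  let ?h = "\<lambda>t. (A * K / t) powr (1 / (p - 1))"
  have "pow_int q N (T f) =
      (\<integral>\<^sup>+y. \<integral>\<^sup>+t. ennreal (q * 2 powr q * t powr (q - 1)) * indicator {0<..<norm (T f y) / 2} t \<partial>lborel \<partial>N)"
    using q2 by (intro nn_integral_cong powr_layer_cake) auto
  also have "\<dots> = (\<integral>\<^sup>+y. \<integral>\<^sup>+t. ennreal (q * 2 powr q * t powr (q - 1)) * (indicator {0<..} t * (if 2 * t < norm (T f y) then 1 else 0)) \<partial>lborel \<partial>N)"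
    by (intro nn_integral_cong) (auto split: split_indicator)
  also have "\<dots> = (\<integral>\<^sup>+t. \<integral>\<^sup>+y. ennreal (q * 2 powr q * t powr (q - 1)) * (indicator {0<..} t * (if 2 * t < norm (T f y) then 1 else 0)) \<partial>N \<partial>lborel)"
    by (rule PN.Fubini'[symmetric]) measurable
  also have "\<dots> \<le> (\<integral>\<^sup>+t. \<integral>\<^sup>+x. ennreal ((norm (f x))\<^sup>2) * (ennreal (q * 2 powr q * B * t powr (q - 3)) * (if 0 < t \<and> norm (f x) \<le> ?h t then 1 else 0)) \<partial>M \<partial>lborel)"
  proof (rule nn_integral_mono)
    fix t :: real
    show "(\<integral>\<^sup>+y. ennreal (q * 2 powr q * t powr (q - 1)) * (indicator {0<..} t * (if 2 * t < norm (T f y) then 1 else 0)) \<partial>N) \<le>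
      (\<integral>\<^sup>+x. ennreal ((norm (f x))\<^sup>2) * (ennreal (q * 2 powr q * B * t powr (q - 3)) * (if 0 < t \<and> norm (f x) \<le> ?h t then 1 else 0)) \<partial>M)"
    proof (cases "t > 0")
      case True
      have "(\<integral>\<^sup>+y. ennreal (q * 2 powr q * t powr (q - 1)) * (indicator {0<..} t * (if 2 * t < norm (T f y) then 1 else 0)) \<partial>N)
          = ennreal (q * 2 powr q * t powr (q - 1)) * (\<integral>\<^sup>+y. indicator {y. 2 * t < norm (T f y)} y \<partial>N)"
        using True by (subst nn_integral_cmult[symmetric]) (auto intro!: nn_integral_cong split: split_indicator)
      also have "\<dots> \<le> ennreal (q * 2 powr q * t powr (q - 1)) * (ennreal (B / t\<^sup>2) *
          (\<integral>\<^sup>+x. ennreal ((norm (f x))\<^sup>2) * indicator {x. norm (f x) \<le> ?h t} x \<partial>M))"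
        by (intro mult_left_mono level_set_bound f p K fK True) simp
      also have "\<dots> = ennreal (q * 2 powr q * B * t powr (q - 3)) * (\<integral>\<^sup>+x. ennreal ((norm (f x))\<^sup>2) * indicator {x. norm (f x) \<le> ?h t} x \<partial>M)"
      proof -
        have "t powr (q - 1) / t\<^sup>2 = t powr (q - 3)"
          using True powr_diff[of t "q - 1" 2] by simp
        moreover have "q * 2 powr q * t powr (q - 1) * (B / t\<^sup>2) = q * 2 powr q * B * (t powr (q - 1) / t\<^sup>2)"
          by simp
        ultimately have "q * 2 powr q * t powr (q - 1) * (B / t\<^sup>2) = q * 2 powr q * B * t powr (q - 3)"
          by (simp only:)
        then show ?thesis using B_nonneg q2 True
          by (simp add: mult.assoc[symmetric] ennreal_mult'[symmetric])
      qed
      also have "\<dots> = (\<integral>\<^sup>+x. ennreal ((norm (f x))\<^sup>2) * (ennreal (q * 2 powr q * B * t powr (q - 3)) * (if 0 < t \<and> norm (f x) \<le> ?h t then 1 else 0)) \<partial>M)"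
        using True by (subst nn_integral_cmult[symmetric]) (auto intro!: nn_integral_cong split: split_indicator simp: mult_ac)
      finally show ?thesis .
    qed simp
  qed
  also have "\<dots> = (\<integral>\<^sup>+x. \<integral>\<^sup>+t. ennreal ((norm (f x))\<^sup>2) * (ennreal (q * 2 powr q * B * t powr (q - 3)) * (if 0 < t \<and> norm (f x) \<le> ?h t then 1 else 0)) \<partial>lborel \<partial>M)"
    by (rule PM.Fubini') measurable
  also have "\<dots> \<le> (\<integral>\<^sup>+x. ennreal (q * 2 powr q * B * (A * K) powr (q - 2) / (q - 2)) * ennreal (norm (f x) powr p) \<partial>M)"
  proof (rule nn_integral_mono)
    fix x
    show "(\<integral>\<^sup>+t. ennreal ((norm (f x))\<^sup>2) * (ennreal (q * 2 powr q * B * t powr (q - 3)) * (if 0 < t \<and> norm (f x) \<le> ?h t then 1 else 0)) \<partial>lborel) \<le>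
       ennreal (q * 2 powr q * B * (A * K) powr (q - 2) / (q - 2)) * ennreal (norm (f x) powr p)"
    proof (cases "f x = 0")
      case False
      define v where "v = norm (f x)"
      have v: "v > 0" using False by (simp add: v_def)
      \<comment> \<open>The largest level \<open>t\<close> whose cut height is at least \<open>v\<close>.\<close>
      define L where "L = A * K * v powr (1 - p)"
      have L: "L > 0" using A_pos K v by (simp add: L_def)
      have c: "t \<le> L" if "0 < t" "v \<le> ?h t" for t
      proof -
        have "v powr (p - 1) \<le> ?h t powr (p - 1)" using that v p by (intro powr_mono2) auto
        also have "\<dots> = A * K / t" using p that A_pos K by (simp add: powr_powr)
        finally have "t * v powr (p - 1) \<le> A * K" using that by (simp add: field_simps)
        then have "t * v powr (p - 1) * v powr (1 - p) \<le> A * K * v powr (1 - p)"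
          by (rule mult_right_mono) simp
        moreover have "v powr (p - 1) * v powr (1 - p) = 1"
          using v by (simp add: powr_add[symmetric])
        ultimately show ?thesis by (simp add: L_def mult.assoc)
      qed
      have "(\<integral>\<^sup>+t. ennreal (v\<^sup>2) * (ennreal (q * 2 powr q * B * t powr (q - 3)) * (if 0 < t \<and> v \<le> ?h t then 1 else 0)) \<partial>lborel)
          \<le> (\<integral>\<^sup>+t. ennreal (v\<^sup>2 * (q * 2 powr q * B)) * (ennreal (t powr (q - 2 - 1)) * indicator {0<..<L} t) \<partial>lborel)"
      proof (rule nn_integral_mono_AE, use AE_lborel_singleton[of L] in eventually_elim)
        case (elim t)
        have "ennreal (v\<^sup>2) * ennreal (q * 2 powr q * B * t powr (q - 3)) = ennreal (v\<^sup>2 * (q * 2 powr q * B)) * ennreal (t powr (q - 2 - 1))"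
          using q2 B_nonneg by (simp add: ennreal_mult[symmetric] mult_ac)
        then show ?case using c[of t] elim by (auto split: split_indicator simp: mult.assoc[symmetric])
      qed
      also have "\<dots> = ennreal (v\<^sup>2 * (q * 2 powr q * B)) * ennreal (L powr (q - 2) / (q - 2))"
        using q2 L nn_integral_powr_Ioo[of "q - 2" L] by (subst nn_integral_cmult) auto
      also have "\<dots> = ennreal (q * 2 powr q * B * (A * K) powr (q - 2) / (q - 2)) * ennreal (v powr p)"
      proof -
        have "L powr (q - 2) = (A * K) powr (q - 2) * v powr ((1 - p) * (q - 2))"
          using A_pos K v by (simp add: L_def powr_mult powr_powr)
        also have "(1 - p) * (q - 2) = p - 2" using p by (simp add: q field_simps)
        finally have "v\<^sup>2 * L powr (q - 2) = (A * K) powr (q - 2) * v powr p"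
          using v by (simp add: powr_diff)
        then have "v\<^sup>2 * (q * 2 powr q * B) * (L powr (q - 2) / (q - 2)) = q * 2 powr q * B * (A * K) powr (q - 2) / (q - 2) * v powr p"
          by (simp add: field_simps)
        then show ?thesis using q2 B_nonneg by (simp add: ennreal_mult[symmetric] del: times_divide_eq_left times_divide_eq_right)
      qed
      finally show ?thesis unfolding v_def .
    qed simp
  qed
  also have "\<dots> = ennreal (q * 2 powr q * B * (A * K) powr (q - 2) / (q - 2)) * pow_int p M f"
    by (rule nn_integral_cmult) measurable
  also have "\<dots> \<le> ennreal (q * 2 powr q * B * (A * K) powr (q - 2) / (q - 2)) * ennreal K"
    by (intro mult_left_mono fK) simp
  also have "\<dots> = ennreal (q * 2 powr q * B * A powr (q - 2) / (q - 2) * K powr (q / p))"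
  proof -
    have "K powr (q - 2) * K = K powr (q / p)" unfolding qp using K powr_mult_base[of K "q - 2"] by (simp add: mult.commute)
    then have "q * 2 powr q * B * (A * K) powr (q - 2) / (q - 2) * K = q * 2 powr q * B * A powr (q - 2) / (q - 2) * K powr (q / p)"
      using A_pos K by (simp add: powr_mult field_simps)
    then show ?thesis using q2 B_nonneg K by (simp add: ennreal_mult[symmetric] del: times_divide_eq_left times_divide_eq_right)
  qed
  finally show ?thesis .
qed

lemma hausdorff_young_a_priori:
  assumes p: "1 < p" "p \<le> 2" and q: "q = p / (p - 1)"
  obtains C where "C > 0" "\<And>(f :: 'a \<Rightarrow> complex) K. integrable M f \<Longrightarrow> K \<ge> 0 \<Longrightarrow>
    pow_int p M f \<le> ennreal K \<Longrightarrow>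
    pow_int q N (T f) \<le> ennreal (C * K powr (q / p))"
proof -
  have q1: "q > 0" using p by (simp add: q)
  \<comment> \<open>The summand \<open>1\<close> makes the constant positive for the zero operator as well.\<close>
  define C where "C = (if p = 2 then B else q * 2 powr q * B * A powr (q - 2) / (q - 2)) + 1"
  have C: "C > 0"
  proof (cases "p = 2")
    case False
    then have "q > 2" using p by (simp add: q field_simps)
    then have "q * 2 powr q * B * A powr (q - 2) / (q - 2) \<ge> 0" using B_nonneg by simp
    then show ?thesis using False by (simp add: C_def)
  qed (use B_nonneg in \<open>simp add: C_def\<close>)
  show ?thesis
  proof (rule that[OF C])
    fix f :: "'a \<Rightarrow> complex" and K assume f: "integrable M f" and K: "K \<ge> 0"
      and fK: "pow_int p M f \<le> ennreal K"
    show "pow_int q N (T f) \<le> ennreal (C * K powr (q / p))"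
    proof (cases "K = 0")
      case True
      have fm[measurable]: "f \<in> borel_measurable M" using f by simp
      have "AE x in M. f x = 0"
        by (rule AE_eq_zero_of_powr_integral[of p f M "\<lambda>_. 0"]) (use fK True p in auto)
      then have "(\<integral>x. norm (f x) \<partial>M) = 0"
        by (intro integral_eq_zero_AE) auto
      then have "T f y = 0" for y using T_L1[OF f, of y] by simp
      then show ?thesis using q1 by simp
    next
      case False
      then have K: "K > 0" using K by simp
      show ?thesis
      proof (cases "p = 2")
        case True
        then have q2: "q = 2" by (simp add: q)
        have "pow_int q N (T f) = (\<integral>\<^sup>+y. ennreal ((norm (T f y))\<^sup>2) \<partial>N)"
          unfolding q2 by simp
        also have "\<dots> \<le> ennreal B * (\<integral>\<^sup>+x. ennreal ((norm (f x))\<^sup>2) \<partial>M)" by (rule T_L2[OF f])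
        also have "\<dots> \<le> ennreal B * ennreal K" using fK True by (intro mult_left_mono) auto
        also have "\<dots> = ennreal (B * K)" using B_nonneg K by (simp add: ennreal_mult)
        also have "\<dots> \<le> ennreal (C * K powr (q / p))"
          using True q2 K by (intro ennreal_leI) (simp add: C_def)
        finally show ?thesis .
      next
        case False
        then have "pow_int q N (T f) \<le> ennreal (q * 2 powr q * B * A powr (q - 2) / (q - 2) * K powr (q / p))"
          using p by (intro interpolation_lt_2[OF _ _ q f K fK]) auto
        also have "\<dots> \<le> ennreal (C * K powr (q / p))"
          using False by (intro ennreal_leI mult_right_mono) (auto simp: C_def)
        finally show ?thesis .
      qed
    qed
  qed
qed

text \<open>
  Truncate \<open>f\<close> to sets \<open>S\<^sub>n\<close> of finite measure that exhaust the space. The a priori bound makes the transforms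
  of the truncations a Cauchy sequence in \<open>L\<^sup>q\<close>; along a fast subsequence they converge almost everywhere, and by Fatou's
  lemma the limit is the limit in the mean of the whole sequence. All properties of the extension pass to the limit
  from the truncations, on which the operator is linear.
\<close>

lemma hausdorff_young_extension:
  assumes p: "1 < p" "p \<le> 2" and q: "q = p / (p - 1)"
  obtains E C where
    "\<And>f. f \<in> Lspace p M \<Longrightarrow> E f \<in> Lspace q N"
    "\<And>f g. f \<in> Lspace p M \<Longrightarrow> g \<in> Lspace p M \<Longrightarrow> AE y in N. E (\<lambda>x. f x + g x) y = E f y + E g y"
    "\<And>k f. f \<in> Lspace p M \<Longrightarrow> AE y in N. E (\<lambda>x. k * f x) y = k * E f y"
    "\<And>f. f \<in> Lspace p M \<Longrightarrow> (\<integral>y. norm (E f y) powr q \<partial>N) powr (1 / q) \<le> C * (\<integral>x. norm (f x) powr p \<partial>M) powr (1 / p)"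
    "\<And>f. f \<in> Lspace p M \<Longrightarrow> integrable M f \<Longrightarrow> AE y in N. E f y = T f y"
proof -
  have q0: "q > 0" using p by (simp add: q)
  have p0: "p > 0" using p by simp
  obtain C where C: "C > 0" and HY: "\<And>f K. integrable M f \<Longrightarrow> K \<ge> 0 \<Longrightarrow>
    pow_int p M f \<le> ennreal K \<Longrightarrow>
    pow_int q N (T f) \<le> ennreal (C * K powr (q / p))"
    using hausdorff_young_a_priori[OF p q] by blast
  obtain S :: "nat \<Rightarrow> 'a set" where S: "range S \<subseteq> sets M" "(\<Union>i. S i) = space M"
      "\<And>i. emeasure M (S i) \<noteq> \<infinity>" "incseq S"
    using M.sigma_finite_incseq by metis
  have Sm[measurable]: "S n \<in> sets M" for n using S(1) by auto
  define tr where "tr n f x = (if x \<in> S n then f x else (0::complex))" for n f x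
  have Lm: "f \<in> borel_measurable M" if "f \<in> Lspace p M" for f using that by (simp add: Lspace_def)
  have Li: "integrable M (\<lambda>x. norm (f x) powr p)" if "f \<in> Lspace p M" for f using that by (simp add: Lspace_def)
  have trm: "tr n f \<in> borel_measurable M" if "f \<in> Lspace p M" for f n
    using Lm[OF that] unfolding tr_def[abs_def] by measurable
  have tri: "integrable M (tr n f)" if f: "f \<in> Lspace p M" for f n
  proof (rule Bochner_Integration.integrable_bound)
    have "integrable M (indicator (S n) :: 'a \<Rightarrow> real)" using S(3)[of n] by (simp add: less_top)
    then show "integrable M (\<lambda>x. indicator (S n) x + norm (f x) powr p)"
      using Li[OF f] by simp
    have "norm (tr n f x) \<le> norm (indicator (S n) x + norm (f x) powr p)" for x
    proof (cases "norm (f x) \<le> 1")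
      case False
      then have "norm (f x) powr 1 \<le> norm (f x) powr p" using p by (intro powr_mono) auto
      then show ?thesis by (auto simp: tr_def intro: add_increasing)
    qed (auto simp: tr_def intro: add_increasing2)
    then show "AE x in M. norm (tr n f x) \<le> norm (indicator (S n) x + norm (f x) powr p)" by simp
  qed (use trm[OF f] in auto)
  define \<tau> where "\<tau> f n = (\<integral>x. norm (f x - tr n f x) powr p \<partial>M)" for f n
  have \<tau>i: "integrable M (\<lambda>x. norm (f x - tr n f x) powr p)" if f: "f \<in> Lspace p M" for f n
    by (rule Bochner_Integration.integrable_bound[OF Li[OF f]]) (use trm[OF f] Lm[OF f] in \<open>auto simp: tr_def\<close>)
  have \<tau>0: "\<tau> f n \<ge> 0" for f n by (simp add: \<tau>_def)
  have \<tau>nn: "pow_int p M (\<lambda>x. f x - tr n f x) = ennreal (\<tau> f n)" if f: "f \<in> Lspace p M" for f n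
    unfolding \<tau>_def by (rule nn_integral_eq_integral[OF \<tau>i[OF f]]) simp
  have \<tau>le: "\<tau> f n \<le> (\<integral>x. norm (f x) powr p \<partial>M)" if f: "f \<in> Lspace p M" for f n
    unfolding \<tau>_def by (intro integral_mono \<tau>i Li f) (auto simp: tr_def)
  have \<tau>lim: "\<tau> f \<longlonglongrightarrow> 0" if f: "f \<in> Lspace p M" for f
  proof -
    have "(\<lambda>n. \<integral>x. norm (f x - tr n f x) powr p \<partial>M) \<longlonglongrightarrow> (\<integral>x. 0 \<partial>M)"
    proof (rule integral_dominated_convergence[OF _ _ Li[OF f]])
      show "AE x in M. (\<lambda>n. norm (f x - tr n f x) powr p) \<longlonglongrightarrow> 0"
      proof (rule AE_I2)
        fix x assume "x \<in> space M"
        then obtain k where k: "x \<in> S k" using S(2) by auto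
        have "norm (f x - tr n f x) powr p = 0" if "n \<ge> k" for n
          using k S(4) that by (auto simp: tr_def incseq_def)
        then show "(\<lambda>n. norm (f x - tr n f x) powr p) \<longlonglongrightarrow> 0"
          by (intro tendsto_eventually) (auto simp: eventually_sequentially)
      qed
    qed (use trm[OF f] Lm[OF f] in \<open>auto simp: tr_def\<close>)
    then show ?thesis by (simp add: \<tau>_def[abs_def])
  qed
  define e where "e f n = C * \<tau> f n powr (q / p)" for f n
  have e0: "e f n \<ge> 0" for f n using C by (simp add: e_def)
  have e_lim: "e f \<longlonglongrightarrow> 0" if f: "f \<in> Lspace p M" for f
  proof -
    have "(\<lambda>n. C * \<tau> f n powr (q / p)) \<longlonglongrightarrow> C * 0 powr (q / p)"
      by (intro tendsto_intros tendsto_powr' \<tau>lim[OF f]) (use q0 p0 \<tau>0 in auto)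
    then show ?thesis by (simp add: e_def[abs_def])
  qed
  have Tm: "T f \<in> borel_measurable N" if "integrable M f" for f by (rule T_measurable[OF that])
  have diff: "pow_int q N (\<lambda>y. T (tr m f) y - T (tr n f) y) \<le> ennreal (e f n)"
    if f: "f \<in> Lspace p M" and nm: "n \<le> m" for f n m
  proof -
    have i: "integrable M (\<lambda>x. tr m f x - tr n f x)" using tri[OF f] by simp
    have sub: "S n \<subseteq> S m" using S(4) nm by (simp add: incseq_def)
    have "pow_int p M (\<lambda>x. tr m f x - tr n f x) \<le> pow_int p M (\<lambda>x. f x - tr n f x)"
      by (intro nn_integral_mono ennreal_leI powr_mono2) (use p sub in \<open>auto simp: tr_def\<close>)
    then have "pow_int q N (T (\<lambda>x. tr m f x - tr n f x)) \<le> ennreal (e f n)"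
      unfolding \<tau>nn[OF f] e_def by (intro HY[OF i \<tau>0])
    then show ?thesis by (simp add: T_diff[OF tri[OF f] tri[OF f]])
  qed
  have ex: "\<exists>U\<in>borel_measurable N. \<forall>n. pow_int q N (\<lambda>y. U y - T (tr n f) y) \<le> ennreal (e f n)"
    if f: "f \<in> Lspace p M" for f
  proof -
    \<comment> \<open>Indices \<open>r k\<close> from which on the errors have the decay required for convergence almost everywhere.\<close>
    have "\<exists>r. \<forall>k. (\<forall>n\<ge>r k. e f n \<le> (1/2) ^ k * (1/2) powr (q * real k)) \<and> r k < r (Suc k)"
    proof (rule dependent_nat_choice)
      have ev: "\<exists>m. \<forall>n\<ge>m. e f n \<le> d" if "d > 0" for d
        using order_tendstoD(2)[OF e_lim[OF f] that] by (auto simp: eventually_sequentially intro: less_imp_le)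
      show "\<exists>m. \<forall>n\<ge>m. e f n \<le> (1/2) ^ 0 * (1/2) powr (q * real 0)" by (intro ev) auto
      fix m :: nat and k
      obtain m' where m': "\<forall>n\<ge>m'. e f n \<le> (1/2) ^ (Suc k) * (1/2) powr (q * real (Suc k))"
        using ev[of "(1/2) ^ (Suc k) * (1/2) powr (q * real (Suc k))"] by auto
      show "\<exists>y. (\<forall>n\<ge>y. e f n \<le> (1/2) ^ Suc k * (1/2) powr (q * real (Suc k))) \<and> m < y"
        by (rule exI[of _ "max m' (Suc m)"]) (use m' in auto)
    qed
    then obtain r where r: "\<And>k n. n \<ge> r k \<Longrightarrow> e f n \<le> (1/2) ^ k * (1/2) powr (q * real k)" and rs: "strict_mono r"
      by (auto simp: strict_mono_Suc_iff)
    define u where "u k = T (tr (r k) f)" for k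
    have um[measurable]: "u k \<in> borel_measurable N" for k unfolding u_def by (rule Tm[OF tri[OF f]])
    have trTm[measurable]: "T (tr n f) \<in> borel_measurable N" for n by (rule Tm[OF tri[OF f]])
    have cvg: "AE y in N. convergent (\<lambda>k. u k y)"
    proof (rule AE_convergent_of_fast_Cauchy[OF q0 um])
      fix k
      have "r k \<le> r (Suc k)" using rs by (simp add: strict_mono_less_eq)
      from diff[OF f this] show "pow_int q N (\<lambda>y. u (Suc k) y - u k y) \<le> ennreal ((1/2) ^ k * (1/2) powr (q * real k))"
        unfolding u_def using r[of k "r k"] by (auto intro: order_trans ennreal_leI)
    qed
    define U where "U y = lim (\<lambda>k. u k y)" for y
    have Um: "U \<in> borel_measurable N" unfolding U_def[abs_def] by (rule borel_measurable_lim_metric) measurable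
    have "pow_int q N (\<lambda>y. U y - T (tr n f) y) \<le> ennreal (e f n)" for n
    proof (rule nn_integral_le_of_tendsto[where f = "\<lambda>k y. norm (u (k + n) y - T (tr n f) y) powr q" and c = "\<lambda>_. ennreal (e f n)"])
      show "AE y in N. (\<lambda>k. norm (u (k + n) y - T (tr n f) y) powr q) \<longlonglongrightarrow> norm (U y - T (tr n f) y) powr q"
        using cvg
      proof eventually_elim
        case (elim y)
        then have "(\<lambda>k. u k y) \<longlonglongrightarrow> U y" by (simp add: U_def convergent_LIMSEQ_iff)
        then have "(\<lambda>k. u (k + n) y) \<longlonglongrightarrow> U y" by (rule LIMSEQ_ignore_initial_segment)
        then show ?case
          by (intro tendsto_powr' tendsto_norm tendsto_diff tendsto_const) (use q0 in auto)
      qed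
      fix k
      have "n \<le> r (k + n)" using seq_suble[OF rs, of "k + n"] by simp
      from diff[OF f this] show "pow_int q N (\<lambda>y. u (k + n) y - T (tr n f) y) \<le> ennreal (e f n)"
        unfolding u_def .
      show "(\<lambda>y. norm (u (k + n) y - T (tr n f) y) powr q) \<in> borel_measurable N" by measurable
    qed simp
    with Um show ?thesis by blast
  qed
  define E where "E f = (SOME U. U \<in> borel_measurable N \<and> (\<forall>n. pow_int q N (\<lambda>y. U y - T (tr n f) y) \<le> ennreal (e f n)))" for f
  have E: "E f \<in> borel_measurable N \<and> (\<forall>n. pow_int q N (\<lambda>y. E f y - T (tr n f) y) \<le> ennreal (e f n))"
    if f: "f \<in> Lspace p M" for f
    using someI_ex[OF ex[OF f, unfolded Bex_def]] unfolding E_def .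
  have Em: "E f \<in> borel_measurable N" if "f \<in> Lspace p M" for f using E[OF that] by blast
  have Ele: "pow_int q N (\<lambda>y. E f y - T (tr n f) y) \<le> ennreal (e f n)" if "f \<in> Lspace p M" for f n
    using E[OF that] by blast
  have lim0: "(\<lambda>n. ennreal (3 powr q) * (ennreal (a n) + ennreal (b n) + ennreal (c n))) \<longlonglongrightarrow> 0"
    if "a \<longlonglongrightarrow> 0" "b \<longlonglongrightarrow> 0" "c \<longlonglongrightarrow> 0" for a b c :: "nat \<Rightarrow> real"
  proof -
    have "(\<lambda>n. ennreal (3 powr q) * (ennreal (a n) + ennreal (b n) + ennreal (c n))) \<longlonglongrightarrow> ennreal (3 powr q) * (ennreal 0 + ennreal 0 + ennreal 0)"
      by (intro ennreal_tendsto_cmult tendsto_add tendsto_ennrealI that) simp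
    then show ?thesis by simp
  qed
  have zero: "AE y in N. D y = 0"
    if D: "\<And>n y. D y = u n y - v n y - w n y"
      and m: "\<And>n. u n \<in> borel_measurable N" "\<And>n. v n \<in> borel_measurable N" "\<And>n. w n \<in> borel_measurable N"
      and le: "\<And>n. pow_int q N (u n) \<le> ennreal (a n)"
        "\<And>n. pow_int q N (v n) \<le> ennreal (b n)"
        "\<And>n. pow_int q N (w n) \<le> ennreal (c n)"
      and l: "a \<longlonglongrightarrow> 0" "b \<longlonglongrightarrow> 0" "c \<longlonglongrightarrow> 0"
    for D :: "'b \<Rightarrow> complex" and u v w :: "nat \<Rightarrow> 'b \<Rightarrow> complex" and a b c :: "nat \<Rightarrow> real"
  proof (rule AE_eq_zero_of_powr_integral[OF q0 _ _ lim0[OF l]])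
    have "D = (\<lambda>y. u 0 y - v 0 y - w 0 y)" using D by auto
    then show "D \<in> borel_measurable N" using m by simp
    fix n
    have "pow_int q N D \<le> ennreal (3 powr q) * (pow_int q N (u n) +
        pow_int q N (v n) + pow_int q N (w n))"
      unfolding D[of _ n] by (rule nn_integral_norm_diff3_powr_le[OF q0 m])
    also have "\<dots> \<le> ennreal (3 powr q) * (ennreal (a n) + ennreal (b n) + ennreal (c n))"
      by (intro mult_left_mono add_mono le) simp
    finally show "pow_int q N D \<le> ennreal (3 powr q) * (ennreal (a n) + ennreal (b n) + ennreal (c n))" .
  qed
  \<comment> \<open>Two terms of the three-term estimate are nonzero, and each is bounded by the a priori estimate.\<close>
  define C' where "C' = 2 * 3 powr q * C"
  have Ebound: "pow_int q N (E f) \<le> ennreal (C' * (\<integral>x. norm (f x) powr p \<partial>M) powr (q / p))"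
    if f: "f \<in> Lspace p M" for f
  proof -
    let ?I = "\<integral>x. norm (f x) powr p \<partial>M"
    have I0: "?I \<ge> 0" by simp
    have a: "pow_int q N (\<lambda>y. E f y - T (tr 0 f) y) \<le> ennreal (C * ?I powr (q / p))"
    proof -
      have "e f 0 \<le> C * ?I powr (q / p)" unfolding e_def
        using C \<tau>0[of f 0] \<tau>le[OF f, of 0] q0 p0 by (intro mult_left_mono powr_mono2) auto
      then show ?thesis using Ele[OF f, of 0] by (auto intro: order_trans ennreal_leI)
    qed
    have b: "pow_int q N (\<lambda>y. - T (tr 0 f) y) \<le> ennreal (C * ?I powr (q / p))"
    proof -
      have "pow_int p M (tr 0 f) \<le> pow_int p M f"
        by (intro nn_integral_mono ennreal_leI powr_mono2) (use p in \<open>auto simp: tr_def\<close>)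
      also have "\<dots> = ennreal ?I" by (rule nn_integral_eq_integral[OF Li[OF f]]) simp
      finally show ?thesis using HY[OF tri[OF f] I0] by simp
    qed
    have "pow_int q N (E f) = pow_int q N (\<lambda>y. (E f y - T (tr 0 f) y) - (- T (tr 0 f) y) - 0)" by simp
    also have "\<dots> \<le> ennreal (3 powr q) * (pow_int q N (\<lambda>y. E f y - T (tr 0 f) y) +
       pow_int q N (\<lambda>y. - T (tr 0 f) y) + pow_int q N (\<lambda>y. 0::complex))"
      using Em[OF f] Tm[OF tri[OF f, of 0]] by (intro nn_integral_norm_diff3_powr_le[OF q0]) auto
    also have "\<dots> \<le> ennreal (3 powr q) * (ennreal (C * ?I powr (q / p)) + ennreal (C * ?I powr (q / p)) + 0)"
      by (intro mult_left_mono add_mono a b) auto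
    also have "\<dots> = ennreal (C' * ?I powr (q / p))"
      using C by (simp add: C'_def ennreal_plus[symmetric] ennreal_mult[symmetric] algebra_simps del: ennreal_plus)
    finally show ?thesis .
  qed
  have Eint: "integrable N (\<lambda>y. norm (E f y) powr q)" if f: "f \<in> Lspace p M" for f
    using Em[OF f] Ebound[OF f] by (intro integrableI_bounded) (auto simp: top_unique less_top[symmetric])
  show ?thesis
  proof (rule that[of E "C' powr (1 / q)"])
    fix f assume f: "f \<in> Lspace p M"
    show "E f \<in> Lspace q N" using Em[OF f] Eint[OF f] by (simp add: Lspace_def)
    have C': "C' \<ge> 0" using C by (simp add: C'_def)
    have "ennreal (\<integral>y. norm (E f y) powr q \<partial>N) \<le> ennreal (C' * (\<integral>x. norm (f x) powr p \<partial>M) powr (q / p))"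
      using Ebound[OF f] by (subst nn_integral_eq_integral[OF Eint[OF f], symmetric]) auto
    then have "(\<integral>y. norm (E f y) powr q \<partial>N) \<le> C' * (\<integral>x. norm (f x) powr p \<partial>M) powr (q / p)"
      using C' by (subst (asm) ennreal_le_iff) auto
    then have "(\<integral>y. norm (E f y) powr q \<partial>N) powr (1 / q) \<le> (C' * (\<integral>x. norm (f x) powr p \<partial>M) powr (q / p)) powr (1 / q)"
      using q0 by (intro powr_mono2) auto
    also have "\<dots> = C' powr (1 / q) * (\<integral>x. norm (f x) powr p \<partial>M) powr (1 / p)"
      using q0 C' by (simp add: powr_mult powr_powr)
    finally show "(\<integral>y. norm (E f y) powr q \<partial>N) powr (1 / q) \<le> C' powr (1 / q) * (\<integral>x. norm (f x) powr p \<partial>M) powr (1 / p)" .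
  next
    fix k f assume f: "f \<in> Lspace p M"
    have kf: "(\<lambda>x. k * f x) \<in> Lspace p M"
      using Lm[OF f] Li[OF f] by (simp add: Lspace_def norm_mult powr_mult)
    have trk: "tr n (\<lambda>x. k * f x) = (\<lambda>x. k * tr n f x)" for n by (auto simp: tr_def)
    have "AE y in N. E (\<lambda>x. k * f x) y - k * E f y = 0"
    proof (rule zero[where u = "\<lambda>n y. E (\<lambda>x. k * f x) y - T (tr n (\<lambda>x. k * f x)) y"
          and v = "\<lambda>n y. k * (E f y - T (tr n f) y)" and w = "\<lambda>_ _. 0"
          and a = "e (\<lambda>x. k * f x)" and b = "\<lambda>n. norm k powr q * e f n" and c = "\<lambda>_. 0"])
      show "E (\<lambda>x. k * f x) y - k * E f y = E (\<lambda>x. k * f x) y - T (tr n (\<lambda>x. k * f x)) y - k * (E f y - T (tr n f) y) - 0" for n y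
        unfolding trk T_cmult[OF tri[OF f]] by (simp add: algebra_simps)
      show "(\<lambda>y. E (\<lambda>x. k * f x) y - T (tr n (\<lambda>x. k * f x)) y) \<in> borel_measurable N" for n
        using Em[OF kf] Tm[OF tri[OF kf]] by simp
      show "(\<lambda>y. k * (E f y - T (tr n f) y)) \<in> borel_measurable N" for n
        using Em[OF f] Tm[OF tri[OF f]] by simp
      show "pow_int q N (\<lambda>y. E (\<lambda>x. k * f x) y - T (tr n (\<lambda>x. k * f x)) y) \<le> ennreal (e (\<lambda>x. k * f x) n)" for n
        by (rule Ele[OF kf])
      show "pow_int q N (\<lambda>y. k * (E f y - T (tr n f) y)) \<le> ennreal (norm k powr q * e f n)" for n
      proof -
        have "pow_int q N (\<lambda>y. k * (E f y - T (tr n f) y)) =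
            ennreal (norm k powr q) * pow_int q N (\<lambda>y. E f y - T (tr n f) y)"
          using Em[OF f] Tm[OF tri[OF f, of n]] by (simp add: norm_mult powr_mult ennreal_mult nn_integral_cmult)
        also have "\<dots> \<le> ennreal (norm k powr q) * ennreal (e f n)" by (intro mult_left_mono Ele f) simp
        finally show ?thesis using e0 by (simp add: ennreal_mult)
      qed
      show "e (\<lambda>x. k * f x) \<longlonglongrightarrow> 0" by (rule e_lim[OF kf])
      show "(\<lambda>n. norm k powr q * e f n) \<longlonglongrightarrow> 0" using tendsto_mult[OF tendsto_const e_lim[OF f], of "norm k powr q"] by simp
    qed auto
    then show "AE y in N. E (\<lambda>x. k * f x) y = k * E f y" by simp
  next
    fix f g assume f: "f \<in> Lspace p M" and g: "g \<in> Lspace p M"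
    have fg: "(\<lambda>x. f x + g x) \<in> Lspace p M"
    proof -
      have [measurable]: "f \<in> borel_measurable M" "g \<in> borel_measurable M" using Lm f g by auto
      have "integrable M (\<lambda>x. norm (f x + g x) powr p)"
      proof (rule Bochner_Integration.integrable_bound)
        show "integrable M (\<lambda>x. 3 powr p * (norm (f x) powr p + norm (g x) powr p + 0 powr p))"
          using Li[OF f] Li[OF g] by simp
        have "norm (f x + g x) powr p \<le> 3 powr p * (norm (f x) powr p + norm (g x) powr p + 0 powr p)" for x
        proof -
          have "norm (f x + g x) powr p \<le> (norm (f x) + norm (g x) + 0) powr p"
            using p norm_triangle_ineq[of "f x" "g x"] by (intro powr_mono2) auto
          also have "\<dots> \<le> 3 powr p * (norm (f x) powr p + norm (g x) powr p + 0 powr p)"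
            using p by (intro add3_powr_le) auto
          finally show ?thesis .
        qed
        then show "AE x in M. norm (norm (f x + g x) powr p) \<le> norm (3 powr p * (norm (f x) powr p + norm (g x) powr p + 0 powr p))"
          by simp
      qed measurable
      then show ?thesis by (simp add: Lspace_def)
    qed
    have tra: "tr n (\<lambda>x. f x + g x) = (\<lambda>x. tr n f x + tr n g x)" for n by (auto simp: tr_def)
    have "AE y in N. E (\<lambda>x. f x + g x) y - E f y - E g y = 0"
    proof (rule zero[where u = "\<lambda>n y. E (\<lambda>x. f x + g x) y - T (tr n (\<lambda>x. f x + g x)) y"
          and v = "\<lambda>n y. E f y - T (tr n f) y" and w = "\<lambda>n y. E g y - T (tr n g) y"
          and a = "e (\<lambda>x. f x + g x)" and b = "e f" and c = "e g"])
      show "E (\<lambda>x. f x + g x) y - E f y - E g y = E (\<lambda>x. f x + g x) y - T (tr n (\<lambda>x. f x + g x)) y - (E f y - T (tr n f) y) - (E g y - T (tr n g) y)" for n y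
        unfolding tra T_add[OF tri[OF f] tri[OF g]] by simp
      show "(\<lambda>y. E (\<lambda>x. f x + g x) y - T (tr n (\<lambda>x. f x + g x)) y) \<in> borel_measurable N" for n
        using Em[OF fg] Tm[OF tri[OF fg]] by simp
      show "(\<lambda>y. E f y - T (tr n f) y) \<in> borel_measurable N" for n
        using Em[OF f] Tm[OF tri[OF f]] by simp
      show "(\<lambda>y. E g y - T (tr n g) y) \<in> borel_measurable N" for n
        using Em[OF g] Tm[OF tri[OF g]] by simp
    qed (rule Ele e_lim fg f g)+
    then show "AE y in N. E (\<lambda>x. f x + g x) y = E f y + E g y" by (simp add: algebra_simps)
  next
    fix f assume f: "f \<in> Lspace p M" and i: "integrable M f"
    have "AE y in N. E f y - T f y = 0"
    proof (rule zero[where u = "\<lambda>n y. E f y - T (tr n f) y" and v = "\<lambda>n y. T (\<lambda>x. f x - tr n f x) y" and w = "\<lambda>_ _. 0"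
          and a = "e f" and b = "e f" and c = "\<lambda>_. 0"])
      show "E f y - T f y = E f y - T (tr n f) y - T (\<lambda>x. f x - tr n f x) y - 0" for n y
        unfolding T_diff[OF i tri[OF f]] by simp
      show "(\<lambda>y. E f y - T (tr n f) y) \<in> borel_measurable N" for n
        using Em[OF f] Tm[OF tri[OF f]] by simp
      show "T (\<lambda>x. f x - tr n f x) \<in> borel_measurable N" for n
        using i tri[OF f, of n] by (intro Tm) simp
      show "pow_int q N (T (\<lambda>x. f x - tr n f x)) \<le> ennreal (e f n)" for n
        unfolding e_def using i tri[OF f, of n] by (intro HY \<tau>0) (simp_all add: \<tau>nn[OF f])
    qed (use Ele[OF f] e_lim[OF f] in auto)
    then show "AE y in N. E f y = T f y" by simp
  qed
qed

end

section \<open>Reduction to Borel functions and to the Hankel transform\<close>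

text \<open>
  Completeness of Lebesgue measure supplies the measurability that the lemmas on almost everywhere equal integrands
  assume.
\<close>

lemma borel_measurable_lebesgue_on_AE:
  fixes g :: "real \<Rightarrow> 'b::euclidean_space"
  assumes S: "S \<in> sets lebesgue" and g': "g' \<in> borel_measurable (lebesgue_on S)"
    and eq: "AE x in lebesgue_on S. g x = g' x"
  shows "g \<in> borel_measurable (lebesgue_on S)"
proof (rule borel_measurable_if_D, rule borel_measurable_AE)
  show "(\<lambda>x. if x \<in> S then g' x else 0) \<in> borel_measurable lebesgue"
    by (rule borel_measurable_if_I[OF g' S])
  have "AE x in lebesgue. x \<in> S \<longrightarrow> g x = g' x"
    using eq S by (subst (asm) AE_restrict_space_iff) auto
  then show "AE x in lebesgue. (if x \<in> S then g' x else 0) = (if x \<in> S then g x else 0)"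
    by eventually_elim auto
qed

lemma integral_lebesgue_on_AE_eq:
  fixes g :: "real \<Rightarrow> 'b::euclidean_space"
  assumes S[measurable]: "S \<in> sets borel" and g'[measurable]: "g' \<in> borel_measurable borel"
    and eq: "AE x in lebesgue_on S. g x = g' x"
  shows "(\<integral>x. g x \<partial>lebesgue_on S) = (\<integral>x. indicator S x *\<^sub>R g' x \<partial>lborel)"
proof -
  have S': "S \<in> sets lebesgue" using S by simp
  have g'm: "g' \<in> borel_measurable (lebesgue_on S)"
    by (intro measurable_restrict_space1 measurable_completion) simp
  have "(\<integral>x. g x \<partial>lebesgue_on S) = (\<integral>x. g' x \<partial>lebesgue_on S)"
    by (intro integral_cong_AE borel_measurable_lebesgue_on_AE[OF S' g'm eq] g'm eq)
  also have "\<dots> = (\<integral>x. indicator S x *\<^sub>R g' x \<partial>lebesgue)"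
    using S' by (subst integral_restrict_space) auto
  also have "\<dots> = (\<integral>x. indicator S x *\<^sub>R g' x \<partial>lborel)"
    by (rule integral_completion) measurable
  finally show ?thesis .
qed

lemma sigma_finite_lebesgue: "sigma_finite_measure (lebesgue :: real measure)"
proof -
  obtain A :: "real set set" where "countable A" "A \<subseteq> sets lborel" "\<Union>A = space lborel" "\<forall>a\<in>A. emeasure lborel a \<noteq> \<infinity>"
    using sigma_finite_lborel unfolding sigma_finite_measure_def by metis
  then show ?thesis unfolding sigma_finite_measure_def
    by (intro exI[of _ A]) auto
qed

text \<open>
  The oscillating factor of the kernel; multiplication by it is an isometry of all \<open>L\<^sup>p\<close> spaces.
\<close>

definition chirp :: "real \<Rightarrow> real \<Rightarrow> complex" where
  "chirp r y = exp (\<i> / 2 * of_real (r * y\<^sup>2))"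

lemma chirp_measurable[measurable]: "chirp r \<in> borel_measurable borel"
  unfolding chirp_def[abs_def] by (intro borel_measurable_continuous_onI continuous_intros)

lemma norm_chirp[simp]: "norm (chirp r y) = 1"
proof -
  have "\<i> / 2 * complex_of_real (r * y\<^sup>2) = \<i> * complex_of_real (r * y\<^sup>2 / 2)" by simp
  then show ?thesis unfolding chirp_def by (simp only: norm_exp_i_times)
qed

lemma chirp_nonzero[simp]: "chirp r y \<noteq> 0" by (simp add: chirp_def)

lemma chirp_inverse: "exp (- (\<i> / 2) * of_real (r * y\<^sup>2)) = 1 / chirp r y"
  by (simp add: chirp_def exp_minus inverse_eq_divide)

context bessel_order
begin

lemma sets_bessel_measure: "sets \<beta> = sets (lebesgue_on {0..})"
  and space_bessel_measure: "space \<beta> = {0..}"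
  by (simp_all add: bessel_measure_def)

lemma measurable_bessel_measure: "measurable \<beta> N = measurable (lebesgue_on {0..}) N"
  by (rule measurable_cong_sets) (simp_all add: sets_bessel_measure)

lemma borel_measurable_bessel_measure:
  "f \<in> measurable borel N \<Longrightarrow> f \<in> measurable \<beta> N"
  unfolding measurable_bessel_measure by (intro measurable_restrict_space1 measurable_completion) simp

text \<open>
  The density vanishes at the origin only.
\<close>

lemma AE_bessel_measure_lebesgue:
  "(AE x in \<beta>. P x) \<longleftrightarrow> (AE x in lebesgue_on {0..}. P x)"
proof -
  have n: "AE x in lebesgue_on {0..}. x \<noteq> (0::real)"
    using AE_lborel_singleton[of "0::real"]
    by (subst AE_restrict_space_iff) (auto simp: AE_completion_iff elim!: eventually_mono)
  have w: "(\<lambda>y. ennreal (y powr (2 * \<nu> + 1))) \<in> borel_measurable (lebesgue_on {0..})"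
    by (intro measurable_restrict_space1 measurable_completion) simp
  have "(AE x in \<beta>. P x) \<longleftrightarrow> (AE x in lebesgue_on {0..}. 0 < ennreal (x powr (2 * \<nu> + 1)) \<longrightarrow> P x)"
    unfolding bessel_measure_def by (rule AE_density[OF w])
  also have "\<dots> \<longleftrightarrow> (AE x in lebesgue_on {0..}. P x)"
    using n by (intro eventually_subst) (auto elim!: eventually_mono)
  finally show ?thesis .
qed

lemma AE_bessel_measure_radial:
  "(AE x in \<beta>. P x) \<longleftrightarrow> (AE x in \<rho>. P x)"
proof -
  have "(AE x in \<beta>. P x) \<longleftrightarrow> (AE x in lborel. x \<in> {0..} \<longrightarrow> P x)"
    unfolding AE_bessel_measure_lebesgue by (subst AE_restrict_space_iff) (auto simp: AE_completion_iff)
  also have "\<dots> \<longleftrightarrow> (AE x in lborel. 0 < ennreal (indicator {0<..} x * x powr (2 * \<nu> + 1)) \<longrightarrow> P x)"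
    using AE_lborel_singleton[of "0::real"]
    by (intro eventually_subst) (auto elim!: eventually_mono split: split_indicator)
  also have "\<dots> \<longleftrightarrow> (AE x in \<rho>. P x)"
    unfolding radial_measure_def by (subst AE_density) auto
  finally show ?thesis .
qed

lemma sigma_finite_bessel_measure: "sigma_finite_measure \<beta>"
proof -
  have s: "sigma_finite_measure (lebesgue_on {0::real..})"
    by (intro sigma_finite_measure_restrict_space sigma_finite_lebesgue) auto
  have w: "(\<lambda>y. ennreal (y powr (2 * \<nu> + 1))) \<in> borel_measurable (lebesgue_on {0..})"
    by (intro measurable_restrict_space1 measurable_completion) simp
  show ?thesis unfolding bessel_measure_def
    using sigma_finite_measure.sigma_finite_iff_density_finite[OF s w] by simp
qed

text \<open>
  Integrals of Borel functions for the completed and for the Borel measure agree, because the second measure is the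
  image of the first under the identity map.
\<close>

lemma distr_bessel_measure: "distr \<beta> borel (\<lambda>x. x) = \<rho>"
proof (rule measure_eqI)
  fix B assume "B \<in> sets (distr \<beta> borel (\<lambda>x. x))"
  then have B[measurable]: "B \<in> sets borel" by simp
  have w: "(\<lambda>y. ennreal (y powr (2 * \<nu> + 1))) \<in> borel_measurable (lebesgue_on {0..})"
    by (intro measurable_restrict_space1 measurable_completion) simp
  have B': "B \<inter> {0..} \<in> sets (lebesgue_on {0..})" by (subst sets_restrict_space_iff) auto
  have "emeasure (distr \<beta> borel (\<lambda>x. x)) B = emeasure \<beta> (B \<inter> {0..})"
    by (subst emeasure_distr) (auto simp: space_bessel_measure intro!: borel_measurable_bessel_measure)
  also have "\<dots> = (\<integral>\<^sup>+y. ennreal (y powr (2 * \<nu> + 1)) * indicator (B \<inter> {0..}) y \<partial>lebesgue_on {0..})"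
    unfolding bessel_measure_def by (rule emeasure_density[OF w B'])
  also have "\<dots> = (\<integral>\<^sup>+y. ennreal (y powr (2 * \<nu> + 1)) * indicator (B \<inter> {0..}) y * indicator {0..} y \<partial>lborel)"
    by (subst nn_integral_restrict_space) (auto simp: nn_integral_completion)
  also have "\<dots> = (\<integral>\<^sup>+y. ennreal (indicator {0<..} y * y powr (2 * \<nu> + 1)) * indicator B y \<partial>lborel)"
    by (rule nn_integral_cong_AE, use AE_lborel_singleton[of "0::real"] in eventually_elim) (auto split: split_indicator)
  also have "\<dots> = emeasure \<rho> B"
    unfolding radial_measure_def by (rule emeasure_density[symmetric]) auto
  finally show "emeasure (distr \<beta> borel (\<lambda>x. x)) B = emeasure \<rho> B" .
qed simp

lemma bessel_measure_borel_version:
  fixes f :: "real \<Rightarrow> complex"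
  assumes F[measurable]: "F \<in> borel_measurable borel" and eq: "AE x in \<beta>. f x = F x"
  shows borel_version_measurable: "f \<in> borel_measurable \<beta>"
    and borel_version_integral: "(\<integral>x. f x \<partial>\<beta>) = (\<integral>x. F x \<partial>\<rho>)"
    and borel_version_integrable: "integrable \<beta> f \<longleftrightarrow> integrable \<rho> F"
proof -
  have Fm: "F \<in> borel_measurable \<beta>" by (rule borel_measurable_bessel_measure) simp
  have id: "(\<lambda>x. x) \<in> measurable \<beta> borel" by (rule borel_measurable_bessel_measure) simp
  show f: "f \<in> borel_measurable \<beta>"
    unfolding measurable_bessel_measure
    by (rule borel_measurable_lebesgue_on_AE[of _ F])
       (use Fm eq in \<open>auto simp: measurable_bessel_measure AE_bessel_measure_lebesgue\<close>)
  have "(\<integral>x. f x \<partial>\<beta>) = (\<integral>x. F x \<partial>\<beta>)"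
    by (rule integral_cong_AE[OF f Fm eq])
  also have "\<dots> = (\<integral>x. F x \<partial>\<rho>)"
    unfolding distr_bessel_measure[symmetric] using id by (simp add: integral_distr)
  finally show "(\<integral>x. f x \<partial>\<beta>) = (\<integral>x. F x \<partial>\<rho>)" .
  have "integrable \<beta> f \<longleftrightarrow> integrable \<beta> F"
    by (rule integrable_cong_AE[OF f Fm eq])
  also have "\<dots> \<longleftrightarrow> integrable \<rho> F"
    unfolding distr_bessel_measure[symmetric] using id by (simp add: integrable_distr_eq)
  finally show "integrable \<beta> f \<longleftrightarrow> integrable \<rho> F" .
qed

lemma nn_integral_bessel_borel_version:
  assumes U[measurable]: "U \<in> borel_measurable borel" and eq: "AE x in \<beta>. u x = U x"
  shows "(\<integral>\<^sup>+x. u x \<partial>\<beta>) = (\<integral>\<^sup>+x. U x \<partial>\<rho>)"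
proof -
  have id: "(\<lambda>x. x) \<in> measurable \<beta> borel" by (rule borel_measurable_bessel_measure) simp
  have "(\<integral>\<^sup>+x. u x \<partial>\<beta>) = (\<integral>\<^sup>+x. U x \<partial>\<beta>)" by (rule nn_integral_cong_AE[OF eq])
  also have "\<dots> = (\<integral>\<^sup>+x. U x \<partial>\<rho>)"
    unfolding distr_bessel_measure[symmetric] using id by (simp add: nn_integral_distr)
  finally show ?thesis .
qed

lemma borel_version_exists:
  fixes f :: "real \<Rightarrow> complex"
  assumes "f \<in> borel_measurable \<beta>"
  obtains F where "F \<in> borel_measurable borel" "AE x in \<beta>. f x = F x"
proof -
  let ?f = "\<lambda>x. if x \<in> {0..} then f x else 0"
  have fm: "?f \<in> borel_measurable lebesgue"
    using assms by (intro borel_measurable_if_I) (auto simp: measurable_bessel_measure)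
  obtain R I :: "real \<Rightarrow> real" where R: "R \<in> borel_measurable lborel" "AE x in lborel. Re (?f x) = R x"
    and I: "I \<in> borel_measurable lborel" "AE x in lborel. Im (?f x) = I x"
    using completion_ex_borel_measurable_real[of "\<lambda>x. Re (?f x)" lborel]
      completion_ex_borel_measurable_real[of "\<lambda>x. Im (?f x)" lborel] fm by auto
  show ?thesis
  proof (rule that[of "\<lambda>x. Complex (R x) (I x)"])
    have "(\<lambda>x. Complex (R x) (I x)) = (\<lambda>x. of_real (R x) + \<i> * of_real (I x))"
      by (auto simp: complex_eq_iff)
    then show "(\<lambda>x. Complex (R x) (I x)) \<in> borel_measurable borel" using R(1) I(1) by simp
    have "AE x in lborel. x \<in> {0..} \<longrightarrow> f x = Complex (R x) (I x)"
      using R(2) I(2) by eventually_elim (auto simp: complex_eq_iff)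
    then show "AE x in \<beta>. f x = Complex (R x) (I x)"
      unfolding AE_bessel_measure_lebesgue by (subst AE_restrict_space_iff) (auto simp: AE_completion_iff)
  qed
qed

lemma Lp_eq_Lspace: "Lp p \<nu> = Lspace p \<beta>"
  by (simp add: Lp_def Lspace_def)

lemma Lp_measurable: "f \<in> Lp p \<nu> \<Longrightarrow> f \<in> borel_measurable \<beta>"
  by (simp add: Lp_def)

lemma Lp_1_iff: "f \<in> Lp 1 \<nu> \<longleftrightarrow> integrable \<beta> f"
  by (auto simp: Lp_def integrable_norm_iff)

text \<open>
  Changes of \<open>f\<close> on a set of angles of measure zero do not affect the integral.
\<close>

lemma bessel_translation_eq:
  assumes F[measurable]: "F \<in> borel_measurable borel"
    and eq: "AE \<theta> in \<alpha>. f (side x y \<theta>) = F (side x y \<theta>)"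
  shows "bessel_translation \<nu> x f y = translate F x y"
proof -
  have "AE \<theta> in lborel. 0 < ennreal (indicator {0<..<pi} \<theta> * (angle_const \<nu> * sin \<theta> powr (2 * \<nu>))) \<longrightarrow> f (side x y \<theta>) = F (side x y \<theta>)"
    using eq unfolding angle_measure_def by (subst (asm) AE_density) auto
  then have "AE \<theta> in lborel. \<theta> \<in> {0..pi} \<longrightarrow> f (side x y \<theta>) = F (side x y \<theta>)"
    using AE_lborel_singleton[of "0::real"] AE_lborel_singleton[of pi]
  proof eventually_elim
    case (elim \<theta>)
    show ?case
    proof
      assume "\<theta> \<in> {0..pi}"
      then have t: "\<theta> \<in> {0<..<pi}" using elim by auto
      then have "sin \<theta> > 0" by (simp add: sin_gt_zero)
      then show "f (side x y \<theta>) = F (side x y \<theta>)"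
        using elim t angle_const_pos by (simp add: ennreal_zero_less_mult_iff)
    qed
  qed
  then have ae: "AE \<theta> in lebesgue_on {0..pi}. f (side x y \<theta>) * of_real (sin \<theta> powr (2 * \<nu>)) = F (side x y \<theta>) * of_real (sin \<theta> powr (2 * \<nu>))"
    by (subst AE_restrict_space_iff) (auto simp: AE_completion_iff elim!: eventually_mono)
  have "(\<integral>\<theta>. f (side x y \<theta>) * of_real (sin \<theta> powr (2 * \<nu>)) \<partial>lebesgue_on {0..pi}) =
      (\<integral>\<theta>. indicator {0..pi} \<theta> *\<^sub>R (F (side x y \<theta>) * of_real (sin \<theta> powr (2 * \<nu>))) \<partial>lborel)"
    by (rule integral_lebesgue_on_AE_eq[OF _ _ ae]) measurable
  then have "bessel_translation \<nu> x f y = of_real (angle_const \<nu>) * (\<integral>\<theta>. indicator {0..pi} \<theta> *\<^sub>R (F (side x y \<theta>) * of_real (sin \<theta> powr (2 * \<nu>))) \<partial>lborel)"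
    by (simp add: bessel_translation_def angle_const_def side_def)
  also have "\<dots> = (\<integral>\<theta>. of_real (angle_const \<nu>) * (indicator {0..pi} \<theta> *\<^sub>R (F (side x y \<theta>) * of_real (sin \<theta> powr (2 * \<nu>)))) \<partial>lborel)"
    by (rule Bochner_Integration.integral_mult_right_zero[symmetric])
  also have "\<dots> = (\<integral>\<theta>. (indicator {0<..<pi} \<theta> * (angle_const \<nu> * sin \<theta> powr (2 * \<nu>))) *\<^sub>R F (side x y \<theta>) \<partial>lborel)"
  proof (rule integral_cong_AE)
    show "AE \<theta> in lborel. of_real (angle_const \<nu>) * (indicator {0..pi} \<theta> *\<^sub>R (F (side x y \<theta>) * of_real (sin \<theta> powr (2 * \<nu>)))) =
        (indicator {0<..<pi} \<theta> * (angle_const \<nu> * sin \<theta> powr (2 * \<nu>))) *\<^sub>R F (side x y \<theta>)"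
      using AE_lborel_singleton[of "0::real"] AE_lborel_singleton[of pi]
      by eventually_elim (auto split: split_indicator simp: scaleR_conv_of_real)
  qed measurable
  also have "\<dots> = (\<integral>\<theta>. F (side x y \<theta>) \<partial>\<alpha>)"
    unfolding angle_measure_def using angle_const_pos
    by (subst integral_density) auto
  finally show ?thesis by (simp add: translate_def)
qed

text \<open>
  For fixed \<open>x\<close> a null set is met by the third side for almost no pair \<open>(y, \<theta>)\<close>, by translation invariance applied to
  its indicator function. The assertion holds for every \<open>x\<close>, which keeps the convolution well defined at every point.
\<close>

lemma AE_side:
  assumes eq: "AE s in \<beta>. f s = F s"
  shows "AE y in \<beta>. AE \<theta> in \<alpha>. f (side x y \<theta>) = F (side x y \<theta>)"
proof -
  obtain N where N: "{s. f s \<noteq> F s} \<subseteq> N" "N \<in> null_sets \<rho>"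
    using eq unfolding AE_bessel_measure_radial by (auto elim!: AE_E simp: null_sets_def)
  have [measurable]: "N \<in> sets borel" using N(2) by (auto simp: null_sets_def)
  have "(\<integral>\<^sup>+y. \<integral>\<^sup>+\<theta>. indicator N (side x y \<theta>) \<partial>\<alpha> \<partial>\<rho>) = (\<integral>\<^sup>+y. indicator N y \<partial>\<rho>)"
    unfolding side_commute[of x] by (rule nn_integral_translate_invariant) measurable
  also have "\<dots> = 0" using N(2) by (simp add: null_sets_def)
  finally have "AE y in \<rho>. (\<integral>\<^sup>+\<theta>. indicator N (side x y \<theta>) \<partial>\<alpha>) = 0"
    by (subst (asm) nn_integral_0_iff_AE) auto
  then have "AE y in \<rho>. AE \<theta> in \<alpha>. f (side x y \<theta>) = F (side x y \<theta>)"
  proof eventually_elim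
    case (elim y)
    then have "AE \<theta> in \<alpha>. indicator N (side x y \<theta>) = (0::ennreal)"
      by (subst (asm) nn_integral_0_iff_AE) auto
    then show ?case by eventually_elim (use N(1) in \<open>auto split: split_indicator_asm\<close>)
  qed
  then show ?thesis unfolding AE_bessel_measure_radial .
qed

context
  fixes m :: "real^2^2" and a b c d :: real
  assumes m: "m = vector [vector [a, b], vector [c, d]]" and b: "b \<noteq> 0"
begin

lemma m_entries: "m$1$1 = a" "m$1$2 = b" "m$2$1 = c" "m$2$2 = d"
  using m by simp_all

text \<open>
  The chirps in \<open>y\<close> cancel up to the one that belongs to \<open>G\<close>, and the chirp in \<open>x\<close> comes out of the integral.
\<close>

lemma convolution_inv_eq:
  assumes F[measurable]: "F \<in> borel_measurable borel" and fF: "AE y in \<beta>. chirp (a / b) y * f y = F y"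
    and G[measurable]: "G \<in> borel_measurable borel" and gG: "AE y in \<beta>. chirp (a / b) y * g y = G y"
  shows "convolution_inv \<nu> m f g x = bessel_conv F G x / chirp (a / b) x"
proof -
  have "convolution_inv \<nu> m f g x = (\<integral>y. 1 / chirp (a / b) x * (translate F x y * G y) \<partial>\<rho>)"
    unfolding convolution_inv_def
  proof (rule borel_version_integral)
    show "(\<lambda>y. 1 / chirp (a / b) x * (translate F x y * G y)) \<in> borel_measurable borel"
      using nu by measurable
    show "AE y in \<beta>. translation_inv \<nu> m x f y * (exp (\<i> * of_real (m$1$1 / m$1$2 * y\<^sup>2)) * g y) =
        1 / chirp (a / b) x * (translate F x y * G y)"
      using AE_side[OF fF, of x] gG
    proof eventually_elim
      case (elim y)
      have t: "bessel_translation \<nu> x (\<lambda>s. exp (\<i> / 2 * of_real (a / b * s\<^sup>2)) * f s) y = translate F x y"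
        using bessel_translation_eq[OF F elim(1)] by (simp only: chirp_def)
      have e1: "exp (- (\<i> / 2) * of_real (a / b * (x\<^sup>2 + y\<^sup>2))) = 1 / chirp (a / b) x * (1 / chirp (a / b) y)"
        unfolding chirp_inverse[symmetric] exp_add[symmetric] by (simp add: algebra_simps add_divide_distrib)
      have e2: "exp (\<i> * of_real (a / b * y\<^sup>2)) = chirp (a / b) y * chirp (a / b) y"
        unfolding chirp_def exp_add[symmetric] by simp
      show ?case
        unfolding translation_inv_def m_entries t e1 e2 elim(2)[symmetric] by simp
    qed
  qed
  then show ?thesis by (simp add: bessel_conv_def)
qed

lemma cfb_transform_eq:
  assumes F[measurable]: "F \<in> borel_measurable borel" and fF: "AE y in \<beta>. chirp (a / b) y * f y = F y"
  shows "cfb_transform \<nu> m f x = cfb_factor \<nu> m * chirp (d / b) x * hankel F (x / b)"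
proof -
  have "(\<integral>y. kernel_K \<nu> m x y * f y \<partial>\<beta>) = (\<integral>y. chirp (d / b) x * (of_real (bessel_j \<nu> (x / b * y)) * F y) \<partial>\<rho>)"
  proof (rule borel_version_integral)
    show "AE y in \<beta>. kernel_K \<nu> m x y * f y = chirp (d / b) x * (of_real (bessel_j \<nu> (x / b * y)) * F y)"
      using fF
    proof eventually_elim
      case (elim y)
      have "exp (\<i> / 2 * of_real (d / b * x\<^sup>2 + a / b * y\<^sup>2)) = chirp (d / b) x * chirp (a / b) y"
        unfolding chirp_def exp_add[symmetric] by (simp add: algebra_simps add_divide_distrib)
      then show ?case unfolding kernel_K_def m_entries elim[symmetric] by simp
    qed
  qed measurable
  then show ?thesis by (simp add: cfb_transform_def hankel_def)
qed

lemma chirped_borel_version: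
  assumes "f \<in> borel_measurable \<beta>"
  obtains F where "F \<in> borel_measurable borel" "AE y in \<beta>. chirp (a / b) y * f y = F y"
proof -
  have "chirp (a / b) \<in> borel_measurable \<beta>" by (rule borel_measurable_bessel_measure) simp
  then have "(\<lambda>y. chirp (a / b) y * f y) \<in> borel_measurable \<beta>" using assms by simp
  then show ?thesis using borel_version_exists that by blast
qed

lemma chirped_integrable:
  assumes F[measurable]: "F \<in> borel_measurable borel" and fF: "AE y in \<beta>. chirp (a / b) y * f y = F y"
    and f: "integrable \<beta> f"
  shows "integrable \<rho> F"
proof -
  have cm: "chirp (a / b) \<in> borel_measurable \<beta>" by (rule borel_measurable_bessel_measure) simp
  have "integrable \<beta> (\<lambda>y. chirp (a / b) y * f y)"
    using f cm by (intro Bochner_Integration.integrable_bound[OF f]) (auto simp: norm_mult)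
  then show ?thesis using borel_version_integrable[OF F fF] by simp
qed

lemma nn_integral_chirped:
  assumes F[measurable]: "F \<in> borel_measurable borel" and fF: "AE y in \<beta>. chirp (a / b) y * f y = F y"
    and u[measurable]: "u \<in> borel_measurable borel"
  shows "(\<integral>\<^sup>+y. u (norm (f y)) \<partial>\<beta>) = (\<integral>\<^sup>+y. u (norm (F y)) \<partial>\<rho>)"
proof (rule nn_integral_bessel_borel_version)
  show "AE y in \<beta>. u (norm (f y)) = u (norm (F y))"
    using fF
  proof eventually_elim
    case (elim y)
    have "norm (F y) = norm (f y)" unfolding elim[symmetric] by (simp add: norm_mult)
    then show ?case by simp
  qed
qed measurable

lemma convolution_theorem_L1:
  assumes f: "f \<in> Lp 1 \<nu>" and g: "g \<in> Lp 1 \<nu>"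
  shows "cfb_factor \<nu> m * cfb_transform \<nu> m (convolution_inv \<nu> m f g) x =
      cfb_transform \<nu> m f x * cfb_transform \<nu> m g x / chirp (d / b) x"
    and "convolution_inv \<nu> m f g \<in> Lp 1 \<nu>"
proof -
  obtain F where F[measurable]: "F \<in> borel_measurable borel" and fF: "AE y in \<beta>. chirp (a / b) y * f y = F y"
    by (rule chirped_borel_version[OF Lp_measurable[OF f]])
  obtain G where G[measurable]: "G \<in> borel_measurable borel" and gG: "AE y in \<beta>. chirp (a / b) y * g y = G y"
    by (rule chirped_borel_version[OF Lp_measurable[OF g]])
  have Fi: "integrable \<rho> F" using chirped_integrable[OF F fF] f by (simp add: Lp_1_iff)
  have Gi: "integrable \<rho> G" using chirped_integrable[OF G gG] g by (simp add: Lp_1_iff)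
  let ?H = "bessel_conv F G"
  have Hm[measurable]: "?H \<in> borel_measurable borel" by (rule bessel_conv_measurable[OF F G])
  have ceq: "convolution_inv \<nu> m f g x = ?H x / chirp (a / b) x" for x
    by (rule convolution_inv_eq[OF F fF G gG])
  then have HH: "AE y in \<beta>. chirp (a / b) y * convolution_inv \<nu> m f g y = ?H y" by simp
  show "cfb_factor \<nu> m * cfb_transform \<nu> m (convolution_inv \<nu> m f g) x =
      cfb_transform \<nu> m f x * cfb_transform \<nu> m g x / chirp (d / b) x"
    unfolding cfb_transform_eq[OF F fF] cfb_transform_eq[OF G gG] cfb_transform_eq[OF Hm HH]
      hankel_bessel_conv[OF Fi Gi] by simp
  have Hi: "integrable \<rho> ?H" by (rule integrable_bessel_conv[OF Fi Gi])
  have "integrable \<rho> (\<lambda>x. ?H x / chirp (a / b) x)"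
    by (rule Bochner_Integration.integrable_bound[OF Hi]) (auto simp: norm_divide)
  then show "convolution_inv \<nu> m f g \<in> Lp 1 \<nu>"
    unfolding Lp_1_iff by (subst borel_version_integrable[of "\<lambda>x. ?H x / chirp (a / b) x"]) (auto simp: ceq)
qed

lemma convolution_inv_Lp:
  assumes f: "f \<in> Lp 1 \<nu>" and p: "p > 1"
  obtains C where "C > 0"
    "\<And>g. g \<in> Lp p \<nu> \<Longrightarrow> convolution_inv \<nu> m f g \<in> Lp p \<nu>"
    "\<And>g. g \<in> Lp p \<nu> \<Longrightarrow> (\<integral>x. norm (convolution_inv \<nu> m f g x) powr p \<partial>\<beta>) \<le> C * (\<integral>x. norm (g x) powr p \<partial>\<beta>)"
    "\<And>g h. g \<in> Lp p \<nu> \<Longrightarrow> h \<in> Lp p \<nu> \<Longrightarrow>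
       AE x in \<beta>. convolution_inv \<nu> m f (\<lambda>y. g y + h y) x = convolution_inv \<nu> m f g x + convolution_inv \<nu> m f h x"
proof -
  let ?B = "\<beta>" and ?R = "\<rho>"
  obtain F where F[measurable]: "F \<in> borel_measurable borel" and fF: "AE y in ?B. chirp (a / b) y * f y = F y"
    by (rule chirped_borel_version[OF Lp_measurable[OF f]])
  have Fi: "integrable ?R F" using chirped_integrable[OF F fF] f by (simp add: Lp_1_iff)
  obtain C where C: "C > 0" and bd: "\<And>G. G \<in> borel_measurable borel \<Longrightarrow>
      pow_int p ?R (bessel_conv F G) \<le> ennreal C * pow_int p ?R G"
    and int: "\<And>G. G \<in> borel_measurable borel \<Longrightarrow> pow_int p ?R G < \<infinity> \<Longrightarrow>
       AE x in ?R. integrable ?R (\<lambda>y. translate F x y * G y)"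
    using bessel_conv_Lp[OF Fi p] by blast
  have nnLp: "pow_int p ?B g = ennreal (\<integral>x. norm (g x) powr p \<partial>?B)" if "g \<in> Lp p \<nu>" for g
    using that by (intro nn_integral_eq_integral) (auto simp: Lp_def)
  have main: "convolution_inv \<nu> m f g \<in> Lp p \<nu> \<and> (\<integral>x. norm (convolution_inv \<nu> m f g x) powr p \<partial>?B) \<le> C * (\<integral>x. norm (g x) powr p \<partial>?B)"
    if g: "g \<in> Lp p \<nu>" for g
  proof -
    obtain G where G[measurable]: "G \<in> borel_measurable borel" and gG: "AE y in ?B. chirp (a / b) y * g y = G y"
      by (rule chirped_borel_version[OF Lp_measurable[OF g]])
    let ?H = "bessel_conv F G" and ?c = "convolution_inv \<nu> m f g"
    have Hm[measurable]: "?H \<in> borel_measurable borel" by (rule bessel_conv_measurable[OF F G])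
    have ceq: "?c x = ?H x / chirp (a / b) x" for x by (rule convolution_inv_eq[OF F fF G gG])
    have HH: "AE y in ?B. chirp (a / b) y * ?c y = ?H y" using ceq by simp
    have cm: "?c \<in> borel_measurable ?B"
      by (rule borel_version_measurable[of "\<lambda>x. ?H x / chirp (a / b) x"]) (auto simp: ceq)
    have le: "pow_int p ?B ?c \<le> ennreal (C * (\<integral>x. norm (g x) powr p \<partial>?B))"
    proof -
      have "pow_int p ?B ?c = pow_int p ?R ?H"
        by (rule nn_integral_chirped[OF Hm HH, of "\<lambda>s. ennreal (s powr p)"]) measurable
      also have "\<dots> \<le> ennreal C * pow_int p ?R G" by (rule bd[OF G])
      also have "pow_int p ?R G = pow_int p ?B g"
        by (rule nn_integral_chirped[OF G gG, of "\<lambda>s. ennreal (s powr p)", symmetric]) measurable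
      finally show ?thesis using C by (simp add: nnLp[OF g] ennreal_mult)
    qed
    have ci: "integrable ?B (\<lambda>x. norm (?c x) powr p)"
      using cm le by (intro integrableI_bounded) (auto simp: top_unique less_top[symmetric])
    have cL: "?c \<in> Lp p \<nu>" using cm ci by (simp add: Lp_def)
    have "0 \<le> C * (\<integral>x. norm (g x) powr p \<partial>?B)" using C by simp
    then show ?thesis using le cL unfolding nnLp[OF cL] by (subst (asm) ennreal_le_iff) auto
  qed
  show ?thesis
  proof (rule that[OF C])
    fix g assume "g \<in> Lp p \<nu>"
    from main[OF this] show "convolution_inv \<nu> m f g \<in> Lp p \<nu>"
      "(\<integral>x. norm (convolution_inv \<nu> m f g x) powr p \<partial>?B) \<le> C * (\<integral>x. norm (g x) powr p \<partial>?B)" by blast+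
  next
    fix g h assume g: "g \<in> Lp p \<nu>" and h: "h \<in> Lp p \<nu>"
    obtain G where G[measurable]: "G \<in> borel_measurable borel" and gG: "AE y in ?B. chirp (a / b) y * g y = G y"
      by (rule chirped_borel_version[OF Lp_measurable[OF g]])
    obtain H where H[measurable]: "H \<in> borel_measurable borel" and hH: "AE y in ?B. chirp (a / b) y * h y = H y"
      by (rule chirped_borel_version[OF Lp_measurable[OF h]])
    have GHm: "(\<lambda>y. G y + H y) \<in> borel_measurable borel" by measurable
    have GH: "AE y in ?B. chirp (a / b) y * (g y + h y) = G y + H y"
      using gG hH by eventually_elim (simp add: algebra_simps)
    have fin: "pow_int p ?R K < \<infinity>"
      if "K \<in> borel_measurable borel" "AE y in ?B. chirp (a / b) y * k y = K y" "k \<in> Lp p \<nu>" for K k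
      by (subst nn_integral_chirped[OF that(1,2), of "\<lambda>s. ennreal (s powr p)", symmetric])
         (simp_all add: nnLp[OF that(3)])
    have "AE x in ?R. integrable ?R (\<lambda>y. translate F x y * G y)" "AE x in ?R. integrable ?R (\<lambda>y. translate F x y * H y)"
      using int[OF G fin[OF G gG g]] int[OF H fin[OF H hH h]] by auto
    then show "AE x in ?B. convolution_inv \<nu> m f (\<lambda>y. g y + h y) x = convolution_inv \<nu> m f g x + convolution_inv \<nu> m f h x"
      unfolding AE_bessel_measure_radial convolution_inv_eq[OF F fF G gG] convolution_inv_eq[OF F fF H hH] convolution_inv_eq[OF F fF GHm GH]
      by eventually_elim (simp add: bessel_conv_def distrib_left add_divide_distrib)
  qed
qed

lemma cfb_transform_measurable:
  assumes "f \<in> borel_measurable \<beta>"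
  shows "cfb_transform \<nu> m f \<in> borel_measurable \<beta>"
proof -
  obtain F where F[measurable]: "F \<in> borel_measurable borel" and fF: "AE y in \<beta>. chirp (a / b) y * f y = F y"
    by (rule chirped_borel_version[OF assms])
  have [measurable]: "hankel F \<in> borel_measurable borel" by (rule hankel_measurable[OF F])
  have "cfb_transform \<nu> m f = (\<lambda>x. cfb_factor \<nu> m * chirp (d / b) x * hankel F (x / b))"
    using cfb_transform_eq[OF F fF] by auto
  then show ?thesis by (intro borel_measurable_bessel_measure) simp
qed

text \<open>
  Chirps have modulus one, so that the endpoint bounds are those of the Hankel transform at \<open>x / b\<close>.
\<close>

lemma cfb_transform_operator:
  "\<exists>A B. L1_L2_operator \<beta> \<beta> (cfb_transform \<nu> m) A B"
proof -
  let ?B = "\<beta>" and ?R = "\<rho>" and ?k = "cfb_factor \<nu> m"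
  let ?C = "(Gamma (\<nu> + 1))\<^sup>2 / 4 * (4 / (1 / b)\<^sup>2) powr (\<nu> + 1)"
  interpret sigma_finite_measure ?B by (rule sigma_finite_bessel_measure)
  have rep: "\<exists>F. F \<in> borel_measurable borel \<and> integrable ?R F \<and> (AE y in ?B. chirp (a / b) y * f y = F y)"
    if f: "integrable ?B f" for f
  proof -
    obtain F where "F \<in> borel_measurable borel" "AE y in ?B. chirp (a / b) y * f y = F y"
      by (rule chirped_borel_version[OF borel_measurable_integrable[OF f]])
    then show ?thesis using chirped_integrable f by blast
  qed
  have int_jF: "integrable ?R (\<lambda>y. of_real (bessel_j \<nu> (t * y)) * F y)" if F: "integrable ?R F" for F :: "real \<Rightarrow> complex" and t
  proof (rule Bochner_Integration.integrable_bound[OF F])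
    have [measurable]: "F \<in> borel_measurable borel" using borel_measurable_integrable[OF F] by simp
    show "(\<lambda>y. of_real (bessel_j \<nu> (t * y)) * F y) \<in> borel_measurable ?R" by measurable
    show "AE y in ?R. norm (of_real (bessel_j \<nu> (t * y)) * F y) \<le> norm (F y)"
      using abs_bessel_j_le_1 by (simp add: norm_mult mult_left_le_one_le)
  qed
  have "L1_L2_operator ?B ?B (cfb_transform \<nu> m) (norm ?k + 1) ((norm ?k)\<^sup>2 * ?C)"
  proof (unfold_locales)
    fix f :: "real \<Rightarrow> complex" assume f: "integrable ?B f"
    then obtain F where F[measurable]: "F \<in> borel_measurable borel" and Fi: "integrable ?R F"
      and fF: "AE y in ?B. chirp (a / b) y * f y = F y" using rep by blast
    have [measurable]: "hankel F \<in> borel_measurable borel" by (rule hankel_measurable[OF F])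
    show "cfb_transform \<nu> m f \<in> borel_measurable ?B"
      using f by (intro cfb_transform_measurable) simp
    fix y
    have "norm (cfb_transform \<nu> m f y) \<le> norm ?k * (\<integral>x. norm (F x) \<partial>?R)"
      unfolding cfb_transform_eq[OF F fF] by (simp add: norm_mult mult_left_mono norm_hankel_le[OF Fi])
    also have "(\<integral>x. norm (F x) \<partial>?R) = (\<integral>x. norm (f x) \<partial>?B)"
    proof -
      have "ennreal (\<integral>x. norm (F x) \<partial>?R) = ennreal (\<integral>x. norm (f x) \<partial>?B)"
        using nn_integral_chirped[OF F fF, of ennreal] f Fi by (simp add: nn_integral_eq_integral)
      then show ?thesis by (subst (asm) ennreal_inj) auto
    qed
    also have "norm ?k * (\<integral>x. norm (f x) \<partial>?B) \<le> (norm ?k + 1) * (\<integral>x. norm (f x) \<partial>?B)"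
      by (intro mult_right_mono) auto
    finally show "norm (cfb_transform \<nu> m f y) \<le> (norm ?k + 1) * (\<integral>x. norm (f x) \<partial>?B)" .
    fix k
    have kF: "AE y in ?B. chirp (a / b) y * (k * f y) = k * F y" using fF by eventually_elim simp
    have kFm: "(\<lambda>y. k * F y) \<in> borel_measurable borel" by measurable
    show "cfb_transform \<nu> m (\<lambda>x. k * f x) y = k * cfb_transform \<nu> m f y"
      unfolding cfb_transform_eq[OF F fF] cfb_transform_eq[OF kFm kF]
      by (simp add: hankel_def mult.left_commute[of _ k])
    show "(\<integral>\<^sup>+y. ennreal ((norm (cfb_transform \<nu> m f y))\<^sup>2) \<partial>?B) \<le> ennreal ((norm ?k)\<^sup>2 * ?C) * (\<integral>\<^sup>+x. ennreal ((norm (f x))\<^sup>2) \<partial>?B)"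
    proof -
      have "(\<integral>\<^sup>+y. ennreal ((norm (cfb_transform \<nu> m f y))\<^sup>2) \<partial>?B) = (\<integral>\<^sup>+y. ennreal ((norm ?k)\<^sup>2) * ennreal ((norm (hankel F (1 / b * y)))\<^sup>2) \<partial>?R)"
        by (rule nn_integral_bessel_borel_version)
           (auto simp: cfb_transform_eq[OF F fF] norm_mult power_mult_distrib ennreal_mult)
      also have "\<dots> = ennreal ((norm ?k)\<^sup>2) * (\<integral>\<^sup>+y. ennreal ((norm (hankel F (1 / b * y)))\<^sup>2) \<partial>?R)"
        by (rule nn_integral_cmult) measurable
      also have "\<dots> \<le> ennreal ((norm ?k)\<^sup>2) * (ennreal ?C * (\<integral>\<^sup>+x. ennreal ((norm (F x))\<^sup>2) \<partial>?R))"
        using b by (intro mult_left_mono hankel_L2_bound[OF Fi]) auto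
      also have "(\<integral>\<^sup>+x. ennreal ((norm (F x))\<^sup>2) \<partial>?R) = (\<integral>\<^sup>+x. ennreal ((norm (f x))\<^sup>2) \<partial>?B)"
        by (rule nn_integral_chirped[OF F fF, of "\<lambda>s. ennreal (s\<^sup>2)", symmetric]) measurable
      finally show ?thesis by (simp only: mult.assoc ennreal_mult zero_le_power2 norm_ge_zero zero_le_mult_iff simp_thms powr_ge_zero zero_le_divide_iff zero_le_numeral)
    qed
    fix g :: "real \<Rightarrow> complex" assume "integrable ?B g"
    then obtain G where G[measurable]: "G \<in> borel_measurable borel" and Gi: "integrable ?R G"
      and gG: "AE y in ?B. chirp (a / b) y * g y = G y" using rep by blast
    have fg: "AE y in ?B. chirp (a / b) y * (f y + g y) = F y + G y"
      using fF gG by eventually_elim (simp add: algebra_simps)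
    have fgm: "(\<lambda>y. F y + G y) \<in> borel_measurable borel" by measurable
    have "hankel (\<lambda>y. F y + G y) t = hankel F t + hankel G t" for t
      unfolding hankel_def distrib_left by (rule Bochner_Integration.integral_add[OF int_jF[OF Fi] int_jF[OF Gi]])
    then show "cfb_transform \<nu> m (\<lambda>x. f x + g x) y = cfb_transform \<nu> m f y + cfb_transform \<nu> m g y"
      unfolding cfb_transform_eq[OF F fF] cfb_transform_eq[OF G gG] cfb_transform_eq[OF fgm fg] by (simp add: distrib_left)
  qed (auto simp: add_nonneg_pos)
  then show ?thesis by blast
qed

text \<open>
  The choice in the definition of the transform is not vacuous, because a bounded extension exists.
\<close>

lemma bounded_extension_cfb_transform_Lp:
  assumes p: "1 < p" "p \<le> 2"
  shows "is_bounded_extension \<nu> m p (p / (p - 1)) (cfb_transform_Lp \<nu> m p)"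
proof -
  obtain A B where "L1_L2_operator \<beta> \<beta> (cfb_transform \<nu> m) A B"
    using cfb_transform_operator by blast
  then interpret L1_L2_operator "\<beta>" "\<beta>" "cfb_transform \<nu> m" A B .
  obtain E C where E: "\<And>f. f \<in> Lp p \<nu> \<Longrightarrow> E f \<in> Lp (p / (p - 1)) \<nu>"
    "\<And>f g. f \<in> Lp p \<nu> \<Longrightarrow> g \<in> Lp p \<nu> \<Longrightarrow> AE y in \<beta>. E (\<lambda>x. f x + g x) y = E f y + E g y"
    "\<And>k f. f \<in> Lp p \<nu> \<Longrightarrow> AE y in \<beta>. E (\<lambda>x. k * f x) y = k * E f y"
    "\<And>f. f \<in> Lp p \<nu> \<Longrightarrow> Lp_norm (p / (p - 1)) \<nu> (E f) \<le> C * Lp_norm p \<nu> f"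
    "\<And>f. f \<in> Lp p \<nu> \<Longrightarrow> integrable \<beta> f \<Longrightarrow> AE y in \<beta>. E f y = cfb_transform \<nu> m f y"
    using hausdorff_young_extension[OF p refl] unfolding Lp_eq_Lspace Lp_norm_def by blast
  have "is_bounded_extension \<nu> m p (p / (p - 1)) E"
    unfolding is_bounded_extension_def
    by (intro conjI ballI allI exI[of _ C]) (use E in \<open>auto simp: Lp_1_iff\<close>)
  then show ?thesis unfolding cfb_transform_Lp_def by (rule someI[of "is_bounded_extension \<nu> m p (p / (p - 1))"])
qed

end
end

section \<open>The convolution theorem for integrable and p-integrable functions\<close>

context bessel_order
begin

lemma bounded_extension_add:
  "is_bounded_extension \<nu> m p q E \<Longrightarrow> f \<in> Lp p \<nu> \<Longrightarrow> g \<in> Lp p \<nu> \<Longrightarrow>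
    AE x in \<beta>. E (\<lambda>y. f y + g y) x = E f x + E g x"
  by (simp add: is_bounded_extension_def)

text \<open>
  An extension acts on representatives; boundedness and additivity make it respect equality almost everywhere.
\<close>

lemma bounded_extension_cong:
  assumes ext: "is_bounded_extension \<nu> m p q E" and p: "p > 0" and q: "q > 0"
    and u: "u \<in> Lp p \<nu>" and v: "v \<in> Lp p \<nu>" and w: "(\<lambda>y. u y - v y) \<in> Lp p \<nu>"
    and eq: "AE x in \<beta>. u x = v x"
  shows "AE x in \<beta>. E u x = E v x"
proof -
  let ?w = "\<lambda>y. u y - v y"
  have Ew: "E ?w \<in> Lp q \<nu>" using ext w by (auto simp: is_bounded_extension_def)
  obtain C where C: "Lp_norm q \<nu> (E ?w) \<le> C * Lp_norm p \<nu> ?w"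
    using ext w unfolding is_bounded_extension_def by blast
  have "(\<integral>y. norm (?w y) powr p \<partial>\<beta>) = 0"
    using eq by (intro integral_eq_zero_AE) (auto elim!: eventually_mono)
  then have "Lp_norm q \<nu> (E ?w) \<le> 0" using C p by (simp add: Lp_norm_def)
  then have "(\<integral>y. norm (E ?w y) powr q \<partial>\<beta>) powr (1 / q) \<le> 0" by (simp add: Lp_norm_def)
  then have "(\<integral>y. norm (E ?w y) powr q \<partial>\<beta>) = 0"
    by (metis powr_eq_0_iff powr_ge_zero order_antisym)
  then have "AE y in \<beta>. norm (E ?w y) powr q = 0"
    using Ew by (subst (asm) integral_nonneg_eq_0_iff_AE) (auto simp: Lp_def)
  moreover have "AE x in \<beta>. E (\<lambda>y. v y + ?w y) x = E v x + E ?w x"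
    by (rule bounded_extension_add[OF ext v w])
  ultimately show ?thesis by eventually_elim simp
qed

context
  fixes m :: "real^2^2" and a b c d p q :: real
  assumes m: "m = vector [vector [a, b], vector [c, d]]" and b: "b \<noteq> 0"
    and p: "1 < p" "p \<le> 2" and q: "q = p / (p - 1)"
begin

lemma bounded_extension_nn_bound:
  assumes ext: "is_bounded_extension \<nu> m p q E"
  obtains C where "C \<ge> 0" "\<And>u. u \<in> Lp p \<nu> \<Longrightarrow>
    pow_int q \<beta> (E u) \<le> ennreal (C * (\<integral>x. norm (u x) powr p \<partial>\<beta>) powr (q / p))"
proof -
  have q0: "q > 0" using p by (simp add: q)
  obtain C where C: "\<forall>u\<in>Lp p \<nu>. Lp_norm q \<nu> (E u) \<le> C * Lp_norm p \<nu> u"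
    using ext unfolding is_bounded_extension_def by blast
  show ?thesis
  proof (rule that[of "\<bar>C\<bar> powr q"])
    fix u assume u: "u \<in> Lp p \<nu>"
    let ?I = "\<integral>x. norm (u x) powr p \<partial>\<beta>" and ?J = "\<integral>x. norm (E u x) powr q \<partial>\<beta>"
    have "E u \<in> Lp q \<nu>" using ext u by (simp add: is_bounded_extension_def)
    then have J: "pow_int q \<beta> (E u) = ennreal ?J"
      by (intro nn_integral_eq_integral) (auto simp: Lp_def)
    have "?J powr (1 / q) \<le> C * ?I powr (1 / p)" using C u by (simp add: Lp_norm_def)
    also have "\<dots> \<le> \<bar>C\<bar> * ?I powr (1 / p)" by (intro mult_right_mono) auto
    finally have "(?J powr (1 / q)) powr q \<le> (\<bar>C\<bar> * ?I powr (1 / p)) powr q"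
      using q0 by (intro powr_mono2) auto
    then have "?J \<le> \<bar>C\<bar> powr q * ?I powr (q / p)" using q0 by (simp add: powr_powr powr_mult)
    then show "pow_int q \<beta> (E u) \<le> ennreal (\<bar>C\<bar> powr q * ?I powr (q / p))"
      unfolding J by (rule ennreal_leI)
  qed simp
qed

text \<open>
  Split \<open>g\<close> into \<open>g\<^sub>n\<close>, where \<open>|g| \<ge> 1/n\<close>, and the rest \<open>h\<^sub>n\<close>. The identity holds for \<open>g\<^sub>n\<close>, which is integrable.
  So the difference \<open>D\<close> of the two sides depends on \<open>h\<^sub>n\<close> alone, and its \<open>L\<^sup>q\<close> norm is bounded by a multiple of the
  \<open>L\<^sup>p\<close> norm of \<open>h\<^sub>n\<close>, which tends to \<open>0\<close>.
\<close>

lemma convolution_theorem_Lp: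
  assumes ext: "is_bounded_extension \<nu> m p q E"
    and f: "f \<in> Lp 1 \<nu>" and g: "g \<in> Lp p \<nu>"
  shows "AE x in \<beta>.
    cfb_factor \<nu> m * E (convolution_inv \<nu> m f g) x = cfb_transform \<nu> m f x * E g x / chirp (d / b) x"
proof -
  let ?B = "\<beta>" and ?k = "cfb_factor \<nu> m" and ?F = "cfb_transform \<nu> m f"
  have q0: "q > 0" using p by (simp add: q)
  obtain A0 B0 where "L1_L2_operator ?B ?B (cfb_transform \<nu> m) A0 B0"
    using cfb_transform_operator[OF m b] by blast
  then interpret op: L1_L2_operator ?B ?B "cfb_transform \<nu> m" A0 B0 .
  have Em: "E u \<in> borel_measurable ?B" if "u \<in> Lp p \<nu>" for u
    using ext that by (auto simp: is_bounded_extension_def Lp_def)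
  have E_add: "AE x in ?B. E (\<lambda>y. u y + v y) x = E u x + E v x" if "u \<in> Lp p \<nu>" "v \<in> Lp p \<nu>" for u v
    by (rule bounded_extension_add[OF ext that])
  have E_ext: "AE x in ?B. E u x = cfb_transform \<nu> m u x" if "u \<in> Lp 1 \<nu>" "u \<in> Lp p \<nu>" for u
    using ext that by (simp add: is_bounded_extension_def)
  obtain C where C: "C \<ge> 0" and Ebd: "\<And>u. u \<in> Lp p \<nu> \<Longrightarrow>
      pow_int q ?B (E u) \<le> ennreal (C * (\<integral>x. norm (u x) powr p \<partial>?B) powr (q / p))"
    using bounded_extension_nn_bound[OF ext] by blast
  obtain C1 where C1: "C1 > 0" and convL: "\<And>g. g \<in> Lp p \<nu> \<Longrightarrow> convolution_inv \<nu> m f g \<in> Lp p \<nu>"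
    and convbd: "\<And>g. g \<in> Lp p \<nu> \<Longrightarrow> (\<integral>x. norm (convolution_inv \<nu> m f g x) powr p \<partial>?B) \<le> C1 * (\<integral>x. norm (g x) powr p \<partial>?B)"
    and convadd: "\<And>g h. g \<in> Lp p \<nu> \<Longrightarrow> h \<in> Lp p \<nu> \<Longrightarrow>
       AE x in ?B. convolution_inv \<nu> m f (\<lambda>y. g y + h y) x = convolution_inv \<nu> m f g x + convolution_inv \<nu> m f h x"
    using convolution_inv_Lp[OF m b f p(1)] by blast
  have gm: "g \<in> borel_measurable ?B" and gi: "integrable ?B (\<lambda>y. norm (g y) powr p)"
    using g by (auto simp: Lp_def)
  \<comment> \<open>Multiplying by \<open>n\<close> avoids the division by zero at \<open>n = 0\<close>, where \<open>g\<^sub>n\<close> is zero.\<close>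
  define gn where "gn n y = (if norm (g y) * real n \<ge> 1 then g y else 0)" for n :: nat and y
  define hn where "hn n y = (if norm (g y) * real n \<ge> 1 then 0 else g y)" for n :: nat and y
  have gsplit: "(\<lambda>y. gn n y + hn n y) = g" for n by (auto simp: gn_def hn_def)
  have gnm: "gn n \<in> borel_measurable ?B" for n unfolding gn_def using gm by measurable
  have hnm: "hn n \<in> borel_measurable ?B" for n unfolding hn_def using gm by measurable
  have gni: "integrable ?B (\<lambda>y. norm (gn n y) powr p)" and hni: "integrable ?B (\<lambda>y. norm (hn n y) powr p)" for n
  proof -
    show "integrable ?B (\<lambda>y. norm (gn n y) powr p)"
      by (rule Bochner_Integration.integrable_bound[OF gi]) (use gnm[of n] in simp, simp add: gn_def)
    show "integrable ?B (\<lambda>y. norm (hn n y) powr p)"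
      by (rule Bochner_Integration.integrable_bound[OF gi]) (use hnm[of n] in simp, simp add: hn_def)
  qed
  have gnp: "gn n \<in> Lp p \<nu>" for n unfolding Lp_def using gnm gni by simp
  have hnp: "hn n \<in> Lp p \<nu>" for n unfolding Lp_def using hnm hni by simp
  have gn1: "gn n \<in> Lp 1 \<nu>" for n
  proof -
    have "integrable ?B (gn n)"
    proof (rule Bochner_Integration.integrable_bound[OF _ gnm])
      show "integrable ?B (\<lambda>y. real n powr (p - 1) * norm (g y) powr p)" using gi by simp
      have "norm (gn n y) \<le> real n powr (p - 1) * norm (g y) powr p" for y
      proof (cases "norm (g y) * real n \<ge> 1")
        case True
        then have gy: "norm (g y) > 0" by (cases "g y = 0") auto
        have "1 powr (p - 1) \<le> (norm (g y) * real n) powr (p - 1)"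
          using True p by (intro powr_mono2) auto
        then have "norm (g y) * 1 \<le> norm (g y) * (norm (g y) powr (p - 1) * real n powr (p - 1))"
          by (intro mult_left_mono) (auto simp: powr_mult)
        also have "\<dots> = real n powr (p - 1) * norm (g y) powr p"
          using gy by (simp add: powr_diff)
        finally show ?thesis using True by (simp add: gn_def)
      qed (simp add: gn_def)
      then show "AE y in ?B. norm (gn n y) \<le> norm (real n powr (p - 1) * norm (g y) powr p)" by simp
    qed
    then show ?thesis by (simp add: Lp_1_iff)
  qed
  have hlim: "(\<lambda>n. \<integral>y. norm (hn n y) powr p \<partial>?B) \<longlonglongrightarrow> 0"
  proof -
    have "(\<lambda>n. \<integral>y. norm (hn n y) powr p \<partial>?B) \<longlonglongrightarrow> (\<integral>y. 0 \<partial>?B)"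
    proof (rule integral_dominated_convergence[OF _ _ gi])
      show "AE y in ?B. (\<lambda>n. norm (hn n y) powr p) \<longlonglongrightarrow> 0"
      proof (rule AE_I2)
        fix y
        show "(\<lambda>n. norm (hn n y) powr p) \<longlonglongrightarrow> 0"
        proof (cases "g y = 0")
          case False
          obtain k :: nat where k: "1 / norm (g y) \<le> real k" using real_arch_simple by blast
          have "norm (hn n y) powr p = 0" if "n \<ge> k" for n
          proof -
            have "1 / norm (g y) \<le> real n" using k that by linarith
            then have "1 \<le> norm (g y) * real n" using False by (simp add: field_simps)
            then show ?thesis by (simp add: hn_def)
          qed
          then show ?thesis by (intro tendsto_eventually) (auto simp: eventually_sequentially)
        qed (simp add: hn_def)
      qed
      show "(\<lambda>y. norm (hn n y) powr p) \<in> borel_measurable ?B" for n using hnm[of n] by simp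
      show "AE y in ?B. norm (norm (hn n y) powr p) \<le> norm (g y) powr p" for n by (simp add: hn_def)
    qed simp
    then show ?thesis by simp
  qed
  define M where "M = A0 * (\<integral>x. norm (f x) \<partial>?B)"
  have fi: "integrable ?B f" using f by (simp add: Lp_1_iff)
  have FM: "norm (?F x) \<le> M" for x unfolding M_def by (rule op.T_L1[OF fi])
  have M0: "M \<ge> 0" using FM[of 0] norm_ge_zero[of "?F 0"] by linarith
  have Fm: "?F \<in> borel_measurable ?B" by (rule op.T_measurable[OF fi])
  have chm: "chirp r \<in> borel_measurable ?B" for r by (rule borel_measurable_bessel_measure) simp
  let ?cv = "convolution_inv \<nu> m f"
  define D where "D x = ?k * E (?cv g) x - ?F x * E g x / chirp (d / b) x" for x
  define D1 where "D1 n x = ?k * E (?cv (hn n)) x" for n x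
  define D2 where "D2 n x = ?F x * E (hn n) x / chirp (d / b) x" for n x
  have D: "AE x in ?B. D x = D1 n x - D2 n x - 0" for n
  proof -
    let ?s = "\<lambda>y. ?cv (gn n) y + ?cv (hn n) y"
    have cs: "?s \<in> Lp p \<nu>"
      and cd: "(\<lambda>y. ?cv g y - ?s y) \<in> Lp p \<nu>"
    proof -
      have eq: "AE x in ?B. ?cv g x = ?s x" using convadd[OF gnp[of n] hnp[of n]] unfolding gsplit .
      have cm: "?cv u \<in> borel_measurable ?B" if "u \<in> Lp p \<nu>" for u using convL[OF that] by (simp add: Lp_def)
      have sm: "?s \<in> borel_measurable ?B" using cm[OF gnp] cm[OF hnp] by simp
      have "integrable ?B (\<lambda>x. norm (?cv g x) powr p)" using convL[OF g] by (simp add: Lp_def)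
      then have "integrable ?B (\<lambda>x. norm (?s x) powr p)"
        by (rule integrable_cong_AE_imp) (use sm eq in \<open>auto elim!: eventually_mono\<close>)
      then show "?s \<in> Lp p \<nu>" using sm by (simp add: Lp_def)
      have "integrable ?B (\<lambda>x. norm (?cv g x - ?s x) powr p)"
        by (rule integrable_cong_AE_imp[of _ "\<lambda>_. 0"]) (use cm[OF g] sm eq in \<open>auto elim!: eventually_mono\<close>)
      then show "(\<lambda>y. ?cv g y - ?s y) \<in> Lp p \<nu>" using cm[OF g] sm by (simp add: Lp_def)
    qed
    have "AE x in ?B. ?cv g x = ?s x" using convadd[OF gnp[of n] hnp[of n]] unfolding gsplit .
    then have 1: "AE x in ?B. E (?cv g) x = E ?s x"
      by (rule bounded_extension_cong[OF ext _ q0 convL[OF g] cs cd, rotated]) (use p in simp)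
    have 2: "AE x in ?B. E ?s x = E (?cv (gn n)) x + E (?cv (hn n)) x"
      by (rule E_add[OF convL[OF gnp] convL[OF hnp]])
    have 3: "AE x in ?B. E g x = E (gn n) x + E (hn n) x"
      using E_add[OF gnp[of n] hnp[of n]] unfolding gsplit .
    have 4: "AE x in ?B. E (?cv (gn n)) x = cfb_transform \<nu> m (?cv (gn n)) x"
      by (rule E_ext[OF convolution_theorem_L1(2)[OF m b f gn1] convL[OF gnp]])
    have 5: "AE x in ?B. E (gn n) x = cfb_transform \<nu> m (gn n) x"
      by (rule E_ext[OF gn1 gnp])
    show ?thesis using 1 2 3 4 5
    proof eventually_elim
      case (elim x)
      have "D x = ?k * cfb_transform \<nu> m (?cv (gn n)) x + D1 n x - (?F x * cfb_transform \<nu> m (gn n) x / chirp (d / b) x + D2 n x)"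
        unfolding D_def D1_def D2_def elim by (simp add: distrib_left add_divide_distrib)
      then show ?case unfolding convolution_theorem_L1(1)[OF m b f gn1] by simp
    qed
  qed
  have D1m: "D1 n \<in> borel_measurable ?B" for n unfolding D1_def[abs_def] using Em[OF convL[OF hnp]] by simp
  have D2m: "D2 n \<in> borel_measurable ?B" for n unfolding D2_def[abs_def] using Fm Em[OF hnp[of n]] chm[of "d / b"] by simp
  define \<sigma> where "\<sigma> n = (\<integral>y. norm (hn n y) powr p \<partial>?B)" for n
  have \<sigma>0: "\<sigma> n \<ge> 0" for n by (simp add: \<sigma>_def)
  define c1 where "c1 n = norm ?k powr q * (C * (C1 * \<sigma> n) powr (q / p))" for n
  define c2 where "c2 n = M powr q * (C * \<sigma> n powr (q / p))" for n
  have qp: "q / p > 0" using q0 p by simp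
  have l1: "pow_int q ?B (D1 n) \<le> ennreal (c1 n)" for n
  proof -
    have "pow_int q ?B (D1 n) = ennreal (norm ?k powr q) * pow_int q ?B (\<lambda>x. E (?cv (hn n)) x)"
      using Em[OF convL[OF hnp[of n]]] by (simp add: D1_def norm_mult powr_mult ennreal_mult nn_integral_cmult)
    also have "\<dots> \<le> ennreal (norm ?k powr q) * ennreal (C * (\<integral>x. norm (?cv (hn n) x) powr p \<partial>?B) powr (q / p))"
      by (intro mult_left_mono Ebd convL hnp) simp
    also have "\<dots> \<le> ennreal (norm ?k powr q) * ennreal (C * (C1 * \<sigma> n) powr (q / p))"
      using convbd[OF hnp[of n]] C qp unfolding \<sigma>_def[symmetric]
      by (intro mult_left_mono ennreal_leI powr_mono2) auto
    finally show ?thesis using C by (simp add: c1_def ennreal_mult)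
  qed
  have l2: "pow_int q ?B (D2 n) \<le> ennreal (c2 n)" for n
  proof -
    have "pow_int q ?B (D2 n) \<le> (\<integral>\<^sup>+x. ennreal (M powr q) * ennreal (norm (E (hn n) x) powr q) \<partial>?B)"
    proof (rule nn_integral_mono)
      fix x
      have "norm (D2 n x) \<le> M * norm (E (hn n) x)"
        using FM[of x] by (simp add: D2_def norm_mult norm_divide mult_right_mono)
      then have "norm (D2 n x) powr q \<le> (M * norm (E (hn n) x)) powr q"
        using q0 by (intro powr_mono2) auto
      then show "ennreal (norm (D2 n x) powr q) \<le> ennreal (M powr q) * ennreal (norm (E (hn n) x) powr q)"
        using M0 by (simp add: powr_mult ennreal_mult[symmetric] ennreal_leI)
    qed
    also have "\<dots> = ennreal (M powr q) * pow_int q ?B (E (hn n))"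
      using Em[OF hnp[of n]] by (simp add: nn_integral_cmult)
    also have "\<dots> \<le> ennreal (M powr q) * ennreal (C * \<sigma> n powr (q / p))"
      unfolding \<sigma>_def by (intro mult_left_mono Ebd hnp) simp
    finally show ?thesis using C by (simp add: c2_def ennreal_mult)
  qed
  have \<sigma>lim: "\<sigma> \<longlonglongrightarrow> 0" using hlim by (simp add: \<sigma>_def[abs_def])
  have "AE x in ?B. D x = 0"
  proof (rule AE_eq_zero_of_powr_integral[OF q0, where c = "\<lambda>n. ennreal (3 powr q) * (ennreal (c1 n) + ennreal (c2 n) + ennreal 0)"])
    show "D \<in> borel_measurable ?B"
      unfolding D_def[abs_def] using Em[OF convL[OF g]] Fm Em[OF g] chm[of "d / b"] by simp
    fix n
    have "pow_int q ?B D = pow_int q ?B (\<lambda>x. D1 n x - D2 n x - 0)"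
      by (rule nn_integral_cong_AE) (use D[of n] in \<open>auto elim!: eventually_mono\<close>)
    also have "\<dots> \<le> ennreal (3 powr q) * (pow_int q ?B (D1 n) + pow_int q ?B (D2 n)
        + pow_int q ?B (\<lambda>x. 0::complex))"
      by (rule nn_integral_norm_diff3_powr_le[OF q0 D1m D2m]) simp
    also have "\<dots> \<le> ennreal (3 powr q) * (ennreal (c1 n) + ennreal (c2 n) + ennreal 0)"
      by (intro mult_left_mono add_mono l1 l2) auto
    finally show "pow_int q ?B D \<le> ennreal (3 powr q) * (ennreal (c1 n) + ennreal (c2 n) + ennreal 0)" .
  next
    have "c1 \<longlonglongrightarrow> norm ?k powr q * (C * (C1 * 0) powr (q / p))"
      unfolding c1_def[abs_def] using qp C1 \<sigma>0
      by (intro tendsto_mult tendsto_const tendsto_powr' \<sigma>lim) auto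
    moreover have "c2 \<longlonglongrightarrow> M powr q * (C * 0 powr (q / p))"
      unfolding c2_def[abs_def] using qp \<sigma>0
      by (intro tendsto_mult tendsto_const tendsto_powr' \<sigma>lim) auto
    ultimately have "(\<lambda>n. ennreal (3 powr q) * (ennreal (c1 n) + ennreal (c2 n) + ennreal 0)) \<longlonglongrightarrow>
        ennreal (3 powr q) * (ennreal 0 + ennreal 0 + ennreal 0)"
      by (intro ennreal_tendsto_cmult tendsto_add tendsto_ennrealI tendsto_const) auto
    then show "(\<lambda>n. ennreal (3 powr q) * (ennreal (c1 n) + ennreal (c2 n) + ennreal 0)) \<longlonglongrightarrow> 0" by simp
  qed
  then show ?thesis by eventually_elim (simp add: D_def)
qed

end
end

theorem proposition3p6:
  fixes \<nu> a b c d :: real and m :: "real^2^2"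
  assumes "\<nu> > - 1 / 2"
    and "m = vector [vector [a, b], vector [c, d]]"
    and "det m = 1"
    and "b \<noteq> 0"
  shows
    "(\<forall>f \<in> Lp 1 \<nu>. \<forall>g \<in> Lp 1 \<nu>. \<forall>x :: real.
        of_real (c_const \<nu>) / (\<i> * of_real b) powr of_real (\<nu> + 1) *
          cfb_transform \<nu> m (convolution_inv \<nu> m f g) x =
        exp (- (\<i> / 2) * of_real (d / b * x\<^sup>2)) * cfb_transform \<nu> m f x * cfb_transform \<nu> m g x) \<and>
     (\<forall>p :: real. 1 < p \<and> p \<le> 2 \<longrightarrow>
       (\<forall>f \<in> Lp 1 \<nu>. \<forall>g \<in> Lp p \<nu>. AE x in lebesgue_on {0..}.
          of_real (c_const \<nu>) / (\<i> * of_real b) powr of_real (\<nu> + 1) *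
            cfb_transform_Lp \<nu> m p (convolution_inv \<nu> m f g) x =
          exp (- (\<i> / 2) * of_real (d / b * x\<^sup>2)) * cfb_transform \<nu> m f x *
            cfb_transform_Lp \<nu> m p g x))"
proof -
  interpret bessel_order \<nu> by unfold_locales (fact assms(1))
  have k: "of_real (c_const \<nu>) / (\<i> * of_real b) powr of_real (\<nu> + 1) = cfb_factor \<nu> m"
    using m_entries(2)[OF assms(2,4)] by (simp add: cfb_factor_def)
  show ?thesis
  proof (intro conjI ballI allI impI)
    fix f g and x :: real
    assume "f \<in> Lp 1 \<nu>" "g \<in> Lp 1 \<nu>"
    from convolution_theorem_L1(1)[OF assms(2,4) this]
    show "of_real (c_const \<nu>) / (\<i> * of_real b) powr of_real (\<nu> + 1) * cfb_transform \<nu> m (convolution_inv \<nu> m f g) x =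
        exp (- (\<i> / 2) * of_real (d / b * x\<^sup>2)) * cfb_transform \<nu> m f x * cfb_transform \<nu> m g x"
      unfolding k chirp_inverse by simp
  next
    fix p :: real and f g
    assume p: "1 < p \<and> p \<le> 2" and f: "f \<in> Lp 1 \<nu>" and g: "g \<in> Lp p \<nu>"
    have "is_bounded_extension \<nu> m p (p / (p - 1)) (cfb_transform_Lp \<nu> m p)"
      using p by (intro bounded_extension_cfb_transform_Lp[OF assms(2,4)]) auto
    then have "AE x in bessel_measure \<nu>. cfb_factor \<nu> m * cfb_transform_Lp \<nu> m p (convolution_inv \<nu> m f g) x =
        cfb_transform \<nu> m f x * cfb_transform_Lp \<nu> m p g x / chirp (d / b) x"
      using p by (intro convolution_theorem_Lp[OF assms(2,4) _ _ refl _ f g]) auto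
    then show "AE x in lebesgue_on {0..}.
          of_real (c_const \<nu>) / (\<i> * of_real b) powr of_real (\<nu> + 1) * cfb_transform_Lp \<nu> m p (convolution_inv \<nu> m f g) x =
          exp (- (\<i> / 2) * of_real (d / b * x\<^sup>2)) * cfb_transform \<nu> m f x * cfb_transform_Lp \<nu> m p g x"
      unfolding AE_bessel_measure_lebesgue k chirp_inverse by eventually_elim simp
  qed
qed

end
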